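(* Let $(A,\Delta)$ be a CQG Hopf $*$-algebra and $B\subseteq A$ a unital right coideal $*$-subalgebra. Let $g\in\mathscr{U}$ be a positive grouplike element (i.e. a character of $A$ that is positive in $\mathscr{U}$) such that $\Phi_C$ is $g$-balanced, and let $\psi_{\mathcal{I}}=\sum_\beta\mathrm{Tr}(\mu_\beta\,-)$ be the associated $g$-invariant positive functional on $\mathcal{I}$, with $\kappa(x)=\mu x\mu^{-1}$ for $x\in\mathscr{I}$. The functional $$\varphi_{\mathcal{D}}:\mathcal{D}(B,\mathcal{I})\to\mathbb{C},\qquad xb\mapsto\psi_{\mathcal{I}}(x)\Phi_A(b),\qquad b\in B,\ x\in\mathcal{I},$$ is a positive functional on $\mathcal{D}(B,\mathcal{I})$. Moreover, $\varphi_{\mathcal{D}}$ is modular, i.e. $\varphi_{\mathcal{D}}(XY)=\varphi_{\mathcal{D}}(Y\sigma_{\mathcal{D}}(X))$ for all $X,Y\in\mathcal{D}(B,\mathcal{I})$, with modular automorphism given by $$\sigma_{\mathcal{D}}(yb)=\kappa(y)\,\sigma_B(g^{-1}\rhd b),\qquad y\in\mathcal{I},\ b\in B.$$ The functional $\varphi_{\mathcal{D}}$ is $g$-invariant in the sense that $$\varphi_{\mathcal{D}}(x\rhd(yb)\lhd a)=\varepsilon(x)\,\varphi_{\mathcal{D}}(yb)\,\tau(a,g),\qquad x\in\mathscr{U},\ a\in A,\ y\in\mathcal{I},\ b\in B.$$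
   Context: A CQG Hopf $*$-algebra $(A,\Delta)$ is a Hopf $*$-algebra with a (unique) invariant state $\Phi_A$: $(\mathrm{id}\otimes\Phi_A)\Delta(a)=\Phi_A(a)1=(\Phi_A\otimes\mathrm{id})\Delta(a)$, $\Phi_A(1)=1$, $\Phi_A(a^*a)\ge0$. Counit $\varepsilon$, antipode $S_A$, $\Delta(a)=a_{(1)}\otimes a_{(2)}$. $\mathscr{U}=\mathrm{Lin}(A,\mathbb{C})$ is a unital $*$-algebra via $(\omega\chi)(a)=(\omega\otimes\chi)\Delta(a)$, $\omega^*(a)=\overline{\omega(S_A(a)^* )}$; $\tau(a,\omega)=\omega(a)$; $\varepsilon(x)=\tau(1_A,x)$ for $x\in\mathscr{U}$; $\tau(a,S(x))=\tau(S_A(a),x)$. Admissible $*$-representations of $\mathscr{U}$ are those on finite-dimensional Hilbert spaces of the form $\pi(x)v=\tau(v_{(1)},x)v_{(0)}$ for a unitary right $A$-comodule; with $(\mathcal{H}_\alpha,\pi_\alpha)$ the irreducible ones up to equivalence, $\mathscr{U}\cong\prod_\alpha B(\mathcal{H}_\alpha)$, and positivity in $\mathscr{U}$ means positivity of every component. $B\subseteq A$ is a unital $*$-subalgebra with $\Delta(B)\subseteq B\otimes A$. $\sigma_B$ is the unique automorphism of $B$ with $\Phi_A(bc)=\Phi_A(c\sigma_B(b))$ for $b,c\in B$. Put $B_+=B\cap\ker\varepsilon$, $C=A/AB_+$ (quotient left $A$-module coalgebra, cosemisimple), $1_C$ the class of $1_A$, $\mathscr{I}=\mathrm{Lin}(C,\mathbb{C})\subseteq\mathscr{U}$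 the unital $*$-subalgebra of functionals vanishing on $AB_+$. Admissible $\mathscr{I}$-representations are subrepresentations of restrictions of admissible $\mathscr{U}$-representations; with $\mathcal{G}_\beta$ the irreducible ones up to equivalence, $\mathscr{I}=\prod_\beta\mathrm{End}(\mathcal{G}_\beta)$ and $\mathcal{I}=\bigoplus_\beta\mathrm{End}(\mathcal{G}_\beta)$. $\Phi_C\in\mathcal{I}$ is the self-adjoint support projection of the $*$-representation $\omega\mapsto\omega(1_C)$ of $\mathscr{I}$, also regarded as a functional on $A$; $\mathcal{I}=\{\Phi_C(a\,-)\mid a\in A\}$ where $\Phi_C(a\,-)$ is $c\mapsto\Phi_C(ac)$. $\mathscr{I}$ and $\mathcal{I}$ are right $A$-modules by $\tau(c,x\lhd a)=\tau(ac,x)$, $a \in A$, $c\in C$. $\Phi_C$ is $g$-balanced if $\Phi_C=S(\Phi_C)g$. In this case there is a unique functional $\psi_{\mathcal{I}}$ on $\mathcal{I}$ with $\psi_{\mathcal{I}}(\Phi_C(a\,-))=\tau(a,g)$; it satisfies $\psi_{\mathcal{I}}(x\lhd a)=\tau(a,g)\psi_{\mathcal{I}}(x)$, and (for $g$ positive) it is positive and of the form $\psi_{\mathcal{I}}(x)=\sum_\beta\mathrm{Tr}(\mu_\beta x_\beta)$ for a positive invertible element $\mu=(\mu_\beta)_\beta\in\mathscr{I}$. This is the "associated $g$-invariant positive functional". $\mathcal{D}(B,\mathcal{I})$ is the $*$-algebra spanned by products $yb$ with $y\in\mathcal{I},b\in B$, subject to the multiplication and $*$-structure of $B$ and $\mathcal{I}$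 and the commutation relations $$yb=b_{(1)}(y\lhd b_{(2)}),\qquad by=(y\lhd S_A^{-1}(b_{(2)}))b_{(1)},\qquad b\in B,\ y\in\mathcal{I};$$ the multiplication maps $B\otimes\mathcal{I}\to\mathcal{D}(B,\mathcal{I})$ and $\mathcal{I}\otimes B\to\mathcal{D}(B,\mathcal{I})$ are linear isomorphisms. For $x\in\mathscr{U}$, $b\in B$ put $x\rhd b=b_{(1)}\tau(b_{(2)},x)\in B$. Then $\mathcal{D}(B,\mathcal{I})$ is an $\mathscr{U}$-$A$-bimodule by $x\rhd(yb)=y(x\rhd b)$ and $(yb)\lhd a=(y\lhd a)b$. *)

theory Defs
  imports
    "HOL-Library.Poly_Mapping"
    "HOL-Library.Complex_Order"
    "Jordan_Normal_Form.Schur_Decomposition"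
begin

section \<open>Complex vector spaces and algebras\<close>

class scaleC =
  fixes scaleC :: "complex \<Rightarrow> 'a \<Rightarrow> 'a"  (infixr "*\<^sub>C" 75)

class complex_vector = scaleC + ab_group_add +
  assumes scaleC_add_right: "a *\<^sub>C (x + y) = a *\<^sub>C x + a *\<^sub>C y"
    and scaleC_add_left: "(a + b) *\<^sub>C x = a *\<^sub>C x + b *\<^sub>C x"
    and scaleC_scaleC: "a *\<^sub>C (b *\<^sub>C x) = (a * b) *\<^sub>C x"
    and scaleC_one [simp]: "1 *\<^sub>C x = x"

global_interpretation complex_vector:
  vector_space "scaleC :: complex \<Rightarrow> 'a \<Rightarrow> 'a::complex_vector"
  defines cspan = complex_vector.span
    and csubspace = complex_vector.subspace
  by unfold_locales (simp_all add: scaleC_add_right scaleC_add_left scaleC_scaleC)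

definition clinear :: "('a::complex_vector \<Rightarrow> 'b::complex_vector) \<Rightarrow> bool"
  where "clinear f \<longleftrightarrow> Vector_Spaces.linear scaleC scaleC f"

lemma clinear_iff:
  "clinear f \<longleftrightarrow> (\<forall>x y. f (x + y) = f x + f y) \<and> (\<forall>c x. f (c *\<^sub>C x) = c *\<^sub>C f x)"
  by (simp add: clinear_def Vector_Spaces.linear_iff complex_vector.vector_space_axioms)

definition clinear_on :: "'a::complex_vector set \<Rightarrow> ('a \<Rightarrow> 'b::complex_vector) \<Rightarrow> bool"
  where "clinear_on S f \<longleftrightarrow>
    (\<forall>x\<in>S. \<forall>y\<in>S. f (x + y) = f x + f y) \<and> (\<forall>c. \<forall>x\<in>S. f (c *\<^sub>C x) = c *\<^sub>C f x)"

definition cbilinear :: "('a::complex_vector \<Rightarrow> 'b::complex_vector \<Rightarrow> 'c::complex_vector) \<Rightarrow> bool"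
  where "cbilinear f \<longleftrightarrow> (\<forall>x. clinear (f x)) \<and> (\<forall>y. clinear (\<lambda>x. f x y))"

class complex_algebra = complex_vector + ring +
  assumes mult_scaleC_left: "(c *\<^sub>C x) * y = c *\<^sub>C (x * y)"
    and mult_scaleC_right: "x * (c *\<^sub>C y) = c *\<^sub>C (x * y)"

class complex_algebra_1 = complex_algebra + ring_1

class star =
  fixes star :: "'a \<Rightarrow> 'a"

class complex_star_algebra_1 = complex_algebra_1 + star +
  assumes star_star [simp]: "star (star x) = x"
    and star_add: "star (x + y) = star x + star y"
    and star_scaleC: "star (c *\<^sub>C x) = cnj c *\<^sub>C star x"
    and star_mult: "star (x * y) = star y * star x"

instantiation complex :: complex_algebra_1
begin
definition scaleC_complex :: "complex \<Rightarrow> complex \<Rightarrow> complex"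
  where [simp]: "scaleC_complex c z = c * z"
instance by standard (simp_all add: algebra_simps)
end

definition algebra_automorphism_on :: "'a::complex_algebra set \<Rightarrow> ('a \<Rightarrow> 'a) \<Rightarrow> bool"
  where "algebra_automorphism_on S f \<longleftrightarrow>
    bij_betw f S S \<and> clinear_on S f \<and> (\<forall>x\<in>S. \<forall>y\<in>S. f (x * y) = f x * f y)"

(* The two-sided inverse; only used for invertible elements. *)
definition ring_inverse :: "'a::ring_1 \<Rightarrow> 'a"
  where "ring_inverse x = (THE y. x * y = 1 \<and> y * x = 1)"


section \<open>The algebraic tensor product\<close>

text \<open>The free vector space on pairs, modulo the subspace spanned by the bilinearity relations.\<close>

inductive_set tensor_null :: "(('a::complex_vector \<times> 'b::complex_vector) \<Rightarrow>\<^sub>0 complex) set" where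
  zero: "0 \<in> tensor_null"
| add: "p \<in> tensor_null \<Longrightarrow> q \<in> tensor_null \<Longrightarrow> p + q \<in> tensor_null"
| scale: "p \<in> tensor_null \<Longrightarrow> Poly_Mapping.map ((*) c) p \<in> tensor_null"
| add_left: "Poly_Mapping.single (x + x', y) 1 - Poly_Mapping.single (x, y) 1
    - Poly_Mapping.single (x', y) 1 \<in> tensor_null"
| add_right: "Poly_Mapping.single (x, y + y') 1 - Poly_Mapping.single (x, y) 1
    - Poly_Mapping.single (x, y') 1 \<in> tensor_null"
| scale_left: "Poly_Mapping.single (c *\<^sub>C x, y) 1 - Poly_Mapping.single (x, y) c \<in> tensor_null"
| scale_right: "Poly_Mapping.single (x, c *\<^sub>C y) 1 - Poly_Mapping.single (x, y) c \<in> tensor_null"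

lemma lookup_smap: "Poly_Mapping.lookup (Poly_Mapping.map ((*) c) p) k = (c::complex) * Poly_Mapping.lookup p k"
  by (simp add: Poly_Mapping.map.rep_eq when_def)

lemma smap_minus_one: "Poly_Mapping.map ((*) (-1::complex)) p = - p"
  by (rule poly_mapping_eqI) (simp add: lookup_smap)

lemma smap_add: "Poly_Mapping.map ((*) (c::complex)) (p + q)
    = Poly_Mapping.map ((*) c) p + Poly_Mapping.map ((*) c) q"
  by (rule poly_mapping_eqI) (simp add: lookup_smap lookup_add algebra_simps)

lemma smap_diff: "Poly_Mapping.map ((*) (c::complex)) (p - q)
    = Poly_Mapping.map ((*) c) p - Poly_Mapping.map ((*) c) q"
  by (rule poly_mapping_eqI) (simp add: lookup_smap lookup_minus algebra_simps)

lemma smap_add_left: "Poly_Mapping.map ((*) (c + d :: complex)) p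
    = Poly_Mapping.map ((*) c) p + Poly_Mapping.map ((*) d) p"
  by (rule poly_mapping_eqI) (simp add: lookup_smap lookup_add algebra_simps)

lemma smap_smap: "Poly_Mapping.map ((*) (c::complex)) (Poly_Mapping.map ((*) d) p)
    = Poly_Mapping.map ((*) (c * d)) p"
  by (rule poly_mapping_eqI) (simp add: lookup_smap)

lemma smap_one: "Poly_Mapping.map ((*) (1::complex)) p = p"
  by (rule poly_mapping_eqI) (simp add: lookup_smap)

lemma tensor_null_uminus: "p \<in> tensor_null \<Longrightarrow> - p \<in> tensor_null"
  using tensor_null.scale[of p "-1"] by (simp add: smap_minus_one)

lemma tensor_null_diff: "p \<in> tensor_null \<Longrightarrow> q \<in> tensor_null \<Longrightarrow> p - q \<in> tensor_null"
  using tensor_null.add[OF _ tensor_null_uminus, of p q] by simp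

quotient_type (overloaded) ('a, 'b) tensor =
  "('a::complex_vector \<times> 'b::complex_vector) \<Rightarrow>\<^sub>0 complex" / "\<lambda>p q. p - q \<in> tensor_null"
proof -
  let ?R = "\<lambda>p q :: ('a \<times> 'b) \<Rightarrow>\<^sub>0 complex. p - q \<in> tensor_null"
  have "reflp ?R"
    by (simp add: reflp_def tensor_null.zero)
  moreover have "symp ?R"
  proof (rule sympI)
    fix p q
    assume "?R p q"
    from tensor_null_uminus[OF this] show "?R q p" by simp
  qed
  moreover have "transp ?R"
  proof (rule transpI)
    fix p q r
    assume "?R p q" "?R q r"
    from tensor_null.add[OF this] show "?R p r" by simp
  qed
  ultimately show "equivp ?R" by (rule equivpI)
qed

instantiation tensor :: (complex_vector, complex_vector) complex_vector
begin

lift_definition zero_tensor :: "('a, 'b) tensor" is 0 .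

lift_definition plus_tensor :: "('a, 'b) tensor \<Rightarrow> ('a, 'b) tensor \<Rightarrow> ('a, 'b) tensor" is "(+)"
proof -
  fix p p' q q' :: "('a \<times> 'b) \<Rightarrow>\<^sub>0 complex"
  assume "p - p' \<in> tensor_null" "q - q' \<in> tensor_null"
  from tensor_null.add[OF this] show "p + q - (p' + q') \<in> tensor_null"
    by (simp add: add_diff_add)
qed

lift_definition uminus_tensor :: "('a, 'b) tensor \<Rightarrow> ('a, 'b) tensor" is uminus
proof -
  fix p p' :: "('a \<times> 'b) \<Rightarrow>\<^sub>0 complex"
  assume "p - p' \<in> tensor_null"
  from tensor_null_uminus[OF this] show "- p - - p' \<in> tensor_null" by simp
qed

definition minus_tensor :: "('a, 'b) tensor \<Rightarrow> ('a, 'b) tensor \<Rightarrow> ('a, 'b) tensor"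
  where "s - t = s + - (t :: ('a, 'b) tensor)"

lift_definition scaleC_tensor :: "complex \<Rightarrow> ('a, 'b) tensor \<Rightarrow> ('a, 'b) tensor"
  is "\<lambda>c. Poly_Mapping.map ((*) c)"
proof -
  fix c and p p' :: "('a \<times> 'b) \<Rightarrow>\<^sub>0 complex"
  assume "p - p' \<in> tensor_null"
  from tensor_null.scale[OF this, of c]
  show "Poly_Mapping.map ((*) c) p - Poly_Mapping.map ((*) c) p' \<in> tensor_null"
    by (simp add: smap_diff)
qed

instance
proof
  fix s t u :: "('a, 'b) tensor" and c d :: complex
  show "s + t + u = s + (t + u)"
    by transfer (simp add: add.assoc tensor_null.zero)
  show "s + t = t + s"
    by transfer (simp add: add.commute tensor_null.zero)
  show "0 + s = s" by transfer (simp add: tensor_null.zero)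
  show "- s + s = 0" by transfer (simp add: tensor_null.zero)
  show "s - t = s + - t" by (rule minus_tensor_def)
  show "c *\<^sub>C (s + t) = c *\<^sub>C s + c *\<^sub>C t"
    by transfer (simp add: smap_add tensor_null.zero)
  show "(c + d) *\<^sub>C s = c *\<^sub>C s + d *\<^sub>C s"
    by transfer (simp add: smap_add_left tensor_null.zero)
  show "c *\<^sub>C (d *\<^sub>C s) = (c * d) *\<^sub>C s"
    by transfer (simp add: smap_smap tensor_null.zero)
  show "1 *\<^sub>C s = s"
    by transfer (simp add: smap_one tensor_null.zero)
qed

end

lift_definition tens :: "'a::complex_vector \<Rightarrow> 'b::complex_vector \<Rightarrow> ('a, 'b) tensor"
    (infixl "\<boxtimes>" 70)
  is "\<lambda>x y. Poly_Mapping.single (x, y) 1" .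

definition free_lift :: "('a \<Rightarrow> 'b \<Rightarrow> 'c::complex_vector) \<Rightarrow> (('a \<times> 'b) \<Rightarrow>\<^sub>0 complex) \<Rightarrow> 'c"
  where "free_lift f p = (\<Sum>(x, y)\<in>Poly_Mapping.keys p. Poly_Mapping.lookup p (x, y) *\<^sub>C f x y)"

(* For bilinear f this is the induced linear map on the tensor product, independent of the chosen
   representative (lemma tensor_lift_tens).  In Sweedler notation,
   tensor_lift (\<lambda>p q. f p q) (comult a) is f(a_(1), a_(2)). *)
definition tensor_lift ::
    "('a \<Rightarrow> 'b \<Rightarrow> 'c::complex_vector) \<Rightarrow> ('a::complex_vector, 'b::complex_vector) tensor \<Rightarrow> 'c"
  where "tensor_lift f t = free_lift f (rep_tensor t)"

(* The same for maps that are antilinear in both arguments. *)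
definition tensor_antilift ::
    "('a \<Rightarrow> 'b \<Rightarrow> 'c::complex_vector) \<Rightarrow> ('a::complex_vector, 'b::complex_vector) tensor \<Rightarrow> 'c"
  where "tensor_antilift f t = (\<Sum>(x, y)\<in>Poly_Mapping.keys (rep_tensor t). cnj (Poly_Mapping.lookup (rep_tensor t) (x, y)) *\<^sub>C f x y)"

lemma free_lift_superset:
  assumes "finite K" "Poly_Mapping.keys p \<subseteq> K"
  shows "free_lift f p = (\<Sum>(x, y)\<in>K. Poly_Mapping.lookup p (x, y) *\<^sub>C f x y)"
  unfolding free_lift_def
  by (rule sum.mono_neutral_left) (use assms in \<open>auto simp: in_keys_iff\<close>)

lemma free_lift_add: "free_lift f (p + q) = free_lift f p + free_lift f q"
proof -
  let ?K = "Poly_Mapping.keys p \<union> Poly_Mapping.keys q"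
  have "Poly_Mapping.keys (p + q) \<subseteq> ?K" by (rule Poly_Mapping.keys_add)
  then show ?thesis
    by (simp add: free_lift_superset[of ?K] lookup_add scaleC_add_left sum.distrib case_prod_unfold)
qed

lemma free_lift_scale: "free_lift f (Poly_Mapping.map ((*) c) p) = c *\<^sub>C free_lift f p"
proof -
  have "Poly_Mapping.keys (Poly_Mapping.map ((*) c) p) \<subseteq> Poly_Mapping.keys p"
    by (auto simp: in_keys_iff lookup_smap)
  then show ?thesis
    by (simp add: free_lift_superset[of "Poly_Mapping.keys p"] lookup_smap complex_vector.scale_sum_right
        scaleC_scaleC case_prod_unfold)
qed

lemma free_lift_uminus: "free_lift f (- p) = - free_lift f p"
  using free_lift_scale[of f "-1" p] by (simp add: smap_minus_one)

lemma free_lift_diff: "free_lift f (p - q) = free_lift f p - free_lift f q"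
  using free_lift_add[of f p "- q"] by (simp add: free_lift_uminus)

lemma free_lift_single: "free_lift f (Poly_Mapping.single (x, y) c) = c *\<^sub>C f x y"
  by (subst free_lift_superset[of "{(x, y)}"]) auto

lemma free_lift_null:
  assumes "cbilinear f" "p \<in> tensor_null"
  shows "free_lift f p = 0"
  using assms(2) assms(1)
  by induction (auto simp: free_lift_add free_lift_scale free_lift_diff free_lift_single
      cbilinear_def clinear_iff free_lift_def[of _ 0])

lemma tensor_lift_abs:
  assumes "cbilinear f"
  shows "tensor_lift f (abs_tensor p) = free_lift f p"
proof -
  have "rep_tensor (abs_tensor p) - p \<in> tensor_null"
    by (rule Quotient3_rep_abs[OF Quotient3_tensor]) (simp add: tensor_null.zero)
  from free_lift_null[OF assms this] show ?thesis
    by (simp add: tensor_lift_def free_lift_diff)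
qed

lemma tensor_lift_tens:
  assumes "cbilinear f"
  shows "tensor_lift f (x \<boxtimes> y) = f x y"
  using assms by (simp add: tens.abs_eq tensor_lift_abs free_lift_single)

lemma clinear_tensor_lift:
  assumes "cbilinear f"
  shows "clinear (tensor_lift f)"
  unfolding clinear_iff
proof safe
  fix s t :: "('a, 'b) tensor" and c :: complex
  obtain p q where "s = abs_tensor p" "t = abs_tensor q"
    using Quotient3_abs_rep[OF Quotient3_tensor] by metis
  then show "tensor_lift f (s + t) = tensor_lift f s + tensor_lift f t"
    and "tensor_lift f (c *\<^sub>C s) = c *\<^sub>C tensor_lift f s"
    by (simp_all add: plus_tensor.abs_eq scaleC_tensor.abs_eq tensor_lift_abs assms
        free_lift_add free_lift_scale)
qed

lemma clinear_apply_tensor_lift: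
  assumes "clinear F"
  shows "F (tensor_lift f t) = tensor_lift (\<lambda>x y. F (f x y)) t"
proof -
  interpret Vector_Spaces.linear scaleC scaleC F using assms by (simp add: clinear_def)
  show ?thesis by (simp add: tensor_lift_def free_lift_def sum scale case_prod_unfold)
qed

lemma cbilinear_tens: "cbilinear (\<boxtimes>)"
  unfolding cbilinear_def clinear_iff
proof (intro conjI allI)
  fix x x' :: 'a and y y' :: 'b and c :: complex
  show "x \<boxtimes> (y + y') = x \<boxtimes> y + x \<boxtimes> y'"
    by transfer (use tensor_null.add_right in \<open>simp add: diff_diff_eq\<close>)
  show "(x + x') \<boxtimes> y = x \<boxtimes> y + x' \<boxtimes> y"
    by transfer (use tensor_null.add_left in \<open>simp add: diff_diff_eq\<close>)
  show "x \<boxtimes> (c *\<^sub>C y) = c *\<^sub>C (x \<boxtimes> y)"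
    by transfer (use tensor_null.scale_right in \<open>simp add: map_single\<close>)
  show "(c *\<^sub>C x) \<boxtimes> y = c *\<^sub>C (x \<boxtimes> y)"
    by transfer (use tensor_null.scale_left in \<open>simp add: map_single\<close>)
qed

definition tensor_subspace ::
    "'a::complex_vector set \<Rightarrow> 'b::complex_vector set \<Rightarrow> ('a, 'b) tensor set"
  where "tensor_subspace V W = cspan {v \<boxtimes> w |v w. v \<in> V \<and> w \<in> W}"

definition tensor_mult ::
    "('a::complex_algebra, 'b::complex_algebra) tensor \<Rightarrow> ('a, 'b) tensor \<Rightarrow> ('a, 'b) tensor"
  where "tensor_mult s t =
    tensor_lift (\<lambda>x y. tensor_lift (\<lambda>x' y'. (x * x') \<boxtimes> (y * y')) t) s"

definition tensor_star ::
    "('a::complex_star_algebra_1, 'b::complex_star_algebra_1) tensor \<Rightarrow> ('a, 'b) tensor"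
  where "tensor_star = tensor_antilift (\<lambda>x y. star x \<boxtimes> star y)"


section \<open>CQG Hopf *-algebras\<close>

(* The superclass is given by the sort constraint on 'a, so that the polymorphic tensor product
   operations may be used in the axioms. *)
class hopf_star_algebra =
  fixes comult :: "'a::complex_star_algebra_1 \<Rightarrow> ('a, 'a) tensor"
    and counit :: "'a \<Rightarrow> complex"
    and antipode :: "'a \<Rightarrow> 'a"
  assumes comult_linear: "clinear comult"
    and counit_linear: "clinear counit"
    and antipode_linear: "clinear antipode"
    and comult_mult: "comult (a * b) = tensor_mult (comult a) (comult b)"
    and comult_one: "comult 1 = 1 \<boxtimes> 1"
    and comult_star: "comult (star a) = tensor_star (comult a)"
    and counit_mult: "counit (a * b) = counit a * counit b"
    and counit_one: "counit 1 = 1"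
    and coassoc: "tensor_lift (\<lambda>x z. tensor_lift (\<lambda>p q. p \<boxtimes> (q \<boxtimes> z)) (comult x)) (comult a)
      = tensor_lift (\<lambda>x z. x \<boxtimes> comult z) (comult a)"
    and counit_left: "tensor_lift (\<lambda>p q. counit p *\<^sub>C q) (comult a) = a"
    and counit_right: "tensor_lift (\<lambda>p q. counit q *\<^sub>C p) (comult a) = a"
    and antipode_left: "tensor_lift (\<lambda>p q. antipode p * q) (comult a) = counit a *\<^sub>C 1"
    and antipode_right: "tensor_lift (\<lambda>p q. p * antipode q) (comult a) = counit a *\<^sub>C 1"

class cqg_hopf_star_algebra =
  fixes haar :: "'a::hopf_star_algebra \<Rightarrow> complex"
  assumes haar_linear: "clinear haar"
    and haar_one: "haar 1 = 1"
    and haar_positive: "0 \<le> haar (star a * a)"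
    and haar_left_invariant: "tensor_lift (\<lambda>p q. haar q *\<^sub>C p) (comult a) = haar a *\<^sub>C 1"
    and haar_right_invariant: "tensor_lift (\<lambda>p q. haar p *\<^sub>C q) (comult a) = haar a *\<^sub>C 1"


section \<open>The dual algebra\<close>

typedef (overloaded) ('a::complex_vector) dual = "{f :: 'a \<Rightarrow> complex. clinear f}"
  by (rule exI[of _ "\<lambda>_. 0"]) (simp add: clinear_iff)

setup_lifting type_definition_dual

lift_definition tau :: "'a::complex_vector \<Rightarrow> 'a dual \<Rightarrow> complex" is "\<lambda>a f. f a" .

lemma dual_eqI: "(\<And>a. tau a x = tau a y) \<Longrightarrow> x = y"
  by transfer auto

lemma clinear_tau: "clinear (\<lambda>a. tau a x)"
  by transfer

lemma tau_add_left: "tau (a + b) x = tau a x + tau b x"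
  and tau_scaleC_left: "tau (c *\<^sub>C a) x = c * tau a x"
  using clinear_tau[of x] by (simp_all add: clinear_iff)

instantiation dual :: (complex_vector) complex_vector
begin
lift_definition zero_dual :: "'a dual" is "\<lambda>_. 0" by (simp add: clinear_iff)
lift_definition plus_dual :: "'a dual \<Rightarrow> 'a dual \<Rightarrow> 'a dual" is "\<lambda>f g a. f a + g a"
  by (simp add: clinear_iff algebra_simps)
lift_definition minus_dual :: "'a dual \<Rightarrow> 'a dual \<Rightarrow> 'a dual" is "\<lambda>f g a. f a - g a"
  by (simp add: clinear_iff algebra_simps)
lift_definition uminus_dual :: "'a dual \<Rightarrow> 'a dual" is "\<lambda>f a. - f a"
  by (simp add: clinear_iff)
lift_definition scaleC_dual :: "complex \<Rightarrow> 'a dual \<Rightarrow> 'a dual" is "\<lambda>c f a. c * f a"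
  by (simp add: clinear_iff algebra_simps)
instance by standard (transfer, simp add: algebra_simps)+
end

lemma tau_add_right: "tau a (x + y) = tau a x + tau a y"
  by transfer simp

lemma tau_scaleC_right: "tau a (c *\<^sub>C x) = c * tau a x"
  by transfer simp

lemma cbilinear_tau_mult: "cbilinear (\<lambda>p q. tau p x * tau q y)"
  by (simp add: cbilinear_def clinear_iff tau_add_left tau_scaleC_left algebra_simps)

instantiation dual :: (hopf_star_algebra) "{times, one, star}"
begin

lift_definition times_dual :: "'a dual \<Rightarrow> 'a dual \<Rightarrow> 'a dual"
  is "\<lambda>\<omega> \<chi> a. tensor_lift (\<lambda>p q. \<omega> p * \<chi> q) (comult a)"
proof -
  fix \<omega> \<chi> :: "'a \<Rightarrow> complex"
  assume "clinear \<omega>" "clinear \<chi>"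
  then have "cbilinear (\<lambda>p q. \<omega> p * \<chi> q)"
    by (simp add: cbilinear_def clinear_iff algebra_simps)
  from clinear_tensor_lift[OF this]
  show "clinear (\<lambda>a. tensor_lift (\<lambda>p q. \<omega> p * \<chi> q) (comult a))"
    by (simp add: clinear_iff comult_linear[unfolded clinear_iff])
qed

lift_definition one_dual :: "'a dual" is counit
  by (rule counit_linear)

lift_definition star_dual :: "'a dual \<Rightarrow> 'a dual" is "\<lambda>\<omega> a. cnj (\<omega> (star (antipode a)))"
  by (simp add: clinear_iff star_add star_scaleC antipode_linear[unfolded clinear_iff])

instance ..

end

lemma tau_times: "tau a (x * y) = tensor_lift (\<lambda>p q. tau p x * tau q y) (comult a)"
  by transfer simp

lemma tau_one: "tau a 1 = counit a"
  by transfer simp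

lemma tau_star: "tau a (star x) = cnj (tau (star (antipode a)) x)"
  by transfer simp

lemma tensor_lift_add_fun: "tensor_lift (\<lambda>p q. f p q + g p q) t = tensor_lift f t + tensor_lift g t"
  by (simp add: tensor_lift_def free_lift_def scaleC_add_right sum.distrib case_prod_unfold)

lemma tensor_lift_mult_fun: "tensor_lift (\<lambda>p q. c * f p q) t = c * tensor_lift f t" for c :: complex
  by (simp add: tensor_lift_def free_lift_def sum_distrib_left case_prod_unfold mult.left_commute)

instance dual :: (hopf_star_algebra) complex_algebra_1
proof
  fix x y z :: "'a dual" and c :: complex
  show "(x + y) * z = x * z + y * z"
    by (rule dual_eqI) (simp add: tau_times tau_add_right distrib_right tensor_lift_add_fun)
  show "x * (y + z) = x * y + x * z"
    by (rule dual_eqI) (simp add: tau_times tau_add_right distrib_left tensor_lift_add_fun)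
  show "(c *\<^sub>C x) * y = c *\<^sub>C (x * y)"
    by (rule dual_eqI) (simp add: tau_times tau_scaleC_right tensor_lift_mult_fun mult.assoc)
  show "x * (c *\<^sub>C y) = c *\<^sub>C (x * y)"
    by (rule dual_eqI) (simp add: tau_times tau_scaleC_right tensor_lift_mult_fun mult.left_commute)
  show "(0 :: 'a dual) \<noteq> 1"
  proof
    assume "(0 :: 'a dual) = 1"
    then have "tau 1 (0 :: 'a dual) = counit (1 :: 'a)" by (simp add: tau_one)
    then show False by (simp add: counit_one zero_dual.rep_eq tau.rep_eq)
  qed
  show "1 * x = x"
  proof (rule dual_eqI)
    fix a
    have "tau a x = tau (tensor_lift (\<lambda>p q. counit p *\<^sub>C q) (comult a)) x"
      by (simp add: counit_left)
    also have "\<dots> = tau a (1 * x)"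
      by (simp add: clinear_apply_tensor_lift[OF clinear_tau] tau_times tau_one tau_scaleC_left)
    finally show "tau a (1 * x) = tau a x" by simp
  qed
  show "x * 1 = x"
  proof (rule dual_eqI)
    fix a
    have "tau a x = tau (tensor_lift (\<lambda>p q. counit q *\<^sub>C p) (comult a)) x"
      by (simp add: counit_right)
    also have "\<dots> = tau a (x * 1)"
      by (simp add: clinear_apply_tensor_lift[OF clinear_tau] tau_times tau_one tau_scaleC_left
          mult.commute)
    finally show "tau a (x * 1) = tau a x" by simp
  qed
  show "x * y * z = x * (y * z)"
  proof (rule dual_eqI)
    fix a
    define G where "G = tensor_lift (\<lambda>q r. tau q y * tau r z)"
    have G: "clinear G"
      unfolding G_def by (rule clinear_tensor_lift[OF cbilinear_tau_mult])
    define F where "F = tensor_lift (\<lambda>p t. tau p x * G t)"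
    have bF: "cbilinear (\<lambda>p t. tau p x * G t)"
      using G by (simp add: cbilinear_def clinear_iff tau_add_left tau_scaleC_left algebra_simps)
    have F: "clinear F"
      unfolding F_def by (rule clinear_tensor_lift[OF bF])
    have Ft: "F (p \<boxtimes> t) = tau p x * G t" for p t
      unfolding F_def by (rule tensor_lift_tens[OF bF])
    have Gt: "G (q \<boxtimes> r) = tau q y * tau r z" for q r
      unfolding G_def by (rule tensor_lift_tens[OF cbilinear_tau_mult])
    have m: "clinear (\<lambda>w. w * c)" for c :: complex
      by (simp add: clinear_iff algebra_simps)
    have "tau a (x * y * z)
        = tensor_lift (\<lambda>b r. tensor_lift (\<lambda>p q. tau p x * tau q y) (comult b) * tau r z) (comult a)"
      by (simp add: tau_times)
    also have "\<dots> = tensor_lift (\<lambda>b r. tensor_lift (\<lambda>p q. tau p x * tau q y * tau r z) (comult b)) (comult a)"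
      by (simp only: clinear_apply_tensor_lift[OF m])
    also have "\<dots> = F (tensor_lift (\<lambda>b r. tensor_lift (\<lambda>p q. p \<boxtimes> (q \<boxtimes> r)) (comult b)) (comult a))"
      by (simp add: clinear_apply_tensor_lift[OF F] Ft Gt mult.assoc)
    also have "\<dots> = F (tensor_lift (\<lambda>p r. p \<boxtimes> comult r) (comult a))"
      by (simp only: coassoc)
    also have "\<dots> = tau a (x * (y * z))"
      by (simp add: clinear_apply_tensor_lift[OF F] Ft tau_times G_def)
    finally show "tau a (x * y * z) = tau a (x * (y * z))" .
  qed
qed

lift_definition dual_antipode :: "'a::hopf_star_algebra dual \<Rightarrow> 'a dual"
  is "\<lambda>x a. x (antipode a)"
  by (simp add: clinear_iff antipode_linear[unfolded clinear_iff])

lift_definition ract :: "'a::complex_algebra dual \<Rightarrow> 'a \<Rightarrow> 'a dual"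
  is "\<lambda>x a c. x (a * c)"
  by (simp add: clinear_iff distrib_left mult_scaleC_right)

definition lact :: "'a::hopf_star_algebra dual \<Rightarrow> 'a \<Rightarrow> 'a"
  where "lact x b = tensor_lift (\<lambda>p q. tau q x *\<^sub>C p) (comult b)"

definition grouplike :: "'a::hopf_star_algebra dual \<Rightarrow> bool"
  where "grouplike g \<longleftrightarrow> tau 1 g = 1 \<and> (\<forall>a b. tau (a * b) g = tau a g * tau b g)"


section \<open>Representations\<close>

definition mat_positive :: "complex mat \<Rightarrow> bool"
  where "mat_positive M \<longleftrightarrow>
    square_mat M \<and> (\<forall>v\<in>carrier_vec (dim_row M). 0 \<le> (M *\<^sub>v v) \<bullet>c v)"

definition mat_trace :: "'b::comm_monoid_add mat \<Rightarrow> 'b"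
  where "mat_trace M = (\<Sum>i<dim_row M. M $$ (i, i))"

(* A unitary right comodule structure on the Hilbert space C^n in the standard orthonormal basis:
   the coaction sends e_j to the sum of the e_i (x) u i j. *)
definition unitary_comodule :: "nat \<Rightarrow> (nat \<Rightarrow> nat \<Rightarrow> 'a::hopf_star_algebra) \<Rightarrow> bool"
  where "unitary_comodule n u \<longleftrightarrow>
    (\<forall>i<n. \<forall>j<n. comult (u i j) = (\<Sum>k<n. u i k \<boxtimes> u k j)) \<and>
    (\<forall>i<n. \<forall>j<n. counit (u i j) = (if i = j then 1 else 0)) \<and>
    (\<forall>i<n. \<forall>j<n. (\<Sum>k<n. star (u k i) * u k j) = (if i = j then 1 else 0)) \<and>
    (\<forall>i<n. \<forall>j<n. (\<Sum>k<n. u i k * star (u j k)) = (if i = j then 1 else 0))"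

(* The matrix of \<pi>(x) v = \<tau>(v_(1), x) v_(0). *)
definition comodule_rep :: "nat \<Rightarrow> (nat \<Rightarrow> nat \<Rightarrow> 'a::hopf_star_algebra) \<Rightarrow> 'a dual \<Rightarrow> complex mat"
  where "comodule_rep n u x = mat n n (\<lambda>(i, j). tau (u i j) x)"

definition admissible_U :: "nat \<Rightarrow> ('a::hopf_star_algebra dual \<Rightarrow> complex mat) \<Rightarrow> bool"
  where "admissible_U n \<pi> \<longleftrightarrow> (\<exists>u. unitary_comodule n u \<and> \<pi> = comodule_rep n u)"

definition irreducible_rep :: "'u set \<Rightarrow> nat \<Rightarrow> ('u \<Rightarrow> complex mat) \<Rightarrow> bool"
  where "irreducible_rep S n \<rho> \<longleftrightarrow> 0 < n \<and>
    (\<forall>W. W \<subseteq> carrier_vec n \<and> 0\<^sub>v n \<in> W \<and> (\<forall>v\<in>W. \<forall>w\<in>W. v + w \<in> W) \<and>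
        (\<forall>c. \<forall>v\<in>W. c \<cdot>\<^sub>v v \<in> W) \<and> (\<forall>x\<in>S. \<forall>v\<in>W. \<rho> x *\<^sub>v v \<in> W)
      \<longrightarrow> W = {0\<^sub>v n} \<or> W = carrier_vec n)"

definition equivalent_reps ::
    "'u set \<Rightarrow> nat \<Rightarrow> ('u \<Rightarrow> complex mat) \<Rightarrow> nat \<Rightarrow> ('u \<Rightarrow> complex mat) \<Rightarrow> bool"
  where "equivalent_reps S n \<rho> m \<sigma> \<longleftrightarrow> n = m \<and>
    (\<exists>T\<in>carrier_mat n n. invertible_mat T \<and> (\<forall>x\<in>S. T * \<rho> x = \<sigma> x * T))"

definition dual_positive :: "'a::hopf_star_algebra dual \<Rightarrow> bool"
  where "dual_positive x \<longleftrightarrow>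
    (\<forall>n \<pi>. admissible_U n \<pi> \<and> irreducible_rep UNIV n \<pi> \<longrightarrow> mat_positive (\<pi> x))"


section \<open>Coideal *-subalgebras and their dual algebras\<close>

definition right_coideal_star_subalgebra :: "'a::hopf_star_algebra set \<Rightarrow> bool"
  where "right_coideal_star_subalgebra B \<longleftrightarrow>
    csubspace B \<and> 1 \<in> B \<and> (\<forall>b\<in>B. \<forall>c\<in>B. b * c \<in> B) \<and> (\<forall>b\<in>B. star b \<in> B) \<and>
    (\<forall>b\<in>B. comult b \<in> tensor_subspace B UNIV)"

(* The left ideal A B_+; the coalgebra C is the quotient of A by it. *)
definition coideal_kernel :: "'a::hopf_star_algebra set \<Rightarrow> 'a set"
  where "coideal_kernel B = cspan {a * b |a b. b \<in> B \<and> counit b = 0}"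

(* Lin(C, \<complex>), as functionals on A. *)
definition full_I :: "'a::hopf_star_algebra set \<Rightarrow> 'a dual set"
  where "full_I B = {x. \<forall>a\<in>coideal_kernel B. tau a x = 0}"

(* Subrepresentations of restricted admissible representations; the invariant subspace is given by
   an isometry V from C^m onto it. *)
definition admissible_I ::
    "'a::hopf_star_algebra set \<Rightarrow> nat \<Rightarrow> ('a dual \<Rightarrow> complex mat) \<Rightarrow> bool"
  where "admissible_I B m \<rho> \<longleftrightarrow>
    (\<exists>n \<pi>. \<exists>V\<in>carrier_mat n m. admissible_U n \<pi> \<and> mat_adjoint V * V = 1\<^sub>m m \<and>
      (\<forall>x\<in>full_I B. \<rho> x \<in> carrier_mat m m \<and> \<pi> x * V = V * \<rho> x))"

definition complete_irreps ::
    "'a::hopf_star_algebra set \<Rightarrow> 'i set \<Rightarrow> ('i \<Rightarrow> nat) \<Rightarrow> ('i \<Rightarrow> 'a dual \<Rightarrow> complex mat) \<Rightarrow> bool"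
  where "complete_irreps B J d \<rho> \<longleftrightarrow>
    (\<forall>\<beta>\<in>J. admissible_I B (d \<beta>) (\<rho> \<beta>) \<and> irreducible_rep (full_I B) (d \<beta>) (\<rho> \<beta>)) \<and>
    (\<forall>\<beta>\<in>J. \<forall>\<gamma>\<in>J. equivalent_reps (full_I B) (d \<beta>) (\<rho> \<beta>) (d \<gamma>) (\<rho> \<gamma>) \<longrightarrow> \<beta> = \<gamma>) \<and>
    (\<forall>n \<sigma>. admissible_I B n \<sigma> \<and> irreducible_rep (full_I B) n \<sigma> \<longrightarrow>
      (\<exists>\<beta>\<in>J. equivalent_reps (full_I B) n \<sigma> (d \<beta>) (\<rho> \<beta>)))"

definition I_supp ::
    "'i set \<Rightarrow> ('i \<Rightarrow> nat) \<Rightarrow> ('i \<Rightarrow> 'u \<Rightarrow> complex mat) \<Rightarrow> 'u \<Rightarrow> 'i set"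
  where "I_supp J d \<rho> x = {\<beta>\<in>J. \<rho> \<beta> x \<noteq> 0\<^sub>m (d \<beta>) (d \<beta>)}"

(* The direct sum of the End(G_\<beta>) inside the direct product full_I B. *)
definition fin_I ::
    "'a::hopf_star_algebra set \<Rightarrow> 'i set \<Rightarrow> ('i \<Rightarrow> nat) \<Rightarrow> ('i \<Rightarrow> 'a dual \<Rightarrow> complex mat) \<Rightarrow> 'a dual set"
  where "fin_I B J d \<rho> = {x \<in> full_I B. finite (I_supp J d \<rho> x)}"

(* The self-adjoint support projection of the one-dimensional *-representation x \<mapsto> \<tau>(1, x):
   the central projection p with kernel full_I B * (1 - p). *)
definition support_projection ::
    "'a::hopf_star_algebra set \<Rightarrow> 'i set \<Rightarrow> ('i \<Rightarrow> nat) \<Rightarrow> ('i \<Rightarrow> 'a dual \<Rightarrow> complex mat) \<Rightarrow> 'a dual \<Rightarrow> bool"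
  where "support_projection B J d \<rho> p \<longleftrightarrow>
    p \<in> fin_I B J d \<rho> \<and> p * p = p \<and> star p = p \<and>
    (\<forall>x\<in>full_I B. x * p = p * x \<and> (tau 1 x = 0 \<longleftrightarrow> x * p = 0))"

definition modular_automorphism :: "'a::cqg_hopf_star_algebra set \<Rightarrow> ('a \<Rightarrow> 'a) \<Rightarrow> bool"
  where "modular_automorphism B \<sigma> \<longleftrightarrow>
    algebra_automorphism_on B \<sigma> \<and> (\<forall>b\<in>B. \<forall>c\<in>B. haar (b * c) = haar (c * \<sigma> b))"

definition balanced :: "'a::hopf_star_algebra dual \<Rightarrow> 'a dual \<Rightarrow> bool"
  where "balanced g p \<longleftrightarrow> p = dual_antipode p * g"

(* ract p a is the functional p(a -). *)
definition invariant_functional ::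
    "'a::hopf_star_algebra dual set \<Rightarrow> 'a dual \<Rightarrow> 'a dual \<Rightarrow> ('a dual \<Rightarrow> complex) \<Rightarrow> bool"
  where "invariant_functional I p g \<psi> \<longleftrightarrow>
    clinear_on I \<psi> \<and> (\<forall>a. \<psi> (ract p a) = tau a g)"

definition trace_density ::
    "'a::hopf_star_algebra set \<Rightarrow> 'i set \<Rightarrow> ('i \<Rightarrow> nat) \<Rightarrow> ('i \<Rightarrow> 'a dual \<Rightarrow> complex mat) \<Rightarrow>
      ('a dual \<Rightarrow> complex) \<Rightarrow> 'a dual \<Rightarrow> bool"
  where "trace_density B J d \<rho> \<psi> \<mu> \<longleftrightarrow>
    \<mu> \<in> full_I B \<and> (\<exists>\<nu>\<in>full_I B. \<mu> * \<nu> = 1 \<and> \<nu> * \<mu> = 1) \<and>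
    (\<forall>\<beta>\<in>J. mat_positive (\<rho> \<beta> \<mu>)) \<and>
    (\<forall>x\<in>fin_I B J d \<rho>. \<psi> x = (\<Sum>\<beta>\<in>I_supp J d \<rho> x. mat_trace (\<rho> \<beta> \<mu> * \<rho> \<beta> x)))"


section \<open>The Drinfeld double\<close>

definition double ::
    "'a::hopf_star_algebra set \<Rightarrow> 'a dual set \<Rightarrow> ('a \<Rightarrow> 'm) \<Rightarrow> ('a dual \<Rightarrow> 'm) \<Rightarrow>
      'm::complex_star_algebra_1 set"
  where "double B I jB jI = cspan {jI y * jB b |y b. y \<in> I \<and> b \<in> B}"

(* ps lists the summands of b_(1) (x) b_(2) in a decomposition inside B (x) A.  Such a list is
   needed wherever the first leg is fed to a map defined on B only. *)
definition sweedler :: "'a::hopf_star_algebra set \<Rightarrow> 'a \<Rightarrow> ('a \<times> 'a) list \<Rightarrow> bool"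
  where "sweedler B b ps \<longleftrightarrow>
    (\<forall>(p, q)\<in>set ps. p \<in> B) \<and> comult b = (\<Sum>(p, q)\<leftarrow>ps. p \<boxtimes> q)"

(* I need not have a unit, and then B is not contained in the double.  The double is therefore described
   as the span of the products inside a unital *-algebra containing copies of both B (via jB) and
   I (via jI).  Such an ambient algebra always exists: take the crossed product
   of B with I + \<complex>\<epsilon>, on which A acts on the right as well.  The conditions determine the
   *-algebra "double B I jB jI" up to isomorphism. *)
definition is_double ::
    "'a::hopf_star_algebra set \<Rightarrow> 'a dual set \<Rightarrow> ('a \<Rightarrow> 'm::complex_star_algebra_1) \<Rightarrow>
      ('a dual \<Rightarrow> 'm) \<Rightarrow> bool"
  where "is_double B I jB jI \<longleftrightarrow>
    clinear_on B jB \<and> jB 1 = 1 \<and> (\<forall>b\<in>B. \<forall>c\<in>B. jB (b * c) = jB b * jB c) \<and>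
    (\<forall>b\<in>B. jB (star b) = star (jB b)) \<and>
    clinear_on I jI \<and> (\<forall>x\<in>I. \<forall>y\<in>I. jI (x * y) = jI x * jI y) \<and>
    (\<forall>x\<in>I. jI (star x) = star (jI x)) \<and>
    (\<forall>y\<in>I. \<forall>b\<in>B. \<forall>ps. sweedler B b ps \<longrightarrow>
      jI y * jB b = (\<Sum>(p, q)\<leftarrow>ps. jB p * jI (ract y q)) \<and>
      jB b * jI y = (\<Sum>(p, q)\<leftarrow>ps. jI (ract y (inv_into UNIV antipode q)) * jB p)) \<and>
    (\<exists>T. clinear_on (tensor_subspace I B) T \<and>
      bij_betw T (tensor_subspace I B) (double B I jB jI) \<and>
      (\<forall>y\<in>I. \<forall>b\<in>B. T (y \<boxtimes> b) = jI y * jB b)) \<and>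
    (\<exists>T. clinear_on (tensor_subspace B I) T \<and>
      bij_betw T (tensor_subspace B I) (double B I jB jI) \<and>
      (\<forall>y\<in>I. \<forall>b\<in>B. T (b \<boxtimes> y) = jB b * jI y))"

definition double_bimodule ::
    "'a::hopf_star_algebra set \<Rightarrow> 'a dual set \<Rightarrow> ('a \<Rightarrow> 'm::complex_star_algebra_1) \<Rightarrow>
      ('a dual \<Rightarrow> 'm) \<Rightarrow> ('a dual \<Rightarrow> 'm \<Rightarrow> 'm) \<Rightarrow> ('m \<Rightarrow> 'a \<Rightarrow> 'm) \<Rightarrow> bool"
  where "double_bimodule B I jB jI L R \<longleftrightarrow>
    (\<forall>x. clinear_on (double B I jB jI) (L x)) \<and>
    (\<forall>a. clinear_on (double B I jB jI) (\<lambda>X. R X a)) \<and>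
    (\<forall>x. \<forall>y\<in>I. \<forall>b\<in>B. L x (jI y * jB b) = jI y * jB (lact x b)) \<and>
    (\<forall>a. \<forall>y\<in>I. \<forall>b\<in>B. R (jI y * jB b) a = jI (ract y a) * jB b)"

end

theory Submission
  imports Defs
begin

text \<open>
  Write \<open>\<Phi>\<close> for the Haar state and \<open>\<phi>\<close> for the functional on the double.  Moving an element of \<open>B\<close> past
  one of \<open>\<I>\<close> by the commutation relation gives two formulas, for \<open>y, z \<in> \<I>\<close> and \<open>b, c \<in> B\<close>:
  \<open>\<phi>(z b y) = \<psi>(zy) \<Phi>(b)\<close> (lemma \<open>phi_jI_jB_jI\<close>), because the Haar state is invariant, and
  \<open>\<phi>(b y c) = \<psi>(y) \<Phi>((g\<^sup>-\<^sup>1 \<rhd> b) c)\<close> (lemma \<open>phi_jB_jI_jB\<close>), because \<open>\<psi>\<close> is \<open>g\<close>-invariant.  The theorem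
  follows from them.

  Positivity.  An element of the double is a sum of products \<open>b\<^sub>i y\<^sub>i\<close>, and the first formula turns
  \<open>\<phi>(X\<^sup>* X)\<close> into \<open>\<Sum> \<psi>(y\<^sub>i\<^sup>* y\<^sub>j) \<Phi>(b\<^sub>i\<^sup>* b\<^sub>j)\<close>.  This is nonnegative by Schur's product theorem
  (\<open>schur_product_nonneg\<close>) once both Gram matrices are positive semidefinite.  For \<open>\<psi>\<close> this holds
  because it is a sum of traces with positive densities over *-representations of \<open>\<I>\<close>.

  Modularity.  The first formula and the trace property give \<open>\<phi>(xY) = \<phi>(Y \<kappa>(x))\<close>; the second one gives
  \<open>\<phi>(bY) = \<phi>(Y \<sigma>\<^sub>B(g\<^sup>-\<^sup>1 \<rhd> b))\<close>.  Together they say that \<open>\<sigma>\<close> is modular on products \<open>xb\<close>.  That \<open>\<sigma>\<close> is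
  multiplicative then follows from \<open>\<phi>(Z \<sigma>(XY)) = \<phi>(XYZ) = \<phi>(Z \<sigma>(X) \<sigma>(Y))\<close>, provided that \<open>\<phi>\<close> is
  nondegenerate (\<open>phi_nondegenerate\<close>).  By the second formula this comes down to the two factors.
  An invariant functional on a Hopf algebra is nondegenerate (\<open>haar_nondegenerate\<close>), and the
  Cauchy-Schwarz inequality carries this over to \<open>B\<close>.  For \<open>\<psi>\<close> one computes
  \<open>\<psi>((\<Phi>\<^sub>C \<lhd> a) y) = \<tau>(a\<^sub>1, g) \<tau>(S\<^sup>-\<^sup>1(a\<^sub>2), y)\<close>, which determines \<open>y\<close> as \<open>g\<close> and \<open>S\<close> are invertible
  (\<open>invariant_functional_nondegenerate\<close>).

  The algebra below these arguments is Sweedler calculus: the antipode is antimultiplicative with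
  inverse \<open>a \<mapsto> S(a\<^sup>*)\<^sup>*\<close>, and the functionals that factor through \<open>C\<close> form a *-algebra.
\<close>

section \<open>Linear maps and tensors as finite sums\<close>

lemma clinear_id: "clinear (\<lambda>x. x)"
  and clinear_scale: "clinear f \<Longrightarrow> clinear (\<lambda>x. c *\<^sub>C f x)"
  and clinear_scale_vector: "clinear h \<Longrightarrow> clinear (\<lambda>x. h x *\<^sub>C v)"
  by (simp_all add: clinear_iff scaleC_add_right scaleC_add_left scaleC_scaleC mult.commute)

lemma clinear_mult_left: "clinear f \<Longrightarrow> clinear (\<lambda>x. f x * c)"
  and clinear_mult_right: "clinear f \<Longrightarrow> clinear (\<lambda>x. c * f x)"
  for f :: "'a::complex_vector \<Rightarrow> 'b::complex_algebra"
  by (simp_all add: clinear_iff distrib_left distrib_right mult_scaleC_left mult_scaleC_right)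

lemma clinear_compose: "clinear F \<Longrightarrow> clinear f \<Longrightarrow> clinear (\<lambda>x. F (f x))"
  by (simp add: clinear_iff)

lemma cbilinearI:
  "(\<And>x. clinear (\<lambda>y. f x y)) \<Longrightarrow> (\<And>y. clinear (\<lambda>x. f x y)) \<Longrightarrow> cbilinear f"
  by (simp add: cbilinear_def)

lemma clinear_sum_list: "clinear f \<Longrightarrow> f (sum_list xs) = sum_list (map f xs)"
proof (induction xs)
  case Nil
  then have "f (0 *\<^sub>C 0) = 0 *\<^sub>C f 0" by (simp only: clinear_iff)
  then show ?case by simp
qed (simp add: clinear_iff)

lemma clinear_on_sum_list:
  assumes "csubspace S" "clinear_on S f" "set xs \<subseteq> S"
  shows "f (sum_list xs) = sum_list (map f xs)"
proof -
  have "sum_list xs \<in> S \<and> f (sum_list xs) = sum_list (map f xs)" using assms(3)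
  proof (induction xs)
    case Nil
    have "0 \<in> S" using assms(1) by (simp add: complex_vector.subspace_0)
    then have "f (0 *\<^sub>C 0) = 0 *\<^sub>C f 0" using assms(2) unfolding clinear_on_def by blast
    then show ?case using \<open>0 \<in> S\<close> by simp
  next
    case (Cons x xs)
    then show ?case using assms(1,2)
      by (auto simp: clinear_on_def complex_vector.subspace_add)
  qed
  then show ?thesis by simp
qed

text \<open>Maps that are linear only on a subspace cannot be fed to \<open>tensor_lift\<close>, which wants bilinear maps
  on the whole space; their linear extensions can.\<close>

lemma clinear_on_extend:
  fixes f :: "'a::complex_vector \<Rightarrow> 'b::complex_vector"
  assumes "csubspace S" "clinear_on S f"
  obtains f' where "clinear f'" "\<And>x. x \<in> S \<Longrightarrow> f' x = f x"
proof -
  interpret VS: vector_space_pair "scaleC :: complex \<Rightarrow> 'a \<Rightarrow> 'a" "scaleC :: complex \<Rightarrow> 'b \<Rightarrow> 'b" ..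
  obtain E where E: "E \<subseteq> S" "\<not> complex_vector.dependent E" "S \<subseteq> cspan E"
    using complex_vector.basis_exists[of S] by metis
  obtain f' where f': "Vector_Spaces.linear scaleC scaleC f'" "\<And>x. x \<in> E \<Longrightarrow> f' x = f x"
    using VS.linear_independent_extend[OF E(2), of f] by blast
  interpret f': Vector_Spaces.linear scaleC scaleC f' by (rule f'(1))
  have "x \<in> S \<and> f' x = f x" if "x \<in> cspan E" for x using that
  proof (induction rule: complex_vector.span_induct_alt)
    case base
    have "0 \<in> S" using assms(1) by (simp add: complex_vector.subspace_0)
    then have "f (0 *\<^sub>C 0) = 0 *\<^sub>C f 0" using assms(2) unfolding clinear_on_def by blast
    then show ?case using \<open>0 \<in> S\<close> by (simp add: f'.zero)
  next
    case (step c x y)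
    then have "x \<in> S" using E(1) by blast
    then have "c *\<^sub>C x \<in> S" using assms(1) by (simp add: complex_vector.subspace_scale)
    then show ?case using step \<open>x \<in> S\<close> assms(1,2) f'(2)
      by (simp add: f'.add f'.scale clinear_on_def complex_vector.subspace_add)
  qed
  then show ?thesis using that f'(1) E(3) unfolding clinear_def by blast
qed

lemma clinear_on_inv_into:
  assumes "csubspace S" "bij_betw f S T" "clinear_on S f"
  shows "clinear_on T (inv_into S f)"
proof -
  have inv: "inv_into S f t \<in> S" "f (inv_into S f t) = t" if "t \<in> T" for t
    using that assms(2) by (auto simp: bij_betw_def inv_into_into f_inv_into_f)
  have eq: "inv_into S f (f s) = s" if "s \<in> S" for s
    using that assms(2) by (auto simp: bij_betw_def)
  have "inv_into S f (s + t) = inv_into S f s + inv_into S f t" if "s \<in> T" "t \<in> T" for s t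
    using eq[of "inv_into S f s + inv_into S f t"] inv[OF that(1)] inv[OF that(2)] assms(1,3)
    by (simp add: clinear_on_def complex_vector.subspace_add)
  moreover have "inv_into S f (c *\<^sub>C s) = c *\<^sub>C inv_into S f s" if "s \<in> T" for c s
    using eq[of "c *\<^sub>C inv_into S f s"] inv[OF that] assms(1,3)
    by (simp add: clinear_on_def complex_vector.subspace_scale)
  ultimately show ?thesis by (simp add: clinear_on_def)
qed

lemma span_products_sum_list:
  assumes "x \<in> cspan {f y b |y b. y \<in> S \<and> b \<in> U}"
    and "\<And>c y b. y \<in> S \<Longrightarrow> b \<in> U \<Longrightarrow> \<exists>y'\<in>S. c *\<^sub>C f y b = f y' b"
  obtains ps where "set ps \<subseteq> S \<times> U" "x = (\<Sum>(y, b)\<leftarrow>ps. f y b)"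
proof -
  have "\<exists>ps. set ps \<subseteq> S \<times> U \<and> x = (\<Sum>(y, b)\<leftarrow>ps. f y b)" using assms(1)
  proof (induction rule: complex_vector.span_induct_alt)
    case base
    show ?case by (rule exI[of _ "[]"]) simp
  next
    case (step c x y)
    then obtain ps where ps: "set ps \<subseteq> S \<times> U" "y = (\<Sum>(y, b)\<leftarrow>ps. f y b)" by blast
    from step(1) obtain z b where zb: "x = f z b" "z \<in> S" "b \<in> U" by blast
    from assms(2)[OF zb(2,3), of c] obtain z' where "z' \<in> S" "c *\<^sub>C x = f z' b" using zb(1) by blast
    then show ?case using ps zb(3) by (intro exI[of _ "(z', b) # ps"]) simp
  qed
  then show ?thesis using that by blast
qed

text \<open>Expanding the second legs in a basis of the span reduces a bilinear expression to its
  values on single vectors.  This replaces the choice of linearly independent legs in a tensor.\<close>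

lemma sum_list_zero_by_functionals:
  fixes V :: "'b::complex_vector set" and f :: "'a \<Rightarrow> 'b \<Rightarrow> 'c::complex_vector"
  assumes V: "csubspace V" "\<And>y b. (y, b) \<in> set ps \<Longrightarrow> b \<in> V"
    and f: "\<And>y b. (y, b) \<in> set ps \<Longrightarrow> clinear_on V (f y)"
    and zero: "\<And>r v. clinear r \<Longrightarrow> v \<in> V \<Longrightarrow> (\<Sum>(y, b)\<leftarrow>ps. r b *\<^sub>C f y v) = 0"
  shows "(\<Sum>(y, b)\<leftarrow>ps. f y b) = 0"
proof -
  obtain E where E: "E \<subseteq> V" "\<not> complex_vector.dependent E" "V \<subseteq> cspan E"
    using complex_vector.basis_exists[of V] by metis
  have "cspan E \<subseteq> V" using V(1) E(1) by (simp add: complex_vector.span_minimal)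
  define r where "r e b = (SOME r'. clinear r' \<and> (\<forall>v\<in>V. r' v = complex_vector.representation E v e)) b"
    for e b
  have r: "clinear (r e) \<and> (\<forall>v\<in>V. r e v = complex_vector.representation E v e)" for e
  proof -
    have "clinear_on V (\<lambda>v. complex_vector.representation E v e)"
      using E(3) complex_vector.representation_add[OF E(2)] complex_vector.representation_scale[OF E(2)]
      unfolding clinear_on_def by (auto simp: subset_iff)
    then obtain r' where "clinear r' \<and> (\<forall>v\<in>V. r' v = complex_vector.representation E v e)"
      using clinear_on_extend[OF V(1)] by metis
    then show ?thesis unfolding r_def by (rule someI[where P = "\<lambda>r'. clinear r' \<and> (\<forall>v\<in>V. r' v = complex_vector.representation E v e)"])
  qed
  define F where "F = (\<Union>(y, b)\<in>set ps. {e. complex_vector.representation E b e \<noteq> 0})"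
  have finF: "finite F" unfolding F_def by (auto simp: complex_vector.finite_representation)
  have FE: "F \<subseteq> E" unfolding F_def by (auto intro: complex_vector.representation_ne_zero)
  have expand: "f y b = (\<Sum>e\<in>F. r e b *\<^sub>C f y e)" if yb: "(y, b) \<in> set ps" for y b
  proof -
    obtain f' where f': "clinear f'" "\<And>x. x \<in> V \<Longrightarrow> f' x = f y x"
      using clinear_on_extend[OF V(1) f[OF yb]] by metis
    interpret f': Vector_Spaces.linear scaleC scaleC f' using f'(1) by (simp add: clinear_def)
    have bV: "b \<in> V" by (rule V(2)[OF yb])
    have "b = (\<Sum>e | complex_vector.representation E b e \<noteq> 0. complex_vector.representation E b e *\<^sub>C e)"
      using complex_vector.sum_nonzero_representation_eq[OF E(2), of b] bV E(3) by auto
    also have "\<dots> = (\<Sum>e\<in>F. complex_vector.representation E b e *\<^sub>C e)"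
      by (rule sum.mono_neutral_left[OF finF]) (use yb in \<open>auto simp: F_def\<close>)
    also have "\<dots> = (\<Sum>e\<in>F. r e b *\<^sub>C e)" using r bV by simp
    finally have "f' b = f' (\<Sum>e\<in>F. r e b *\<^sub>C e)" by simp
    also have "\<dots> = (\<Sum>e\<in>F. r e b *\<^sub>C f' e)" by (simp add: f'.sum f'.scale)
    also have "\<dots> = (\<Sum>e\<in>F. r e b *\<^sub>C f y e)" using FE E(1) f'(2) by (intro sum.cong) auto
    finally show ?thesis using f'(2)[OF bV] by simp
  qed
  have "(\<Sum>(y, b)\<leftarrow>ps. f y b) = (\<Sum>(y, b)\<leftarrow>ps. \<Sum>e\<in>F. r e b *\<^sub>C f y e)"
    using expand by (intro arg_cong[of _ _ sum_list] map_cong) auto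
  also have "\<dots> = (\<Sum>e\<in>F. \<Sum>(y, b)\<leftarrow>ps. r e b *\<^sub>C f y e)"
    by (induction ps) (auto simp: sum.distrib)
  also have "\<dots> = 0" using zero r FE E(1) by (intro sum.neutral) blast
  finally show ?thesis .
qed

lemma tens_scale_left: "(c *\<^sub>C x) \<boxtimes> y = c *\<^sub>C (x \<boxtimes> y)"
  using cbilinear_tens unfolding cbilinear_def clinear_iff by blast

lemma tensor_eq_sum_keys:
  "t = (\<Sum>(x, y)\<in>Poly_Mapping.keys (rep_tensor t). Poly_Mapping.lookup (rep_tensor t) (x, y) *\<^sub>C (x \<boxtimes> y))"
proof -
  let ?p = "rep_tensor t"
  have abs_sum: "abs_tensor (\<Sum>k\<in>K. Poly_Mapping.single k (Poly_Mapping.lookup ?p k))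
      = (\<Sum>(x, y)\<in>K. Poly_Mapping.lookup ?p (x, y) *\<^sub>C (x \<boxtimes> y))" if "finite K" for K
    using that
  proof induction
    case empty
    then show ?case by (simp add: zero_tensor_def)
  next
    case (insert k K)
    then show ?case
      by (cases k) (simp add: plus_tensor.abs_eq[symmetric] tens.abs_eq scaleC_tensor.abs_eq map_single)
  qed
  have "?p = (\<Sum>k\<in>Poly_Mapping.keys ?p. Poly_Mapping.single k (Poly_Mapping.lookup ?p k))"
    by (rule poly_mapping_eqI)
      (auto simp: lookup_sum lookup_single when_def not_in_keys_iff_lookup_eq_zero)
  then have "abs_tensor ?p = abs_tensor (\<Sum>k\<in>Poly_Mapping.keys ?p. Poly_Mapping.single k (Poly_Mapping.lookup ?p k))"
    by (rule arg_cong)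
  then show ?thesis
    using Quotient3_abs_rep[OF Quotient3_tensor, of t] by (simp add: abs_sum)
qed

text \<open>The star on a tensor product is defined through representatives; for the representative
  chosen there, it acts leg by leg.\<close>

lemma tensor_star_sum_list:
  obtains ps where "t = (\<Sum>(x, y)\<leftarrow>ps. x \<boxtimes> y)" "tensor_star t = (\<Sum>(x, y)\<leftarrow>ps. star x \<boxtimes> star y)"
proof -
  let ?p = "rep_tensor t"
  let ?c = "Poly_Mapping.lookup ?p"
  obtain ks where ks: "set ks = Poly_Mapping.keys ?p" "distinct ks"
    using finite_distinct_list[OF finite_keys[of ?p]] by metis
  let ?ps = "map (\<lambda>(x, y). (?c (x, y) *\<^sub>C x, y)) ks"
  have eq: "(\<Sum>k\<in>Poly_Mapping.keys ?p. h k) = sum_list (map h ks)" for h :: "_ \<Rightarrow> 'c::comm_monoid_add"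
    using sum.distinct_set_conv_list[OF ks(2), of h] unfolding ks(1) .
  have "t = (\<Sum>(x, y)\<leftarrow>?ps. x \<boxtimes> y)"
    by (rule trans[OF tensor_eq_sum_keys]) (simp add: eq o_def case_prod_unfold tens_scale_left)
  moreover have "tensor_star t = (\<Sum>(x, y)\<leftarrow>?ps. star x \<boxtimes> star y)"
    by (simp add: tensor_star_def tensor_antilift_def eq o_def case_prod_unfold tens_scale_left star_scaleC)
  ultimately show ?thesis by (rule that)
qed

lemma tensor_lift_sum_list:
  assumes "cbilinear f"
  shows "tensor_lift f (\<Sum>(x, y)\<leftarrow>ps. x \<boxtimes> y) = (\<Sum>(x, y)\<leftarrow>ps. f x y)"
  by (simp add: clinear_sum_list[OF clinear_tensor_lift[OF assms]] o_def case_prod_unfold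
      tensor_lift_tens[OF assms])


section \<open>Sweedler calculus\<close>

abbreviation coprod_sum :: "'a::hopf_star_algebra \<Rightarrow> ('a \<Rightarrow> 'a \<Rightarrow> 'b::complex_vector) \<Rightarrow> 'b"
  where "coprod_sum a f \<equiv> tensor_lift f (comult a)"

lemma clinear_coprod_sum: "cbilinear F \<Longrightarrow> clinear f \<Longrightarrow> clinear (\<lambda>x. coprod_sum (f x) F)"
  by (intro clinear_compose[OF clinear_tensor_lift] clinear_compose[OF comult_linear])

lemma clinear_coprod_sum_fun:
  assumes "\<And>p q. clinear (\<lambda>x. F x p q)"
  shows "clinear (\<lambda>x. coprod_sum a (F x))"
  using assms
  by (simp add: clinear_iff tensor_lift_def free_lift_def scaleC_add_right sum.distrib
      case_prod_unfold complex_vector.scale_sum_right scaleC_scaleC mult.commute)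

lemmas clinear_counit = clinear_compose[OF counit_linear]
  and clinear_antipode = clinear_compose[OF antipode_linear]
  and clinear_haar = clinear_compose[OF haar_linear]
  and clinear_tau_compose = clinear_compose[OF clinear_tau]

lemmas clinear_intros = cbilinearI clinear_id clinear_scale
  clinear_scale_vector clinear_mult_left clinear_mult_right clinear_coprod_sum
  clinear_coprod_sum_fun clinear_counit clinear_antipode clinear_haar clinear_tau_compose

lemma coprod_sum_scale: "c *\<^sub>C tensor_lift f t = tensor_lift (\<lambda>p q. c *\<^sub>C f p q) t"
  by (rule clinear_apply_tensor_lift) (intro clinear_intros)

lemma coprod_sum_scale_vector: "tensor_lift f t *\<^sub>C v = tensor_lift (\<lambda>p q. f p q *\<^sub>C v) t"
  by (rule clinear_apply_tensor_lift[where F = "\<lambda>x. x *\<^sub>C v"]) (intro clinear_intros)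

lemma coprod_sum_mult_left: "tensor_lift f t * c = tensor_lift (\<lambda>p q. f p q * c) t"
  for c :: "'a::complex_algebra"
  by (rule clinear_apply_tensor_lift[where F = "\<lambda>x. x * c"]) (intro clinear_intros)

lemma coprod_sum_mult_right: "c * tensor_lift f t = tensor_lift (\<lambda>p q. c * f p q) t"
  for c :: "'a::complex_algebra"
  by (rule clinear_apply_tensor_lift[where F = "\<lambda>x. c * x"]) (intro clinear_intros)

lemma coprod_sum_swap:
  "tensor_lift (\<lambda>p q. tensor_lift (\<lambda>r s. F p q r s) t) u
    = tensor_lift (\<lambda>r s. tensor_lift (\<lambda>p q. F p q r s) u) t"
  unfolding tensor_lift_def free_lift_def case_prod_unfold complex_vector.scale_sum_right scaleC_scaleC
  by (subst sum.swap) (simp add: mult.commute)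

lemma coprod_sum_coassoc:
  assumes "\<And>x y. clinear (\<lambda>z. F x y z)" "\<And>x z. clinear (\<lambda>y. F x y z)" "\<And>y z. clinear (\<lambda>x. F x y z)"
  shows "coprod_sum a (\<lambda>x z. coprod_sum x (\<lambda>p q. F p q z)) = coprod_sum a (\<lambda>p z. coprod_sum z (\<lambda>q r. F p q r))"
proof -
  have F: "cbilinear (\<lambda>q r. F p q r)" for p using assms(1,2) by (intro cbilinearI)
  have "clinear (\<lambda>p. tensor_lift (\<lambda>q r. F p q r) t)" for t
    using assms(3)
    by (simp add: clinear_iff tensor_lift_def free_lift_def scaleC_add_right sum.distrib
        case_prod_unfold complex_vector.scale_sum_right scaleC_scaleC mult.commute)
  then have b: "cbilinear (\<lambda>p t. tensor_lift (\<lambda>q r. F p q r) t)"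
    using clinear_tensor_lift[OF F] by (intro cbilinearI)
  define H where "H = tensor_lift (\<lambda>p t. tensor_lift (\<lambda>q r. F p q r) t)"
  have H: "clinear H" unfolding H_def by (rule clinear_tensor_lift[OF b])
  have Ht: "H (p \<boxtimes> t) = tensor_lift (\<lambda>q r. F p q r) t" for p t
    unfolding H_def by (rule tensor_lift_tens[OF b])
  have "H (tensor_lift (\<lambda>x z. tensor_lift (\<lambda>p q. p \<boxtimes> (q \<boxtimes> z)) (comult x)) (comult a))
      = H (tensor_lift (\<lambda>x z. x \<boxtimes> comult z) (comult a))"
    by (simp only: coassoc)
  then show ?thesis
    by (simp add: clinear_apply_tensor_lift[OF H] Ht tensor_lift_tens[OF F])
qed

lemma coprod_sum_mult:
  assumes "cbilinear F"
  shows "coprod_sum (a * b) F = coprod_sum a (\<lambda>p q. coprod_sum b (\<lambda>r s. F (p * r) (q * s)))"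
  by (simp add: comult_mult tensor_mult_def clinear_apply_tensor_lift[OF clinear_tensor_lift[OF assms]]
      tensor_lift_tens[OF assms])

lemma coprod_sum_counit_left: "clinear f \<Longrightarrow> coprod_sum a (\<lambda>p q. counit p *\<^sub>C f q) = f a"
  using clinear_apply_tensor_lift[of f "\<lambda>p q. counit p *\<^sub>C q" "comult a"]
  by (simp add: counit_left clinear_iff)

lemma coprod_sum_counit_right: "clinear f \<Longrightarrow> coprod_sum a (\<lambda>p q. counit q *\<^sub>C f p) = f a"
  using clinear_apply_tensor_lift[of f "\<lambda>p q. counit q *\<^sub>C p" "comult a"]
  by (simp add: counit_right clinear_iff)

lemma coprod_sum_sum_list:
  assumes "cbilinear f" "comult a = (\<Sum>(p, q)\<leftarrow>ps. p \<boxtimes> q)"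
  shows "coprod_sum a f = (\<Sum>(p, q)\<leftarrow>ps. f p q)"
  using tensor_lift_sum_list[OF assms(1)] assms(2) by simp

text \<open>Applies a Sweedler identity for \<open>a\<close> to \<open>star a\<close>; the additive map \<open>h\<close> is the star of \<open>A\<close> in the
  antipode identities and in the proof that the counit is a *-map.\<close>

lemma coprod_sum_star:
  assumes f: "cbilinear f" and g: "cbilinear g"
    and fg: "\<And>p q. g (star p) (star q) = h (f p q)"
    and h: "\<And>x y. h (x + y) = h x + h y"
  shows "coprod_sum (star a) g = h (coprod_sum a f)"
proof -
  obtain ps where ps: "comult a = (\<Sum>(x, y)\<leftarrow>ps. x \<boxtimes> y)"
    "tensor_star (comult a) = (\<Sum>(x, y)\<leftarrow>ps. star x \<boxtimes> star y)"
    by (rule tensor_star_sum_list)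
  have h0: "h 0 = 0" using h[of 0 0] by simp
  have star_ps: "comult (star a) = (\<Sum>(x, y)\<leftarrow>map (\<lambda>(x, y). (star x, star y)) ps. x \<boxtimes> y)"
    by (simp add: comult_star ps(2) o_def case_prod_unfold)
  have "coprod_sum (star a) g = (\<Sum>(x, y)\<leftarrow>ps. g (star x) (star y))"
    by (subst coprod_sum_sum_list[OF g star_ps]) (simp add: o_def case_prod_unfold)
  also have "\<dots> = h (\<Sum>(x, y)\<leftarrow>ps. f x y)"
    by (induction ps) (auto simp: fg h h0)
  also have "\<dots> = h (coprod_sum a f)"
    by (simp add: coprod_sum_sum_list[OF f ps(1)])
  finally show ?thesis .
qed


section \<open>The antipode\<close>

lemma star_one [simp]: "star (1::'a::complex_star_algebra_1) = 1"
  by (metis mult_1_right star_mult star_star)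

lemma star_zero [simp]: "star (0::'a::complex_star_algebra_1) = 0"
  using star_add[of "0::'a" 0] by simp

text \<open>The map \<open>a \<mapsto> cnj (\<epsilon> (a\<^sup>*))\<close> is a counit as well, and counits are unique.\<close>

lemma counit_star: "counit (star a) = cnj (counit a)"
proof -
  define e where "e b = cnj (counit (star b))" for b :: 'a
  have e: "clinear e"
    by (simp add: clinear_iff e_def star_add star_scaleC counit_linear[unfolded clinear_iff])
  have "coprod_sum (star (star b)) (\<lambda>p q. e p *\<^sub>C q) = star (coprod_sum (star b) (\<lambda>p q. counit p *\<^sub>C q))"
    for b :: 'a
    by (rule coprod_sum_star; (intro clinear_intros clinear_compose[OF e])?)
      (simp_all add: e_def star_scaleC star_add)
  then have e_left: "coprod_sum b (\<lambda>p q. e p *\<^sub>C q) = b" for b by (simp add: counit_left)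
  have "counit a = counit (coprod_sum a (\<lambda>p q. e p *\<^sub>C q))" by (simp add: e_left)
  also have "\<dots> = coprod_sum a (\<lambda>p q. counit q *\<^sub>C e p)"
    by (simp add: clinear_apply_tensor_lift[OF counit_linear] counit_linear[unfolded clinear_iff] mult.commute)
  also have "\<dots> = e a" by (rule coprod_sum_counit_right[OF e])
  finally show ?thesis by (simp add: e_def)
qed

lemma antipode_one: "antipode (1::'a::hopf_star_algebra) = 1"
proof -
  have "cbilinear (\<lambda>p q::'a. antipode p * q)" by (intro clinear_intros)
  then show ?thesis using antipode_left[of "1::'a"] by (simp add: comult_one tensor_lift_tens counit_one)
qed

text \<open>The two cancellations \<open>b\<^sub>1 S(b\<^sub>2) = \<epsilon>(b)\<close> and \<open>S(a\<^sub>1 b\<^sub>1) a\<^sub>2 b\<^sub>2 = \<epsilon>(ab)\<close>, applied to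
  \<open>S(a\<^sub>1 b\<^sub>1) a\<^sub>2 b\<^sub>2 S(b\<^sub>3)\<close>.\<close>

lemma antipode_mult_cancel: "coprod_sum a (\<lambda>p q. antipode (p * b) * q) = counit a *\<^sub>C antipode b"
proof -
  have "coprod_sum a (\<lambda>p q. antipode (p * b) * q)
      = coprod_sum a (\<lambda>p q. coprod_sum b (\<lambda>r s. counit s *\<^sub>C (antipode (p * r) * q)))"
    by (subst coprod_sum_counit_right[where f = "\<lambda>r. antipode (_ * r) * _"]) (auto intro!: clinear_intros)
  also have "\<dots> = coprod_sum a (\<lambda>p q. coprod_sum b (\<lambda>r s. coprod_sum s (\<lambda>t u. antipode (p * r) * q * (t * antipode u))))"
    by (simp add: coprod_sum_mult_right[symmetric] antipode_right mult_scaleC_right)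
  also have "\<dots> = coprod_sum a (\<lambda>p q. coprod_sum b (\<lambda>x u. coprod_sum x (\<lambda>r t. antipode (p * r) * q * (t * antipode u))))"
    by (subst coprod_sum_coassoc) (auto intro!: clinear_intros)
  also have "\<dots> = coprod_sum b (\<lambda>x u. coprod_sum a (\<lambda>p q. coprod_sum x (\<lambda>r t. antipode (p * r) * (q * t))) * antipode u)"
    by (subst coprod_sum_swap) (simp add: coprod_sum_mult_left mult.assoc)
  also have "\<dots> = coprod_sum b (\<lambda>x u. coprod_sum (a * x) (\<lambda>m n. antipode m * n) * antipode u)"
    by (subst coprod_sum_mult) (auto intro!: clinear_intros)
  also have "\<dots> = counit a *\<^sub>C coprod_sum b (\<lambda>x u. counit x *\<^sub>C antipode u)"
    by (simp add: antipode_left counit_mult mult_scaleC_left coprod_sum_scale scaleC_scaleC)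
  also have "\<dots> = counit a *\<^sub>C antipode b"
    by (simp add: coprod_sum_counit_left[OF antipode_linear])
  finally show ?thesis .
qed

text \<open>Insert \<open>a\<^sub>2 S(a\<^sub>3) = \<epsilon>(a\<^sub>2)\<close> to the right of \<open>S(a\<^sub>1 b)\<close> and cancel with the previous lemma.\<close>

lemma antipode_mult: "antipode (a * b) = antipode b * antipode a"
proof -
  have "antipode (a * b) = coprod_sum a (\<lambda>p q. counit q *\<^sub>C antipode (p * b))"
    by (subst coprod_sum_counit_right) (auto intro!: clinear_intros)
  also have "\<dots> = coprod_sum a (\<lambda>p q. coprod_sum q (\<lambda>r s. antipode (p * b) * (r * antipode s)))"
    by (simp add: coprod_sum_mult_right[symmetric] antipode_right mult_scaleC_right)
  also have "\<dots> = coprod_sum a (\<lambda>x s. coprod_sum x (\<lambda>p r. antipode (p * b) * (r * antipode s)))"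
    by (subst coprod_sum_coassoc) (auto intro!: clinear_intros)
  also have "\<dots> = coprod_sum a (\<lambda>x s. counit x *\<^sub>C (antipode b * antipode s))"
    by (simp add: mult.assoc[symmetric] coprod_sum_mult_left[symmetric] antipode_mult_cancel mult_scaleC_left)
  also have "\<dots> = antipode b * antipode a"
    by (subst coprod_sum_counit_left) (auto intro!: clinear_intros)
  finally show ?thesis .
qed

definition antipode_inv :: "'a::hopf_star_algebra \<Rightarrow> 'a"
  where "antipode_inv a = star (antipode (star a))"

lemma antipode_inv_linear: "clinear antipode_inv"
  by (simp add: clinear_iff antipode_inv_def star_add star_scaleC antipode_linear[unfolded clinear_iff])

lemmas clinear_antipode_inv = clinear_compose[OF antipode_inv_linear]

lemma antipode_inv_one: "antipode_inv 1 = 1"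
  by (simp add: antipode_inv_def antipode_one)

text \<open>The star of the antipode axiom at \<open>a\<^sup>*\<close>.  The legs come out reversed, so \<open>antipode_inv\<close> is the
  antipode of the opposite coproduct; for that reason it inverts \<open>S\<close>.\<close>

lemma antipode_inv_left: "coprod_sum a (\<lambda>p q. antipode_inv q * p) = counit a *\<^sub>C 1"
proof -
  have "coprod_sum (star (star a)) (\<lambda>p q. antipode_inv q * p) = star (coprod_sum (star a) (\<lambda>p q. p * antipode q))"
    by (rule coprod_sum_star; (intro clinear_intros clinear_antipode_inv)?)
      (simp_all add: antipode_inv_def star_mult star_add)
  then show ?thesis by (simp add: antipode_right counit_star star_scaleC)
qed

lemma antipode_inv_right: "coprod_sum a (\<lambda>p q. q * antipode_inv p) = counit a *\<^sub>C 1"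
proof -
  have "coprod_sum (star (star a)) (\<lambda>p q. q * antipode_inv p) = star (coprod_sum (star a) (\<lambda>p q. antipode p * q))"
    by (rule coprod_sum_star; (intro clinear_intros clinear_antipode_inv)?)
      (simp_all add: antipode_inv_def star_mult star_add)
  then show ?thesis by (simp add: antipode_left counit_star star_scaleC)
qed

lemma antipode_antipode_inv: "antipode (antipode_inv a) = a"
proof -
  have "antipode (antipode_inv a) = coprod_sum a (\<lambda>x s. counit x *\<^sub>C antipode (antipode_inv s))"
    by (subst coprod_sum_counit_left) (auto intro!: clinear_intros clinear_antipode_inv)
  also have "\<dots> = coprod_sum a (\<lambda>x s. coprod_sum x (\<lambda>p r. p * antipode r * antipode (antipode_inv s)))"
    by (simp add: coprod_sum_mult_left[symmetric] antipode_right mult_scaleC_left)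
  also have "\<dots> = coprod_sum a (\<lambda>p q. coprod_sum q (\<lambda>r s. p * antipode r * antipode (antipode_inv s)))"
    by (subst coprod_sum_coassoc) (auto intro!: clinear_intros clinear_antipode_inv)
  also have "\<dots> = coprod_sum a (\<lambda>p q. p * antipode (coprod_sum q (\<lambda>r s. antipode_inv s * r)))"
    by (simp add: coprod_sum_mult_right clinear_apply_tensor_lift[OF antipode_linear] antipode_mult mult.assoc)
  also have "\<dots> = coprod_sum a (\<lambda>p q. counit q *\<^sub>C p)"
    by (simp add: antipode_inv_left antipode_linear[unfolded clinear_iff] antipode_one mult_scaleC_right)
  also have "\<dots> = a" by (rule counit_right)
  finally show ?thesis .
qed

lemma antipode_inv_antipode: "antipode_inv (antipode a) = a"
  using antipode_antipode_inv[of "star a"] by (metis antipode_inv_def star_star)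

lemma inv_antipode: "inv_into UNIV antipode = antipode_inv"
proof
  fix a :: 'a
  have "inj (antipode :: 'a \<Rightarrow> 'a)" by (metis antipode_inv_antipode injI)
  then show "inv_into UNIV antipode a = antipode_inv a"
    by (metis antipode_antipode_inv inv_f_f)
qed


section \<open>Nondegeneracy of the Haar state\<close>

text \<open>By invariance, \<open>\<Phi>(b\<^sub>2 a) 1 = b\<^sub>2 a\<^sub>1 \<Phi>(b\<^sub>3 a\<^sub>2)\<close>; multiplying by \<open>S(b\<^sub>1)\<close> cancels \<open>b\<^sub>2\<close>.\<close>

lemma haar_coprod_sum:
  "coprod_sum a (\<lambda>p q. haar (b * q) *\<^sub>C p) = coprod_sum b (\<lambda>r s. haar (s * a) *\<^sub>C antipode r)"
proof -
  have "coprod_sum b (\<lambda>r s. haar (s * a) *\<^sub>C antipode r)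
      = coprod_sum b (\<lambda>r s. antipode r * coprod_sum (s * a) (\<lambda>m n. haar n *\<^sub>C m))"
    by (simp add: haar_left_invariant mult_scaleC_right)
  also have "\<dots> = coprod_sum b (\<lambda>r s. coprod_sum s (\<lambda>t u. coprod_sum a (\<lambda>p q. haar (u * q) *\<^sub>C (antipode r * (t * p)))))"
    by (subst coprod_sum_mult) (auto intro!: clinear_intros simp: coprod_sum_mult_right mult_scaleC_right)
  also have "\<dots> = coprod_sum b (\<lambda>x u. coprod_sum x (\<lambda>r t. coprod_sum a (\<lambda>p q. haar (u * q) *\<^sub>C (antipode r * (t * p)))))"
    by (subst coprod_sum_coassoc) (auto intro!: clinear_intros)
  also have "\<dots> = coprod_sum b (\<lambda>x u. coprod_sum x (\<lambda>r t. antipode r * t) * coprod_sum a (\<lambda>p q. haar (u * q) *\<^sub>C p))"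
    unfolding coprod_sum_mult_left by (simp add: coprod_sum_mult_right mult_scaleC_right mult.assoc)
  also have "\<dots> = coprod_sum b (\<lambda>x u. counit x *\<^sub>C coprod_sum a (\<lambda>p q. haar (u * q) *\<^sub>C p))"
    by (simp add: antipode_left mult_scaleC_left)
  also have "\<dots> = coprod_sum a (\<lambda>p q. haar (b * q) *\<^sub>C p)"
    by (subst coprod_sum_counit_left) (auto intro!: clinear_intros)
  finally show ?thesis by simp
qed

lemma sum_list_zero [simp]: "(\<Sum>x\<leftarrow>xs. 0) = (0 :: 'a::monoid_add)"
  by (induction xs) simp_all

text \<open>The vectors \<open>a\<close> with \<open>\<Phi>(ba) = 0\<close> for all \<open>b\<close> form a left coideal: the second legs of the coproduct of \<open>a\<close>,
  taken against independent first legs, have the same property by the preceding identity.  On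
  such \<open>a\<close> the counit vanishes, since \<open>\<epsilon>(a) = \<Phi>(S(a\<^sub>1) a\<^sub>2)\<close>.  Hence \<open>a = a\<^sub>1 \<epsilon>(a\<^sub>2) = 0\<close>.\<close>

lemma haar_nondegenerate:
  fixes a :: "'a::cqg_hopf_star_algebra"
  assumes "\<And>b. haar (b * a) = 0"
  shows "a = 0"
proof -
  have haar_legs: "(\<Sum>(p, q)\<leftarrow>ps. r p *\<^sub>C haar (b * q)) = 0"
    if "\<And>b. haar (b * a) = 0" "comult a = (\<Sum>(p, q)\<leftarrow>ps. p \<boxtimes> q)" "clinear r"
    for a b ps and r :: "'a \<Rightarrow> complex"
  proof -
    have "coprod_sum a (\<lambda>p q. haar (b * q) *\<^sub>C p) = 0"
      unfolding haar_coprod_sum that(1) by (simp add: tensor_lift_def free_lift_def)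
    then have "(\<Sum>(p, q)\<leftarrow>ps. haar (b * q) *\<^sub>C p) = 0"
      by (subst (asm) coprod_sum_sum_list[OF _ that(2)]) (auto intro!: clinear_intros)
    then have "0 = r (\<Sum>(p, q)\<leftarrow>ps. haar (b * q) *\<^sub>C p)"
      using clinear_sum_list[OF that(3), of "[]"] by simp
    also have "\<dots> = (\<Sum>(p, q)\<leftarrow>ps. r (haar (b * q) *\<^sub>C p))"
      by (subst clinear_sum_list[OF that(3)]) (simp add: o_def case_prod_unfold)
    also have "\<dots> = (\<Sum>(p, q)\<leftarrow>ps. r p *\<^sub>C haar (b * q))"
      using that(3) by (simp add: clinear_iff mult.commute)
    finally show ?thesis by simp
  qed
  have counit_zero: "counit a = 0" if a: "\<And>b. haar (b * a) = 0" for a :: 'a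
  proof -
    obtain ps where ps: "comult a = (\<Sum>(p, q)\<leftarrow>ps. p \<boxtimes> q)" by (rule tensor_star_sum_list)
    have "counit a = haar (coprod_sum a (\<lambda>p q. antipode p * q))"
      by (simp add: antipode_left haar_linear[unfolded clinear_iff] haar_one)
    also have "\<dots> = coprod_sum a (\<lambda>p q. haar (antipode p * q))"
      by (rule clinear_apply_tensor_lift[OF haar_linear])
    also have "\<dots> = (\<Sum>(p, q)\<leftarrow>ps. haar (antipode p * q))"
      by (rule coprod_sum_sum_list[OF _ ps]) (auto intro!: clinear_intros)
    also have "\<dots> = (\<Sum>(q, p)\<leftarrow>map prod.swap ps. haar (antipode p * q))"
      by (simp add: o_def case_prod_unfold)
    also have "\<dots> = 0"
    proof (rule sum_list_zero_by_functionals[of UNIV])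
      show "clinear_on UNIV (\<lambda>p. haar (antipode p * q))" for q :: 'a
        using clinear_haar[OF clinear_mult_left[OF antipode_linear, of q]]
        by (simp add: clinear_on_def clinear_iff)
      show "(\<Sum>(q, p)\<leftarrow>map prod.swap ps. r p *\<^sub>C haar (antipode v * q)) = 0" if "clinear r" for r v
        using haar_legs[OF a ps that] by (simp add: o_def case_prod_unfold)
    qed auto
    finally show ?thesis .
  qed
  obtain ps where ps: "comult a = (\<Sum>(p, q)\<leftarrow>ps. p \<boxtimes> q)" by (rule tensor_star_sum_list)
  have "a = coprod_sum a (\<lambda>p q. counit q *\<^sub>C p)" by (simp add: counit_right)
  also have "\<dots> = (\<Sum>(p, q)\<leftarrow>ps. counit q *\<^sub>C p)"
    by (rule coprod_sum_sum_list[OF _ ps]) (auto intro!: clinear_intros)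
  also have "\<dots> = (\<Sum>(q, p)\<leftarrow>map prod.swap ps. counit q *\<^sub>C p)"
    by (simp add: o_def case_prod_unfold)
  also have "\<dots> = 0"
  proof (rule sum_list_zero_by_functionals[of UNIV])
    show "clinear_on UNIV (\<lambda>p. counit q *\<^sub>C p)" for q :: 'a
      by (simp add: clinear_on_def scaleC_add_right scaleC_scaleC mult.commute)
    fix r :: "'a \<Rightarrow> complex" and v :: 'a
    assume r: "clinear r"
    \<comment> \<open>the second leg against the coordinate \<open>r\<close> of the first\<close>
    let ?u = "\<Sum>(p, q)\<leftarrow>ps. r p *\<^sub>C q"
    have "haar (b * ?u) = (\<Sum>(p, q)\<leftarrow>ps. r p *\<^sub>C haar (b * q))" for b
      using clinear_sum_list[OF clinear_haar[OF clinear_mult_right[OF clinear_id, of b]]]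
      by (simp add: o_def case_prod_unfold mult_scaleC_right haar_linear[unfolded clinear_iff])
    then have "haar (b * ?u) = 0" for b using haar_legs[OF assms ps r] by simp
    then have "counit ?u = 0" by (rule counit_zero)
    moreover have "counit ?u *\<^sub>C v = (\<Sum>(p, q)\<leftarrow>ps. counit (r p *\<^sub>C q) *\<^sub>C v)"
      using clinear_sum_list[OF clinear_scale_vector[OF counit_linear, of v], of "map (\<lambda>(p, q). r p *\<^sub>C q) ps"]
      by (simp add: o_def case_prod_unfold)
    ultimately show "(\<Sum>(q, p)\<leftarrow>map prod.swap ps. r p *\<^sub>C (counit q *\<^sub>C v)) = 0"
      by (simp add: o_def case_prod_unfold counit_linear[unfolded clinear_iff] scaleC_scaleC)
  qed auto
  finally show ?thesis .
qed


section \<open>Module actions and grouplikes\<close>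

lemma tau_ract: "tau c (ract x a) = tau (a * c) x"
  by transfer simp

lemma tau_dual_antipode: "tau a (dual_antipode x) = tau (antipode a) x"
  by transfer simp

lemma tau_zero_left [simp]: "tau 0 x = 0"
  using tau_scaleC_left[of 0 0 x] by simp

lemma ract_ract: "ract (ract x a) b = ract x (a * b)"
  by (rule dual_eqI) (simp add: tau_ract mult.assoc)

lemma ract_one: "ract x 1 = x" for x :: "'a::complex_algebra_1 dual"
  by (rule dual_eqI) (simp add: tau_ract)

lemma clinear_tau_right: "clinear (\<lambda>x. tau a x)"
  by (simp add: clinear_iff tau_add_right tau_scaleC_right)

lemma ract_linear: "clinear (\<lambda>a. ract x a)"
  unfolding clinear_iff
  by (auto intro!: dual_eqI simp: tau_ract tau_add_right tau_scaleC_right distrib_right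
      mult_scaleC_left tau_add_left tau_scaleC_left)

lemma ract_linear_left: "clinear (\<lambda>x. ract x a)"
  unfolding clinear_iff
  by (auto intro!: dual_eqI simp: tau_ract tau_add_right tau_scaleC_right)

lemma ract_range_subspace: "csubspace {ract x a |a. True}"
proof (rule complex_vector.subspaceI)
  note l = ract_linear[of x, unfolded clinear_iff]
  have "ract x (0 *\<^sub>C 0) = 0 *\<^sub>C ract x 0" using l by blast
  then show "0 \<in> {ract x a |a. True}" by (auto intro!: exI[of _ 0])
  show "y + z \<in> {ract x a |a. True}" if "y \<in> {ract x a |a. True}" "z \<in> {ract x a |a. True}" for y z
    using that l by (auto, metis)
  show "c *\<^sub>C y \<in> {ract x a |a. True}" if "y \<in> {ract x a |a. True}" for c y
    using that l by (auto, metis)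
qed

lemmas clinear_dual_intros = clinear_intros clinear_antipode_inv clinear_compose[OF clinear_tau_right]
  clinear_compose[OF ract_linear] clinear_compose[OF ract_linear_left]

lemma ract_mult: "ract (x * y) a = coprod_sum a (\<lambda>p q. ract x p * ract y q)"
proof (rule dual_eqI)
  fix c
  have "tau c (ract (x * y) a) = coprod_sum (a * c) (\<lambda>p q. tau p x * tau q y)"
    by (simp add: tau_ract tau_times)
  also have "\<dots> = coprod_sum a (\<lambda>p q. tau c (ract x p * ract y q))"
    by (subst coprod_sum_mult[OF cbilinear_tau_mult]) (simp add: tau_times tau_ract)
  also have "\<dots> = tau c (coprod_sum a (\<lambda>p q. ract x p * ract y q))"
    by (simp add: clinear_apply_tensor_lift[OF clinear_tau_right])
  finally show "tau c (ract (x * y) a) = tau c (coprod_sum a (\<lambda>p q. ract x p * ract y q))" .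
qed

text \<open>The product rule \<open>(xy) \<lhd> a = (x \<lhd> a\<^sub>1)(y \<lhd> a\<^sub>2)\<close>, applied to \<open>x(y \<lhd> S\<^sup>-\<^sup>1(a\<^sub>2))\<close> and \<open>a\<^sub>1\<close>, cancels
  the action on \<open>y\<close>.\<close>

lemma ract_mult_untwist:
  "ract x a * y = coprod_sum a (\<lambda>p q. ract (x * ract y (antipode_inv q)) p)"
proof -
  have "coprod_sum a (\<lambda>p q. ract (x * ract y (antipode_inv q)) p)
      = coprod_sum a (\<lambda>p q. coprod_sum p (\<lambda>r s. ract x r * ract y (antipode_inv q * s)))"
    by (simp add: ract_mult ract_ract)
  also have "\<dots> = coprod_sum a (\<lambda>r z. coprod_sum z (\<lambda>s q. ract x r * ract y (antipode_inv q * s)))"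
    by (subst coprod_sum_coassoc) (auto intro!: clinear_dual_intros)
  also have "\<dots> = coprod_sum a (\<lambda>r z. ract x r * ract y (coprod_sum z (\<lambda>s q. antipode_inv q * s)))"
    by (simp add: coprod_sum_mult_right clinear_apply_tensor_lift[OF ract_linear])
  also have "\<dots> = coprod_sum a (\<lambda>r z. counit z *\<^sub>C (ract x r * y))"
    by (simp add: antipode_inv_left ract_linear[unfolded clinear_iff] ract_one mult_scaleC_right)
  also have "\<dots> = ract x a * y"
    by (subst coprod_sum_counit_right) (auto intro!: clinear_dual_intros)
  finally show ?thesis by simp
qed

lemma dual_star_add: "star (x + y) = star x + star y" for x y :: "'a::hopf_star_algebra dual"
  by (rule dual_eqI) (simp add: tau_star tau_add_right)

lemma dual_star_scale: "star (c *\<^sub>C x) = cnj c *\<^sub>C star x" for x :: "'a::hopf_star_algebra dual"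
  by (rule dual_eqI) (simp add: tau_star tau_scaleC_right)

lemma lact_mult: "lact (x * y) b = lact x (lact y b)"
proof -
  have "lact x (lact y b) = coprod_sum b (\<lambda>p q. tau q y *\<^sub>C lact x p)"
  proof -
    have "clinear (lact x)" unfolding lact_def by (intro clinear_dual_intros)
    then show ?thesis
      by (simp add: lact_def[of y] clinear_apply_tensor_lift clinear_iff)
  qed
  also have "\<dots> = coprod_sum b (\<lambda>p q. coprod_sum p (\<lambda>r s. (tau s x * tau q y) *\<^sub>C r))"
    by (simp add: lact_def coprod_sum_scale scaleC_scaleC mult.commute)
  also have "\<dots> = coprod_sum b (\<lambda>r z. coprod_sum z (\<lambda>s q. (tau s x * tau q y) *\<^sub>C r))"
    by (subst coprod_sum_coassoc) (auto intro!: clinear_dual_intros)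
  also have "\<dots> = lact (x * y) b"
    unfolding lact_def tau_times coprod_sum_scale_vector ..
  finally show ?thesis by simp
qed

lemma lact_linear: "clinear (lact x)"
  unfolding lact_def by (intro clinear_dual_intros)

lemma lact_one: "lact 1 b = b"
  by (simp add: lact_def tau_one counit_right)

text \<open>This is the right invariance of the Haar state, evaluated by \<open>x\<close>.\<close>

lemma haar_lact: "haar (lact x b) = tau 1 x * haar b"
proof -
  have "haar (lact x b) = coprod_sum b (\<lambda>p q. tau (haar p *\<^sub>C q) x)"
    by (simp add: lact_def clinear_apply_tensor_lift[OF haar_linear]
        haar_linear[unfolded clinear_iff] tau_scaleC_left mult.commute)
  also have "\<dots> = tau (coprod_sum b (\<lambda>p q. haar p *\<^sub>C q)) x"
    by (rule clinear_apply_tensor_lift[OF clinear_tau, symmetric])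
  finally show ?thesis by (simp add: haar_right_invariant tau_scaleC_left mult.commute)
qed

lemma ring_inverse_eqI:
  assumes "x * y = 1" "y * x = 1"
  shows "ring_inverse x = y"
  unfolding ring_inverse_def
proof (rule the_equality)
  fix z assume z: "x * z = 1 \<and> z * x = 1"
  have "z = (y * x) * z" by (simp only: assms mult_1_left)
  also have "\<dots> = y" by (simp only: mult.assoc z mult_1_right)
  finally show "z = y" .
qed (use assms in simp)

lemma grouplike_inverse:
  assumes "grouplike g"
  shows "g * dual_antipode g = 1" "dual_antipode g * g = 1" "ring_inverse g = dual_antipode g"
    "tau (antipode_inv a) g = tau a (ring_inverse g)"
proof -
  have g: "tau 1 g = 1" "\<And>a b. tau (a * b) g = tau a g * tau b g"
    using assms by (auto simp: grouplike_def)
  show r: "g * dual_antipode g = 1"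
    by (rule dual_eqI) (simp add: tau_times tau_dual_antipode g(2)[symmetric] tau_one
        clinear_apply_tensor_lift[OF clinear_tau, symmetric] antipode_right tau_scaleC_left g(1))
  show l: "dual_antipode g * g = 1"
    by (rule dual_eqI) (simp add: tau_times tau_dual_antipode g(2)[symmetric] tau_one
        clinear_apply_tensor_lift[OF clinear_tau, symmetric] antipode_left tau_scaleC_left g(1))
  show i: "ring_inverse g = dual_antipode g" by (rule ring_inverse_eqI[OF r l])
  have "clinear (\<lambda>a. tau (antipode_inv a) g)" by (intro clinear_dual_intros)
  then have h: "tau a (Abs_dual (\<lambda>a. tau (antipode_inv a) g)) = tau (antipode_inv a) g" for a
    by (simp add: tau.rep_eq Abs_dual_inverse)
  define h where "h = Abs_dual (\<lambda>a. tau (antipode_inv a) g)"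
  have hg: "tau p h * tau q g = tau (q * antipode_inv p) g" for p q
    by (simp add: h_def h g(2))
  have "h * g = 1"
    by (rule dual_eqI) (simp add: tau_times hg tau_one
        clinear_apply_tensor_lift[OF clinear_tau, symmetric] antipode_inv_right tau_scaleC_left g(1))
  have "h = h * (g * dual_antipode g)" by (simp only: r mult_1_right)
  also have "\<dots> = dual_antipode g" by (simp only: mult.assoc[symmetric] \<open>h * g = 1\<close> mult_1_left)
  finally have "h = dual_antipode g" .
  then show "tau (antipode_inv a) g = tau a (ring_inverse g)" using h[of a] by (simp add: h_def i)
qed


section \<open>Coideal *-subalgebras\<close>

locale right_coideal =
  fixes B :: "'a::hopf_star_algebra set"
  assumes coideal: "right_coideal_star_subalgebra B"
begin

lemma B_subspace: "csubspace B" and B_one: "1 \<in> B"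
  and B_mult: "b \<in> B \<Longrightarrow> c \<in> B \<Longrightarrow> b * c \<in> B" and B_star: "b \<in> B \<Longrightarrow> star b \<in> B"
  using coideal by (auto simp: right_coideal_star_subalgebra_def)

lemma sweedler_exists:
  assumes "b \<in> B"
  obtains ps where "sweedler B b ps"
proof -
  have "comult b \<in> cspan {v \<boxtimes> w |v w. v \<in> B \<and> w \<in> UNIV}"
    using coideal assms by (auto simp: right_coideal_star_subalgebra_def tensor_subspace_def)
  then obtain ps where ps: "set ps \<subseteq> B \<times> UNIV" "comult b = (\<Sum>(p, q)\<leftarrow>ps. p \<boxtimes> q)"
  proof (rule span_products_sum_list)
    show "\<exists>y'\<in>B. c *\<^sub>C (y \<boxtimes> w) = y' \<boxtimes> w" if "y \<in> B" for c y and w :: 'a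
      using that B_subspace by (metis complex_vector.subspace_scale tens_scale_left)
  qed
  then show ?thesis using that unfolding sweedler_def by blast
qed

lemma coprod_sum_sweedler:
  "sweedler B b ps \<Longrightarrow> cbilinear f \<Longrightarrow> coprod_sum b f = (\<Sum>(p, q)\<leftarrow>ps. f p q)"
  by (rule coprod_sum_sum_list) (auto simp: sweedler_def)

lemma coprod_sum_cong:
  assumes "b \<in> B" "cbilinear f" "cbilinear g" "\<And>p q. p \<in> B \<Longrightarrow> f p q = g p q"
  shows "coprod_sum b f = coprod_sum b g"
proof -
  obtain ps where ps: "sweedler B b ps" using assms(1) by (rule sweedler_exists)
  have "(\<Sum>(p, q)\<leftarrow>ps. f p q) = (\<Sum>(p, q)\<leftarrow>ps. g p q)"
    using ps assms(4) unfolding sweedler_def by (intro arg_cong[of _ _ sum_list] map_cong) auto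
  then show ?thesis using coprod_sum_sweedler[OF ps assms(2)] coprod_sum_sweedler[OF ps assms(3)] by simp
qed

lemma lact_in_B:
  assumes "b \<in> B"
  shows "lact x b \<in> B"
proof -
  obtain ps where ps: "sweedler B b ps" using assms by (rule sweedler_exists)
  have "lact x b = (\<Sum>(p, q)\<leftarrow>ps. tau q x *\<^sub>C p)"
    unfolding lact_def by (rule coprod_sum_sweedler[OF ps]) (intro clinear_dual_intros)
  moreover have "(\<Sum>(p, q)\<leftarrow>qs. tau q x *\<^sub>C p) \<in> B" if "\<forall>(p, q)\<in>set qs. p \<in> B" for qs
    using that B_subspace
    by (induction qs) (auto simp: complex_vector.subspace_0 complex_vector.subspace_add complex_vector.subspace_scale)
  ultimately show ?thesis using ps by (simp add: sweedler_def)
qed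

text \<open>The kernel \<open>A B\<^sub>+\<close> of the quotient map is awkward to compute with; vanishing on it means being
  right \<open>B\<close>-linear with respect to the counit.\<close>

lemma full_I_iff: "x \<in> full_I B \<longleftrightarrow> (\<forall>a. \<forall>b\<in>B. tau (a * b) x = counit b * tau a x)"
proof safe
  fix a b
  assume x: "x \<in> full_I B" and b: "b \<in> B"
  let ?b = "b + (- counit b) *\<^sub>C 1"
  have "?b \<in> B" using b B_subspace B_one by (intro complex_vector.subspace_add complex_vector.subspace_scale)
  moreover have "counit ?b = 0"
    using counit_linear[unfolded clinear_iff] counit_one by (metis add.right_inverse scaleC_complex_def mult_1_right)
  ultimately have "a * ?b \<in> coideal_kernel B"
    unfolding coideal_kernel_def by (intro complex_vector.span_base) blast
  then have "tau (a * ?b) x = 0" using x by (simp add: full_I_def)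
  moreover have "tau (a * ?b) x = tau (a * b) x + (- counit b) * tau a x"
    by (simp only: distrib_left tau_add_left mult_scaleC_right tau_scaleC_left mult_1_right)
  ultimately show "tau (a * b) x = counit b * tau a x" by (simp add: eq_neg_iff_add_eq_0)
next
  assume x: "\<forall>a. \<forall>b\<in>B. tau (a * b) x = counit b * tau a x"
  have "tau c x = 0" if "c \<in> cspan {a * b |a b. b \<in> B \<and> counit b = 0}" for c
    using that
  proof (induction rule: complex_vector.span_induct_alt)
    case (step k c d)
    then show ?case using x by (auto simp: tau_add_left tau_scaleC_left)
  qed simp
  then show "x \<in> full_I B" by (simp add: full_I_def coideal_kernel_def)
qed

lemma full_I_one: "1 \<in> full_I B"
  by (simp add: full_I_iff tau_one counit_mult)

lemma full_I_ract: "x \<in> full_I B \<Longrightarrow> ract x a \<in> full_I B"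
  by (simp add: full_I_iff tau_ract mult.assoc[symmetric])

lemma full_I_mult:
  assumes "x \<in> full_I B" "y \<in> full_I B"
  shows "x * y \<in> full_I B"
  unfolding full_I_iff
proof safe
  fix a b assume b: "b \<in> B"
  have "tau (a * b) (x * y) = coprod_sum a (\<lambda>p q. coprod_sum b (\<lambda>r s. tau (p * r) x * tau (q * s) y))"
    by (simp add: tau_times coprod_sum_mult[OF cbilinear_tau_mult])
  also have "\<dots> = coprod_sum a (\<lambda>p q. coprod_sum b (\<lambda>r s. (counit r * tau p x) * tau (q * s) y))"
    by (intro arg_cong2[of _ _ _ _ tensor_lift] ext coprod_sum_cong[OF b] clinear_dual_intros refl)
      (use assms(1) in \<open>simp add: full_I_iff\<close>)
  also have "\<dots> = coprod_sum a (\<lambda>p q. tau p x * coprod_sum b (\<lambda>r s. counit r *\<^sub>C tau (q * s) y))"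
    by (simp add: coprod_sum_mult_right ac_simps)
  also have "\<dots> = coprod_sum a (\<lambda>p q. tau p x * tau (q * b) y)"
    by (subst coprod_sum_counit_left) (auto intro!: clinear_dual_intros)
  also have "\<dots> = coprod_sum a (\<lambda>p q. counit b * (tau p x * tau q y))"
    using assms(2) b by (simp add: full_I_iff ac_simps)
  also have "\<dots> = counit b * tau a (x * y)"
    by (simp add: tau_times coprod_sum_mult_right)
  finally show "tau (a * b) (x * y) = counit b * tau a (x * y)" .
qed

text \<open>Write \<open>a S\<^sup>-\<^sup>1(b) = a S\<^sup>-\<^sup>1(b\<^sub>2) \<epsilon>(b\<^sub>1)\<close>.  As \<open>b\<^sub>1\<close> lies in \<open>B\<close>, the functional does not change if
  \<open>\<epsilon>(b\<^sub>1)\<close> is replaced by right multiplication with \<open>b\<^sub>1\<close>, which cancels \<open>S\<^sup>-\<^sup>1(b\<^sub>2)\<close>.\<close>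

lemma full_I_antipode_inv:
  assumes "x \<in> full_I B" "b \<in> B"
  shows "tau (a * antipode_inv b) x = counit b * tau a x"
proof -
  have "tau (a * antipode_inv b) x = coprod_sum b (\<lambda>p q. counit p *\<^sub>C tau (a * antipode_inv q) x)"
    by (subst coprod_sum_counit_left) (auto intro!: clinear_dual_intros)
  also have "\<dots> = coprod_sum b (\<lambda>p q. tau (a * (antipode_inv q * p)) x)"
    by (rule coprod_sum_cong[OF assms(2)])
      ((intro clinear_dual_intros)+, use assms(1) in \<open>simp add: full_I_iff mult.assoc[symmetric]\<close>)
  also have "\<dots> = tau (a * coprod_sum b (\<lambda>p q. antipode_inv q * p)) x"
    by (simp add: coprod_sum_mult_right clinear_apply_tensor_lift[OF clinear_tau])
  also have "\<dots> = counit b * tau a x"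
    by (simp add: antipode_inv_left mult_scaleC_right tau_scaleC_left)
  finally show ?thesis .
qed

text \<open>The adjoint moves \<open>b\<close> to \<open>S\<^sup>-\<^sup>1(b\<^sup>*)\<close>, which need not lie in \<open>B\<close>; the previous lemma takes care of that.\<close>

lemma full_I_star:
  assumes "x \<in> full_I B"
  shows "star x \<in> full_I B"
  unfolding full_I_iff
proof safe
  fix a b assume b: "b \<in> B"
  have "tau (a * b) (star x) = cnj (tau (star (antipode a) * antipode_inv (star b)) x)"
    by (simp add: tau_star antipode_mult star_mult antipode_inv_def)
  also have "\<dots> = counit b * tau a (star x)"
    by (simp add: full_I_antipode_inv[OF assms B_star[OF b]] counit_star tau_star)
  finally show "tau (a * b) (star x) = counit b * tau a (star x)" .
qed

end


section \<open>Admissible representations\<close>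

lemma mat_adjoint_carrier: "A \<in> carrier_mat n m \<Longrightarrow> mat_adjoint A \<in> carrier_mat m n"
  by (auto simp: mat_adjoint_def)

lemma mat_adjoint_index:
  "A \<in> carrier_mat n m \<Longrightarrow> i < m \<Longrightarrow> j < n \<Longrightarrow> mat_adjoint A $$ (i, j) = cnj (A $$ (j, i))"
  for A :: "complex mat"
  by (auto simp: mat_adjoint_def mat_of_rows_index)

lemma mat_adjoint_adjoint: "A \<in> carrier_mat n m \<Longrightarrow> mat_adjoint (mat_adjoint A) = A"
  for A :: "complex mat"
  using mat_adjoint_carrier[of A n m] mat_adjoint_carrier[of "mat_adjoint A" m n]
  by (intro eq_matI) (auto simp: mat_adjoint_index)

lemma mat_adjoint_mult:
  fixes A C :: "complex mat"
  assumes A: "A \<in> carrier_mat n m" and C: "C \<in> carrier_mat m k"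
  shows "mat_adjoint (A * C) = mat_adjoint C * mat_adjoint A"
proof (rule eq_matI)
  note c = mat_adjoint_carrier[OF A] mat_adjoint_carrier[OF C] mat_adjoint_carrier[OF mult_carrier_mat[OF A C]]
  fix i j
  assume "i < dim_row (mat_adjoint C * mat_adjoint A)" "j < dim_col (mat_adjoint C * mat_adjoint A)"
  then have ij: "i < k" "j < n" using c by auto
  have "mat_adjoint (A * C) $$ (i, j) = (\<Sum>l<m. cnj (A $$ (j, l)) * cnj (C $$ (l, i)))"
    using ij A C by (auto simp: mat_adjoint_index[OF mult_carrier_mat[OF A C]] scalar_prod_def lessThan_atLeast0)
  also have "\<dots> = (mat_adjoint C * mat_adjoint A) $$ (i, j)"
    using ij A C c
    by (auto simp: scalar_prod_def lessThan_atLeast0 mat_adjoint_index[OF A] mat_adjoint_index[OF C] mult.commute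
        intro!: sum.cong)
  finally show "mat_adjoint (A * C) $$ (i, j) = (mat_adjoint C * mat_adjoint A) $$ (i, j)" .
qed (use mat_adjoint_carrier[OF A] mat_adjoint_carrier[OF C] mat_adjoint_carrier[OF mult_carrier_mat[OF A C]] in auto)

text \<open>Both sides are inverse to the matrix \<open>u\<close>.\<close>

lemma unitary_comodule_antipode:
  assumes u: "unitary_comodule n u" and "i < n" "j < n"
  shows "antipode (u i j) = star (u j i)"
proof -
  have cancel: "(\<Sum>l<n. antipode (u i l) * u l k) = (if i = k then 1 else 0)" if "k < n" for k
  proof -
    have b: "cbilinear (\<lambda>p q::'a. antipode p * q)" by (intro clinear_intros)
    interpret L: Vector_Spaces.linear scaleC scaleC "tensor_lift (\<lambda>p q::'a. antipode p * q)"
      using clinear_tensor_lift[OF b] by (simp add: clinear_def)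
    have "coprod_sum (u i k) (\<lambda>p q. antipode p * q) = (\<Sum>l<n. antipode (u i l) * u l k)"
      using u \<open>i < n\<close> that by (simp add: unitary_comodule_def L.sum tensor_lift_tens[OF b])
    moreover have "counit (u i k) = (if i = k then 1 else 0)"
      using u \<open>i < n\<close> that by (simp add: unitary_comodule_def)
    ultimately show ?thesis by (cases "i = k") (simp_all add: antipode_left)
  qed
  have "antipode (u i j) = (\<Sum>l<n. antipode (u i l) * (if l = j then 1 else 0))"
    using \<open>j < n\<close> by (simp add: if_distrib[of "(*) _"] cong: if_cong)
  also have "\<dots> = (\<Sum>l<n. antipode (u i l) * (\<Sum>k<n. u l k * star (u j k)))"
    using u \<open>j < n\<close> by (intro sum.cong) (auto simp: unitary_comodule_def)
  also have "\<dots> = (\<Sum>k<n. (\<Sum>l<n. antipode (u i l) * u l k) * star (u j k))"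
    by (simp add: sum_distrib_left sum_distrib_right mult.assoc) (rule sum.swap)
  also have "\<dots> = (\<Sum>k<n. if i = k then star (u j k) else 0)"
    by (intro sum.cong) (auto simp: cancel)
  also have "\<dots> = star (u j i)" using \<open>i < n\<close> by simp
  finally show ?thesis .
qed

lemma admissible_U_star_rep:
  assumes "admissible_U n \<pi>"
  shows "\<pi> x \<in> carrier_mat n n" "\<pi> (x * y) = \<pi> x * \<pi> y" "\<pi> (star x) = mat_adjoint (\<pi> x)"
proof -
  obtain u where u: "unitary_comodule n u" and \<pi>: "\<pi> = comodule_rep n u"
    using assms by (auto simp: admissible_U_def)
  show c: "\<pi> x \<in> carrier_mat n n" for x by (simp add: \<pi> comodule_rep_def)
  have "tau (u i j) (x * y) = (\<Sum>k<n. tau (u i k) x * tau (u k j) y)" if "i < n" "j < n" for i j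
  proof -
    interpret L: Vector_Spaces.linear scaleC scaleC "tensor_lift (\<lambda>p q. tau p x * tau q y)"
      using clinear_tensor_lift[OF cbilinear_tau_mult] by (simp add: clinear_def)
    show ?thesis
      using u that by (simp add: unitary_comodule_def tau_times L.sum tensor_lift_tens[OF cbilinear_tau_mult])
  qed
  then show "\<pi> (x * y) = \<pi> x * \<pi> y"
    by (intro eq_matI) (auto simp: \<pi> comodule_rep_def scalar_prod_def lessThan_atLeast0)
  show "\<pi> (star x) = mat_adjoint (\<pi> x)"
  proof (rule eq_matI)
    fix i j assume "i < dim_row (mat_adjoint (\<pi> x))" "j < dim_col (mat_adjoint (\<pi> x))"
    then have ij: "i < n" "j < n" using mat_adjoint_carrier[OF c[of x]] by auto
    have "mat_adjoint (\<pi> x) $$ (i, j) = cnj (\<pi> x $$ (j, i))" by (rule mat_adjoint_index[OF c ij])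
    then show "\<pi> (star x) $$ (i, j) = mat_adjoint (\<pi> x) $$ (i, j)"
      using ij by (simp add: \<pi> comodule_rep_def tau_star unitary_comodule_antipode[OF u])
  qed (use mat_adjoint_carrier[OF c[of x]] c[of "star x"] in auto)
qed

context right_coideal
begin

text \<open>On functionals that factor through \<open>C\<close>, the representation is the compression of a
  *-representation of the full dual by an isometry onto an invariant subspace.\<close>

lemma admissible_I_star_rep:
  assumes \<rho>: "admissible_I B m \<rho>"
  shows "x \<in> full_I B \<Longrightarrow> \<rho> x \<in> carrier_mat m m"
    and "x \<in> full_I B \<Longrightarrow> y \<in> full_I B \<Longrightarrow> \<rho> (x * y) = \<rho> x * \<rho> y"
    and "x \<in> full_I B \<Longrightarrow> \<rho> (star x) = mat_adjoint (\<rho> x)"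
proof -
  obtain n \<pi> V where V: "V \<in> carrier_mat n m" and *: "admissible_U n \<pi> \<and> mat_adjoint V * V = 1\<^sub>m m \<and>
      (\<forall>x\<in>full_I B. \<rho> x \<in> carrier_mat m m \<and> \<pi> x * V = V * \<rho> x)"
    using \<rho> unfolding admissible_I_def by (elim exE bexE)
  then have \<pi>: "admissible_U n \<pi>" by simp
  have V: "V \<in> carrier_mat n m" "mat_adjoint V * V = 1\<^sub>m m"
    and c: "\<And>x. x \<in> full_I B \<Longrightarrow> \<rho> x \<in> carrier_mat m m"
    and \<pi>V: "\<And>x. x \<in> full_I B \<Longrightarrow> \<pi> x * V = V * \<rho> x"
    using V * by simp_all
  note p = admissible_U_star_rep[OF \<pi>]
  have V': "mat_adjoint V \<in> carrier_mat m n" by (rule mat_adjoint_carrier[OF V(1)])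
  have eq: "\<rho> x = mat_adjoint V * (\<pi> x * V)" if "x \<in> full_I B" for x
    using V(2) \<pi>V[OF that] c[OF that] assoc_mult_mat[OF V' V(1) c[OF that]] by simp
  show "x \<in> full_I B \<Longrightarrow> \<rho> x \<in> carrier_mat m m" by (rule c)
  show "\<rho> (x * y) = \<rho> x * \<rho> y" if x: "x \<in> full_I B" and y: "y \<in> full_I B"
  proof -
    have "\<pi> (x * y) * V = \<pi> x * (V * \<rho> y)"
      using p(1)[of x] p(1)[of y] V(1) by (simp add: p(2) \<pi>V[OF y, symmetric])
    also have "\<dots> = V * (\<rho> x * \<rho> y)"
      using assoc_mult_mat[OF p(1)[of x] V(1) c[OF y]] assoc_mult_mat[OF V(1) c[OF x] c[OF y]] \<pi>V[OF x] by simp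
    finally have "\<rho> (x * y) = mat_adjoint V * (V * (\<rho> x * \<rho> y))" by (simp add: eq[OF full_I_mult[OF x y]])
    then show ?thesis
      using V c[OF x] c[OF y] assoc_mult_mat[OF V' V(1) mult_carrier_mat[OF c[OF x] c[OF y]]] by simp
  qed
  show "\<rho> (star x) = mat_adjoint (\<rho> x)" if x: "x \<in> full_I B"
  proof -
    have "mat_adjoint (\<rho> x) = mat_adjoint (\<pi> x * V) * V"
      using mat_adjoint_mult[OF V' mult_carrier_mat[OF p(1)[of x] V(1)]] by (simp add: eq[OF x] mat_adjoint_adjoint[OF V(1)])
    also have "\<dots> = mat_adjoint V * (\<pi> (star x) * V)"
      using mat_adjoint_mult[OF p(1)[of x] V(1)] V' V(1) p(1)[of "star x"] by (simp add: p(3))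
    also have "\<dots> = \<rho> (star x)" by (simp add: eq[OF full_I_star[OF x]])
    finally show ?thesis by simp
  qed
qed

end

lemma mat_trace_mult:
  assumes "A \<in> carrier_mat n m" "C \<in> carrier_mat m n"
  shows "mat_trace (A * C) = (\<Sum>i<n. \<Sum>j<m. A $$ (i, j) * C $$ (j, i))"
  using assms by (auto simp: mat_trace_def scalar_prod_def lessThan_atLeast0)

lemma mat_trace_commute:
  fixes A C :: "'b::comm_semiring_0 mat"
  assumes "A \<in> carrier_mat n m" "C \<in> carrier_mat m n"
  shows "mat_trace (A * C) = mat_trace (C * A)"
  unfolding mat_trace_mult[OF assms] mat_trace_mult[OF assms(2,1)]
  by (subst sum.swap) (simp add: mult.commute)

text \<open>The trace is the sum of the values of the form of \<open>M\<close> at the conjugated rows of \<open>Y\<close>.\<close>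

lemma mat_positive_trace_nonneg:
  assumes M: "mat_positive M" "M \<in> carrier_mat n n" and Y: "Y \<in> carrier_mat n n"
  shows "0 \<le> mat_trace (M * (mat_adjoint Y * Y))"
proof -
  have Y': "mat_adjoint Y \<in> carrier_mat n n" by (rule mat_adjoint_carrier[OF Y])
  have "mat_trace (M * (mat_adjoint Y * Y))
      = (\<Sum>i<n. \<Sum>l<n. \<Sum>k<n. M $$ (i, l) * (cnj (Y $$ (k, l)) * Y $$ (k, i)))"
    using Y Y' by (subst mat_trace_mult[OF M(2) mult_carrier_mat[OF Y' Y]])
      (auto intro!: sum.cong simp: scalar_prod_def lessThan_atLeast0 mat_adjoint_index[OF Y] sum_distrib_left)
  also have "\<dots> = (\<Sum>i<n. \<Sum>k<n. \<Sum>l<n. M $$ (i, l) * (cnj (Y $$ (k, l)) * Y $$ (k, i)))"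
    by (intro sum.cong sum.swap refl)
  also have "\<dots> = (\<Sum>k<n. \<Sum>i<n. \<Sum>l<n. M $$ (i, l) * (cnj (Y $$ (k, l)) * Y $$ (k, i)))"
    by (rule sum.swap)
  also have "\<dots> = (\<Sum>k<n. (M *\<^sub>v vec n (\<lambda>l. cnj (Y $$ (k, l)))) \<bullet>c vec n (\<lambda>l. cnj (Y $$ (k, l))))"
    using M(2) by (auto intro!: sum.cong simp: scalar_prod_def lessThan_atLeast0 sum_distrib_right mult.assoc)
  also have "0 \<le> \<dots>"
    using M by (intro sum_nonneg) (auto simp: mat_positive_def)
  finally show ?thesis .
qed

locale coideal_irreps = right_coideal B for B :: "'a::hopf_star_algebra set" +
  fixes J :: "'i set" and d :: "'i \<Rightarrow> nat" and \<rho> :: "'i \<Rightarrow> 'a dual \<Rightarrow> complex mat"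
  assumes irreps: "complete_irreps B J d \<rho>"
begin

lemma rho_admissible: "\<beta> \<in> J \<Longrightarrow> admissible_I B (d \<beta>) (\<rho> \<beta>)"
  using irreps by (simp add: complete_irreps_def)

lemmas rho_carrier = admissible_I_star_rep(1)[OF rho_admissible]
  and rho_mult = admissible_I_star_rep(2)[OF rho_admissible]
  and rho_star = admissible_I_star_rep(3)[OF rho_admissible]

lemma I_supp_mult:
  assumes "x \<in> full_I B" "y \<in> full_I B"
  shows "I_supp J d \<rho> (x * y) \<subseteq> I_supp J d \<rho> x \<inter> I_supp J d \<rho> y"
  using left_mult_zero_mat[OF rho_carrier[OF _ assms(2)]] right_mult_zero_mat[OF rho_carrier[OF _ assms(1)]]
  by (auto simp: I_supp_def rho_mult assms)

lemma I_supp_star: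
  assumes "x \<in> full_I B"
  shows "I_supp J d \<rho> (star x) \<subseteq> I_supp J d \<rho> x"
proof -
  have "mat_adjoint (0\<^sub>m n n :: complex mat) = 0\<^sub>m n n" for n
    using mat_adjoint_carrier[of "0\<^sub>m n n" n n] by (intro eq_matI) (auto simp: mat_adjoint_index[of _ n n])
  then show ?thesis using assms by (auto simp: I_supp_def rho_star)
qed

lemma fin_I_mult:
  "x \<in> fin_I B J d \<rho> \<Longrightarrow> y \<in> full_I B \<Longrightarrow> x * y \<in> fin_I B J d \<rho>"
  "y \<in> full_I B \<Longrightarrow> x \<in> fin_I B J d \<rho> \<Longrightarrow> y * x \<in> fin_I B J d \<rho>"
  using I_supp_mult[of x y] I_supp_mult[of y x]
  by (auto simp: fin_I_def full_I_mult intro: finite_subset)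

lemma fin_I_star: "x \<in> fin_I B J d \<rho> \<Longrightarrow> star x \<in> fin_I B J d \<rho>"
  using I_supp_star[of x] by (auto simp: fin_I_def full_I_star intro: finite_subset)

text \<open>Products of two elements have smaller supports than their factors; summing over a common larger
  set makes their values comparable.\<close>

lemma trace_density_sum:
  assumes \<mu>: "trace_density B J d \<rho> \<psi> \<mu>" and x: "x \<in> fin_I B J d \<rho>"
    and K: "finite K" "I_supp J d \<rho> x \<subseteq> K" "K \<subseteq> J"
  shows "\<psi> x = (\<Sum>\<beta>\<in>K. mat_trace (\<rho> \<beta> \<mu> * \<rho> \<beta> x))"
proof -
  have "\<psi> x = (\<Sum>\<beta>\<in>I_supp J d \<rho> x. mat_trace (\<rho> \<beta> \<mu> * \<rho> \<beta> x))"
    using \<mu> x by (simp add: trace_density_def)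
  also have "\<dots> = (\<Sum>\<beta>\<in>K. mat_trace (\<rho> \<beta> \<mu> * \<rho> \<beta> x))"
  proof (rule sum.mono_neutral_left[OF K(1,2)], intro ballI)
    fix \<beta> assume "\<beta> \<in> K - I_supp J d \<rho> x"
    then have "\<beta> \<in> J" "\<rho> \<beta> x = 0\<^sub>m (d \<beta>) (d \<beta>)" using K by (auto simp: I_supp_def)
    moreover have "\<rho> \<beta> \<mu> \<in> carrier_mat (d \<beta>) (d \<beta>)"
      using rho_carrier[OF \<open>\<beta> \<in> J\<close>] \<mu> by (simp add: trace_density_def)
    ultimately show "mat_trace (\<rho> \<beta> \<mu> * \<rho> \<beta> x) = 0" by (simp add: mat_trace_def)
  qed
  finally show ?thesis .
qed

lemma trace_density_positive:
  assumes \<mu>: "trace_density B J d \<rho> \<psi> \<mu>" and y: "y \<in> fin_I B J d \<rho>"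
  shows "0 \<le> \<psi> (star y * y)"
proof -
  have y': "y \<in> full_I B" "star y \<in> full_I B" "star y * y \<in> fin_I B J d \<rho>"
    using y fin_I_mult(1)[OF fin_I_star[OF y]] by (auto simp: fin_I_def full_I_star)
  have "\<psi> (star y * y) = (\<Sum>\<beta>\<in>I_supp J d \<rho> (star y * y). mat_trace (\<rho> \<beta> \<mu> * \<rho> \<beta> (star y * y)))"
    using \<mu> y' by (simp add: trace_density_def)
  also have "0 \<le> \<dots>"
  proof (rule sum_nonneg)
    fix \<beta> assume "\<beta> \<in> I_supp J d \<rho> (star y * y)"
    then have \<beta>: "\<beta> \<in> J" by (simp add: I_supp_def)
    then show "0 \<le> mat_trace (\<rho> \<beta> \<mu> * \<rho> \<beta> (star y * y))"
      using \<mu> y' rho_carrier[OF \<beta>] unfolding rho_mult[OF \<beta> y'(2,1)] rho_star[OF \<beta> y'(1)]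
      by (intro mat_positive_trace_nonneg) (auto simp: trace_density_def)
  qed
  finally show ?thesis .
qed

text \<open>In each block this is \<open>Tr(\<mu> z \<mu> x \<mu>\<^sup>-\<^sup>1) = Tr(\<mu> x z)\<close>.\<close>

lemma trace_density_modular:
  assumes \<mu>: "trace_density B J d \<rho> \<psi> \<mu>" and x: "x \<in> fin_I B J d \<rho>" and z: "z \<in> fin_I B J d \<rho>"
    and \<nu>: "\<nu> \<in> full_I B" "\<nu> * \<mu> = 1"
  shows "\<psi> (z * (\<mu> * x * \<nu>)) = \<psi> (x * z)"
proof -
  have m: "\<mu> \<in> full_I B" using \<mu> by (simp add: trace_density_def)
  have f: "x \<in> full_I B" "z \<in> full_I B" using x z by (simp_all add: fin_I_def)
  let ?K = "I_supp J d \<rho> z"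
  have K: "finite ?K" "?K \<subseteq> J" using z by (auto simp: fin_I_def I_supp_def)
  have "\<psi> (z * (\<mu> * x * \<nu>)) = (\<Sum>\<beta>\<in>?K. mat_trace (\<rho> \<beta> \<mu> * \<rho> \<beta> (z * (\<mu> * x * \<nu>))))"
    using I_supp_mult[OF f(2), of "\<mu> * x * \<nu>"] full_I_mult[OF full_I_mult[OF m f(1)] \<nu>(1)]
    by (intro trace_density_sum[OF \<mu>] K fin_I_mult(1) z) auto
  also have "\<dots> = (\<Sum>\<beta>\<in>?K. mat_trace (\<rho> \<beta> \<mu> * \<rho> \<beta> (x * z)))"
  proof (rule sum.cong[OF refl])
    fix \<beta> assume "\<beta> \<in> ?K"
    then have \<beta>: "\<beta> \<in> J" by (simp add: I_supp_def)
    have trace: "mat_trace (\<rho> \<beta> (a * b)) = mat_trace (\<rho> \<beta> (b * a))" if "a \<in> full_I B" "b \<in> full_I B" for a b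
      unfolding rho_mult[OF \<beta> that] rho_mult[OF \<beta> that(2,1)]
      by (rule mat_trace_commute[OF rho_carrier[OF \<beta> that(1)] rho_carrier[OF \<beta> that(2)]])
    have "mat_trace (\<rho> \<beta> \<mu> * \<rho> \<beta> (z * (\<mu> * x * \<nu>))) = mat_trace (\<rho> \<beta> ((\<mu> * z * \<mu> * x) * \<nu>))"
      using f m \<nu>(1) by (subst rho_mult[OF \<beta>, symmetric]) (auto intro!: full_I_mult simp: mult.assoc)
    also have "\<dots> = mat_trace (\<rho> \<beta> (\<nu> * (\<mu> * z * \<mu> * x)))"
      using f m \<nu>(1) by (intro trace full_I_mult)
    also have "\<nu> * (\<mu> * z * \<mu> * x) = z * (\<mu> * x)"
      by (simp add: mult.assoc[symmetric] \<nu>(2))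
    also have "mat_trace (\<rho> \<beta> (z * (\<mu> * x))) = mat_trace (\<rho> \<beta> (\<mu> * (x * z)))"
      using f m by (subst trace) (auto intro!: full_I_mult simp: mult.assoc)
    also have "\<dots> = mat_trace (\<rho> \<beta> \<mu> * \<rho> \<beta> (x * z))"
      using f m by (simp add: rho_mult[OF \<beta>] full_I_mult)
    finally show "mat_trace (\<rho> \<beta> \<mu> * \<rho> \<beta> (z * (\<mu> * x * \<nu>))) = mat_trace (\<rho> \<beta> \<mu> * \<rho> \<beta> (x * z))" .
  qed
  also have "\<dots> = \<psi> (x * z)"
    using I_supp_mult[OF f] f by (intro trace_density_sum[OF \<mu>, symmetric] K fin_I_mult(1) x) auto
  finally show ?thesis .
qed

end


section \<open>Positive semidefinite kernels\<close>

definition psd_kernel :: "'k set \<Rightarrow> ('k \<Rightarrow> 'k \<Rightarrow> complex) \<Rightarrow> bool"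
  where "psd_kernel S Q \<longleftrightarrow> (\<forall>c. 0 \<le> (\<Sum>i\<in>S. \<Sum>j\<in>S. cnj (c i) * c j * Q i j))"

lemma psd_kernel_subset:
  assumes "finite S" "T \<subseteq> S" "psd_kernel S Q"
  shows "psd_kernel T Q"
  unfolding psd_kernel_def
proof
  fix c :: "'a \<Rightarrow> complex"
  let ?c = "\<lambda>i. if i \<in> T then c i else 0"
  have "0 \<le> (\<Sum>i\<in>S. \<Sum>j\<in>S. cnj (?c i) * ?c j * Q i j)"
    using assms(3) unfolding psd_kernel_def by (rule spec)
  also have "\<dots> = (\<Sum>i\<in>T. \<Sum>j\<in>S. cnj (?c i) * ?c j * Q i j)"
    using assms(1,2) by (intro sum.mono_neutral_right) auto
  also have "\<dots> = (\<Sum>i\<in>T. \<Sum>j\<in>T. cnj (c i) * c j * Q i j)"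
    using assms(1,2) by (intro sum.cong[OF refl] sum.mono_neutral_cong_right) auto
  finally show "0 \<le> (\<Sum>i\<in>T. \<Sum>j\<in>T. cnj (c i) * c j * Q i j)" .
qed

lemma psd_kernel_pair:
  assumes "finite S" "psd_kernel S Q" "i \<in> S" "j \<in> S" "i \<noteq> j"
  shows "0 \<le> cnj a * a * Q i i + cnj a * b * Q i j + cnj b * a * Q j i + cnj b * b * Q j j"
proof -
  have "psd_kernel {i, j} Q" using assms by (intro psd_kernel_subset[OF assms(1) _ assms(2)]) auto
  then have "0 \<le> (\<Sum>k\<in>{i, j}. \<Sum>l\<in>{i, j}. cnj ((\<lambda>k. if k = i then a else b) k) * (\<lambda>k. if k = i then a else b) l * Q k l)"
    unfolding psd_kernel_def by (rule spec)
  then show ?thesis using assms(5) by (simp add: add_ac)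
qed

lemma psd_kernel_diag:
  assumes "finite S" "psd_kernel S Q" "i \<in> S"
  shows "0 \<le> Q i i"
proof -
  have "psd_kernel {i} Q" using assms by (intro psd_kernel_subset[OF assms(1) _ assms(2)]) auto
  then have "0 \<le> (\<Sum>k\<in>{i}. \<Sum>l\<in>{i}. cnj ((\<lambda>_. 1) k) * (\<lambda>_. 1) l * Q k l)"
    unfolding psd_kernel_def by (rule spec)
  then show ?thesis by simp
qed

lemma psd_kernel_hermitian:
  assumes "finite S" "psd_kernel S Q" "i \<in> S" "j \<in> S"
  shows "Q j i = cnj (Q i j)"
proof (cases "i = j")
  case True
  then show ?thesis using psd_kernel_diag[OF assms(1-3)] by (auto simp: complex_eq_iff less_eq_complex_def)
next
  case False
  note p = psd_kernel_pair[OF assms False]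
  show ?thesis
    using p[of 1 1] p[of 1 \<i>] psd_kernel_diag[OF assms(1-3)] psd_kernel_diag[OF assms(1,2,4)]
    by (auto simp: complex_eq_iff less_eq_complex_def)
qed

lemma psd_kernel_zero:
  assumes "finite S" "psd_kernel S Q" "i \<in> S" "a \<in> S" "Q a a = 0"
  shows "Q i a = 0"
proof (cases "i = a")
  case False
  show ?thesis
  proof (rule ccontr)
    assume q: "Q i a \<noteq> 0"
    \<comment> \<open>chosen so that the form takes the value \<open>-1\<close> at the test vector below\<close>
    define s where "s = (Re (Q i i) + 1) / (2 * (cmod (Q i a))\<^sup>2)"
    have s: "s * (2 * (cmod (Q i a))\<^sup>2) = Re (Q i i) + 1" using q by (simp add: s_def)
    have h: "Q a i = cnj (Q i a)" by (rule psd_kernel_hermitian[OF assms(1-4)])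
    have "0 \<le> Q i i + (- of_real s * cnj (Q i a)) * Q i a + cnj (- of_real s * cnj (Q i a)) * Q a i"
      using psd_kernel_pair[OF assms(1-4) False, of 1 "- of_real s * cnj (Q i a)"] assms(5) by simp
    then have "0 \<le> Re (Q i i + (- of_real s * cnj (Q i a)) * Q i a + cnj (- of_real s * cnj (Q i a)) * Q a i)"
      by (simp only: less_eq_complex_def zero_complex.sel)
    also have "\<dots> = Re (Q i i) - s * (2 * (cmod (Q i a))\<^sup>2)"
      unfolding cmod_power2 by (simp add: h power2_eq_square algebra_simps)
    also have "\<dots> = -1" using s by simp
    finally show False by simp
  qed
qed (use assms in simp)

text \<open>One step of Gaussian elimination splits off a rank-one kernel from \<open>Q\<close>; the Schur product of
  a rank-one kernel with \<open>P\<close> is a value of the quadratic form of \<open>P\<close>.\<close>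

lemma schur_product_nonneg:
  assumes "finite S" "psd_kernel S P" "psd_kernel S Q"
  shows "0 \<le> (\<Sum>i\<in>S. \<Sum>j\<in>S. P i j * Q i j)"
  using assms
proof (induction S arbitrary: Q)
  case (insert a S)
  let ?S = "insert a S"
  have fin: "finite ?S" using insert.hyps by simp
  have P: "psd_kernel S P" using psd_kernel_subset[OF fin _ insert.prems(1)] by auto
  show ?case
  proof (cases "Q a a = 0")
    case True
    have "Q i a = 0" "Q a i = 0" if "i \<in> ?S" for i
      using psd_kernel_zero[OF fin insert.prems(2) that insertI1 True]
        psd_kernel_hermitian[OF fin insert.prems(2) that insertI1] by auto
    then have "(\<Sum>i\<in>?S. \<Sum>j\<in>?S. P i j * Q i j) = (\<Sum>i\<in>S. \<Sum>j\<in>S. P i j * Q i j)"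
      using insert.hyps by simp
    then show ?thesis
      using insert.IH[OF P psd_kernel_subset[OF fin _ insert.prems(2)]] by auto
  next
    case False
    have pos: "0 \<le> Q a a" by (rule psd_kernel_diag[OF fin insert.prems(2) insertI1])
    have herm: "Q i a = cnj (Q a i)" if "i \<in> ?S" for i
      by (rule psd_kernel_hermitian[OF fin insert.prems(2) insertI1 that])
    have real: "cnj (Q a a) = Q a a" using herm[OF insertI1] by simp
    define Q' where "Q' i j = Q i j - Q i a * Q a j / Q a a" for i j
    have "psd_kernel S Q'"
      unfolding psd_kernel_def
    proof
      fix c :: "'a \<Rightarrow> complex"
      define u where "u = (\<Sum>j\<in>S. c j * Q a j)"
      have cu: "cnj u = (\<Sum>i\<in>S. cnj (c i) * Q i a)"
        unfolding u_def by (simp add: herm)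
      \<comment> \<open>the value at \<open>a\<close> that minimizes the quadratic form\<close>
      define c' where "c' = c(a := - u / Q a a)"
      have c': "c' i = c i" if "i \<in> S" for i using that insert.hyps by (auto simp: c'_def)
      have c'a: "c' a = - u / Q a a" by (simp add: c'_def)
      have row: "(\<Sum>j\<in>S. cnj (c' a) * c' j * Q a j) = cnj (c' a) * u"
        unfolding u_def sum_distrib_left by (intro sum.cong) (simp_all add: c')
      have col: "(\<Sum>i\<in>S. cnj (c' i) * c' a * Q i a) = c' a * cnj u"
        unfolding cu sum_distrib_left by (intro sum.cong) (simp_all add: c')
      have block: "(\<Sum>i\<in>S. \<Sum>j\<in>S. cnj (c' i) * c' j * Q i j) = (\<Sum>i\<in>S. \<Sum>j\<in>S. cnj (c i) * c j * Q i j)"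
        by (intro sum.cong) (simp_all add: c')
      have "(\<Sum>i\<in>S. \<Sum>j\<in>S. cnj (c i) * c j * (Q i a * Q a j / Q a a)) = cnj u * u / Q a a"
        unfolding cu unfolding u_def sum_product sum_divide_distrib by (intro sum.cong) (simp_all add: mult_ac)
      then have "(\<Sum>i\<in>S. \<Sum>j\<in>S. cnj (c i) * c j * Q' i j)
          = (\<Sum>i\<in>S. \<Sum>j\<in>S. cnj (c i) * c j * Q i j) - cnj u * u / Q a a"
        by (simp add: Q'_def right_diff_distrib sum_subtractf)
      also have "\<dots> = (\<Sum>i\<in>?S. \<Sum>j\<in>?S. cnj (c' i) * c' j * Q i j)"
        using insert.hyps False
        by (simp add: sum.distrib row col block) (simp add: c'a real field_simps)
      also have "0 \<le> \<dots>" using insert.prems(2) unfolding psd_kernel_def by (rule spec)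
      finally show "0 \<le> (\<Sum>i\<in>S. \<Sum>j\<in>S. cnj (c i) * c j * Q' i j)" .
    qed
    from insert.IH[OF P this] have "0 \<le> (\<Sum>i\<in>S. \<Sum>j\<in>S. P i j * Q' i j)" .
    also have "\<dots> = (\<Sum>i\<in>?S. \<Sum>j\<in>?S. P i j * Q' i j)"
      using insert.hyps False by (simp add: Q'_def)
    finally have 1: "0 \<le> (\<Sum>i\<in>?S. \<Sum>j\<in>?S. P i j * Q' i j)" .
    have "0 \<le> (\<Sum>i\<in>?S. \<Sum>j\<in>?S. cnj (Q a i) * Q a j * P i j)"
      using insert.prems(1) unfolding psd_kernel_def by (rule spec)
    also have "\<dots> = (\<Sum>i\<in>?S. \<Sum>j\<in>?S. P i j * (Q i a * Q a j))"
      by (intro sum.cong) (simp_all add: herm mult_ac)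
    finally have "0 \<le> (\<Sum>i\<in>?S. \<Sum>j\<in>?S. P i j * (Q i a * Q a j)) / Q a a"
      using pos by (auto simp: less_eq_complex_def complex_eq_iff Re_divide Im_divide)
    also have "\<dots> = (\<Sum>i\<in>?S. \<Sum>j\<in>?S. P i j * (Q i a * Q a j / Q a a))"
      by (simp only: sum_divide_distrib times_divide_eq_right)
    finally have 2: "0 \<le> (\<Sum>i\<in>?S. \<Sum>j\<in>?S. P i j * (Q i a * Q a j / Q a a))" .
    have "(\<Sum>i\<in>?S. \<Sum>j\<in>?S. P i j * Q i j)
        = (\<Sum>i\<in>?S. \<Sum>j\<in>?S. P i j * Q' i j) + (\<Sum>i\<in>?S. \<Sum>j\<in>?S. P i j * (Q i a * Q a j / Q a a))"
      unfolding sum.distrib[symmetric] Q'_def by (intro sum.cong) (simp_all add: right_diff_distrib)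
    then show ?thesis using add_nonneg_nonneg[OF 1 2] by (simp only:)
  qed
qed simp

lemma psd_kernel_gram:
  fixes h :: "'b::complex_vector \<Rightarrow> 'b \<Rightarrow> complex"
  assumes "csubspace V" "\<And>i. i \<in> S \<Longrightarrow> x i \<in> V"
    and right: "\<And>y. clinear (h y)"
    and left: "\<And>y z w. h (y + z) w = h y w + h z w" "\<And>c y w. h (c *\<^sub>C y) w = cnj c * h y w"
    and pos: "\<And>y. y \<in> V \<Longrightarrow> 0 \<le> h y y"
  shows "psd_kernel S (\<lambda>i j. h (x i) (x j))"
  unfolding psd_kernel_def
proof
  fix c :: "'a \<Rightarrow> complex"
  let ?y = "\<Sum>j\<in>S. c j *\<^sub>C x j"
  have "?y \<in> V"
    using assms(1,2) by (intro complex_vector.subspace_sum complex_vector.subspace_scale)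
  have h0: "h 0 w = 0" for w using left(1)[of 0 0 w] by simp
  have "h (\<Sum>j\<in>F. c j *\<^sub>C x j) w = (\<Sum>j\<in>F. cnj (c j) * h (x j) w)" for F w
    by (induction F rule: infinite_finite_induct) (simp_all add: left h0)
  then have left_sum: "h ?y w = (\<Sum>j\<in>S. cnj (c j) * h (x j) w)" for w .
  have right_sum: "h y ?y = (\<Sum>j\<in>S. c j * h y (x j))" for y
  proof -
    interpret Vector_Spaces.linear scaleC scaleC "h y" using right by (simp add: clinear_def)
    show ?thesis by (simp add: sum scale)
  qed
  have "h ?y ?y = (\<Sum>i\<in>S. \<Sum>j\<in>S. cnj (c i) * c j * h (x i) (x j))"
    by (subst left_sum) (simp add: right_sum sum_distrib_left mult.assoc)
  then show "0 \<le> (\<Sum>i\<in>S. \<Sum>j\<in>S. cnj (c i) * c j * h (x i) (x j))"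
    using pos[OF \<open>?y \<in> V\<close>] by simp
qed

lemma psd_kernel_haar: "psd_kernel S (\<lambda>i j. haar (star (x i) * x j))"
  by (rule psd_kernel_gram[where V = UNIV])
    (auto intro!: clinear_intros haar_positive simp: star_add star_scaleC distrib_right mult_scaleC_left
      haar_linear[unfolded clinear_iff])

text \<open>By the Cauchy-Schwarz inequality \<open>a\<close> is orthogonal to everything, and the Haar state is nondegenerate.\<close>

lemma haar_faithful:
  assumes "haar (star a * a) = 0"
  shows "a = 0"
proof (rule haar_nondegenerate)
  fix b :: 'a
  let ?x = "\<lambda>i. if i then star b else a"
  have "haar (star (?x True) * ?x False) = 0"
    by (rule psd_kernel_zero[OF _ psd_kernel_haar[of UNIV ?x]]) (use assms in simp_all)
  then show "haar (b * a) = 0" by simp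
qed


section \<open>Invariant functionals\<close>

context coideal_irreps
begin

text \<open>The difference \<open>x - \<tau>(1, x) 1\<close> is annihilated by the character, hence by its support projection.\<close>

lemma support_projection_absorbs:
  assumes p: "support_projection B J d \<rho> p" and x: "x \<in> full_I B"
  shows "p * x = tau 1 x *\<^sub>C p"
proof -
  have tau_diff: "tau a (x - y) = tau a x - tau a y" for a and x y :: "'a dual"
    by transfer simp
  let ?x = "x - tau 1 x *\<^sub>C 1"
  have "?x \<in> full_I B"
    using x full_I_one by (simp add: full_I_def tau_diff tau_scaleC_right)
  moreover have "tau 1 ?x = 0" by (simp add: tau_diff tau_scaleC_right tau_one counit_one)
  ultimately have "p * ?x = 0" using p unfolding support_projection_def by metis
  then show ?thesis by (simp add: right_diff_distrib mult_scaleC_right)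
qed

text \<open>The module action moves \<open>y\<close> past \<open>\<Phi>\<^sub>C \<lhd> a\<close>, and \<open>\<Phi>\<^sub>C\<close> absorbs what is left of it.  So on these
  products \<open>\<psi>\<close> is evaluation at \<open>a\<close> of \<open>g\<close> times \<open>y \<circ> S\<^sup>-\<^sup>1\<close>, and both \<open>g\<close> and \<open>S\<close> are invertible.\<close>

lemma invariant_functional_nondegenerate:
  assumes p: "support_projection B J d \<rho> p" and g: "grouplike g"
    and \<psi>: "clinear \<psi>" "\<And>a. \<psi> (ract p a) = tau a g"
    and y: "y \<in> full_I B" and zero: "\<And>a. \<psi> (ract p a * y) = 0"
  shows "y = 0"
proof -
  have "clinear (\<lambda>a. tau (antipode_inv a) y)" by (intro clinear_dual_intros)
  then have h: "tau a (Abs_dual (\<lambda>a. tau (antipode_inv a) y)) = tau (antipode_inv a) y" for a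
    by (simp add: tau.rep_eq Abs_dual_inverse)
  define h' where "h' = Abs_dual (\<lambda>a. tau (antipode_inv a) y)"
  have "tau a (g * h') = 0" for a
  proof -
    have "ract p a * y = coprod_sum a (\<lambda>s q. ract (tau 1 (ract y (antipode_inv q)) *\<^sub>C p) s)"
      unfolding ract_mult_untwist by (simp add: support_projection_absorbs[OF p full_I_ract[OF y]])
    also have "\<dots> = coprod_sum a (\<lambda>s q. tau (antipode_inv q) y *\<^sub>C ract p s)"
      by (simp add: ract_linear_left[unfolded clinear_iff] tau_ract)
    finally have "\<psi> (ract p a * y) = coprod_sum a (\<lambda>s q. tau s g * tau q h')"
      by (simp add: clinear_apply_tensor_lift[OF \<psi>(1)] \<psi>(1)[unfolded clinear_iff] \<psi>(2) h h'_def mult.commute)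
    then show ?thesis using zero by (simp add: tau_times)
  qed
  then have "g * h' = 0" by (intro dual_eqI) (simp add: zero_dual.rep_eq tau.rep_eq)
  then have "dual_antipode g * g * h' = 0" by (simp add: mult.assoc)
  then have "h' = 0" by (simp add: grouplike_inverse(2)[OF g])
  then have "tau (antipode_inv a) y = 0" for a using h[of a] by (simp add: h'_def zero_dual.rep_eq tau.rep_eq)
  then have "tau a y = 0" for a using antipode_inv_antipode[of a] by metis
  then show "y = 0" by (intro dual_eqI) (simp add: zero_dual.rep_eq tau.rep_eq)
qed

end


section \<open>The double\<close>

lemma double_cong:
  assumes "\<And>b. b \<in> B \<Longrightarrow> jB' b = jB b" "\<And>y. y \<in> I \<Longrightarrow> jI' y = jI y"
  shows "double B I jB' jI' = double B I jB jI"
proof -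
  have "{jI' y * jB' b |y b. y \<in> I \<and> b \<in> B} = {jI y * jB b |y b. y \<in> I \<and> b \<in> B}"
    using assms by (intro Collect_cong ex_cong1) auto
  then show ?thesis by (simp add: double_def)
qed

text \<open>The conditions on a double only involve the values of the two maps on \<open>B\<close> and on \<open>I\<close>, so these
  maps may be replaced by linear extensions to the whole space.\<close>

lemma is_double_cong:
  assumes double: "is_double B I jB jI"
    and B: "right_coideal_star_subalgebra B"
    and I: "\<And>x y. x \<in> I \<Longrightarrow> y \<in> I \<Longrightarrow> x * y \<in> I" "\<And>x. x \<in> I \<Longrightarrow> star x \<in> I"
      "\<And>x a. x \<in> I \<Longrightarrow> ract x a \<in> I" "csubspace I"
    and eqB: "\<And>b. b \<in> B \<Longrightarrow> jB' b = jB b" and eqI: "\<And>y. y \<in> I \<Longrightarrow> jI' y = jI y"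
  shows "is_double B I jB' jI'"
proof -
  interpret right_coideal B using B by unfold_locales
  have sweedler_eq: "(\<Sum>(s, q)\<leftarrow>ps. jB' s * jI' (ract y q)) = (\<Sum>(s, q)\<leftarrow>ps. jB s * jI (ract y q))"
      "(\<Sum>(s, q)\<leftarrow>ps. jI' (ract y (f q)) * jB' s) = (\<Sum>(s, q)\<leftarrow>ps. jI (ract y (f q)) * jB s)"
    if "y \<in> I" "sweedler B b ps" for y b ps f
    using that by (auto simp: sweedler_def eqB eqI I intro!: arg_cong[of _ _ sum_list] map_cong)
  have lin: "clinear_on B jB' \<longleftrightarrow> clinear_on B jB" "clinear_on I jI' \<longleftrightarrow> clinear_on I jI"
    using B_subspace I(4) eqB eqI
    by (auto simp: clinear_on_def complex_vector.subspace_add complex_vector.subspace_scale)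
  have double_eq: "double B I jB' jI' = double B I jB jI"
    by (rule double_cong) (simp_all add: eqB eqI)
  have "\<forall>y\<in>I. \<forall>b\<in>B. \<forall>ps. sweedler B b ps \<longrightarrow>
      jI y * jB b = (\<Sum>(p, q)\<leftarrow>ps. jB p * jI (ract y q)) \<and>
      jB b * jI y = (\<Sum>(p, q)\<leftarrow>ps. jI (ract y (inv_into UNIV antipode q)) * jB p)"
    using double unfolding is_double_def by (elim conjE)
  then have cross: "\<forall>y\<in>I. \<forall>b\<in>B. \<forall>ps. sweedler B b ps \<longrightarrow>
      jI' y * jB' b = (\<Sum>(p, q)\<leftarrow>ps. jB' p * jI' (ract y q)) \<and>
      jB' b * jI' y = (\<Sum>(p, q)\<leftarrow>ps. jI' (ract y (inv_into UNIV antipode q)) * jB' p)"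
    by (auto simp only: sweedler_eq eqB eqI)
  show ?thesis
    using double cross unfolding is_double_def lin double_eq
    by (simp add: eqB eqI B_one B_mult B_star I cong: ball_cong)
qed

text \<open>Here \<open>p\<close> is \<open>\<Phi>\<^sub>C\<close>, and \<open>\<nu>\<close> is the inverse of the density \<open>\<mu>\<close>.  The maps \<open>\<psi>\<close>, \<open>\<sigma>\<close>, \<open>jB\<close> and \<open>jI\<close> are
  linear everywhere but meaningful only on \<open>I\<close> or \<open>B\<close>; thus Sweedler sums over all of \<open>A\<close> may be formed
  with them.\<close>

locale double_data = coideal_irreps B J d \<rho>
  for B :: "'a::cqg_hopf_star_algebra set"
    and J :: "'i set" and d :: "'i \<Rightarrow> nat" and \<rho> :: "'i \<Rightarrow> 'a dual \<Rightarrow> complex mat" +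
  fixes I :: "'a dual set" and p g \<mu> \<nu> :: "'a dual" and \<psi> :: "'a dual \<Rightarrow> complex"
    and \<sigma> :: "'a \<Rightarrow> 'a"
    and jB :: "'a \<Rightarrow> 'm::complex_star_algebra_1" and jI :: "'a dual \<Rightarrow> 'm"
  assumes I_fin: "I = fin_I B J d \<rho>"
    and support: "support_projection B J d \<rho> p"
    and I_range: "I = {ract p a |a. True}"
    and grouplike: "grouplike g"
    and psi_linear: "clinear \<psi>" and psi_invariant: "\<psi> (ract p a) = tau a g"
    and density: "trace_density B J d \<rho> \<psi> \<mu>"
    and nu: "\<nu> \<in> full_I B" "\<mu> * \<nu> = 1" "\<nu> * \<mu> = 1"
    and sigma_linear: "clinear \<sigma>" and sigma_bij: "bij_betw \<sigma> B B"
    and sigma_modular: "b \<in> B \<Longrightarrow> c \<in> B \<Longrightarrow> haar (b * c) = haar (c * \<sigma> b)"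
    and jB_linear: "clinear jB" and jI_linear: "clinear jI"
    and double: "is_double B I jB jI"
begin

abbreviation D :: "'m set" where "D \<equiv> double B I jB jI"

abbreviation \<kappa> :: "'a dual \<Rightarrow> 'a dual" where "\<kappa> x \<equiv> \<mu> * x * \<nu>"

abbreviation \<theta> :: "'a \<Rightarrow> 'a" where "\<theta> b \<equiv> \<sigma> (lact (ring_inverse g) b)"

lemma jB_one: "jB 1 = 1" and jB_mult: "b \<in> B \<Longrightarrow> c \<in> B \<Longrightarrow> jB (b * c) = jB b * jB c"
  and jB_star: "b \<in> B \<Longrightarrow> jB (star b) = star (jB b)"
  and jI_mult: "x \<in> I \<Longrightarrow> y \<in> I \<Longrightarrow> jI (x * y) = jI x * jI y"
  and jI_star: "x \<in> I \<Longrightarrow> jI (star x) = star (jI x)"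
  using double by (simp_all add: is_double_def)

lemma I_subspace: "csubspace I"
  unfolding I_range by (rule ract_range_subspace)

lemma I_full: "x \<in> I \<Longrightarrow> x \<in> full_I B"
  by (simp add: I_fin fin_I_def)

lemma mu_full: "\<mu> \<in> full_I B"
  using density by (simp add: trace_density_def)

lemma I_mult: "x \<in> I \<Longrightarrow> y \<in> I \<Longrightarrow> x * y \<in> I"
  using fin_I_mult(1)[of x y] I_full[of y] by (simp add: I_fin)

lemma I_star: "x \<in> I \<Longrightarrow> star x \<in> I"
  by (simp add: I_fin fin_I_star)

lemma I_ract: "x \<in> I \<Longrightarrow> ract x a \<in> I"
  unfolding I_range by (auto simp: ract_ract)

lemma I_conj: "u \<in> full_I B \<Longrightarrow> v \<in> full_I B \<Longrightarrow> x \<in> I \<Longrightarrow> u * x * v \<in> I"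
  by (simp add: I_fin fin_I_mult)

lemma kappa_I: "x \<in> I \<Longrightarrow> \<kappa> x \<in> I"
  by (intro I_conj mu_full nu)

lemma sigma_B: "b \<in> B \<Longrightarrow> \<sigma> b \<in> B"
  using sigma_bij by (auto simp: bij_betw_def)

lemma theta_B: "b \<in> B \<Longrightarrow> \<theta> b \<in> B"
  by (intro sigma_B lact_in_B)

lemma lact_inverse: "lact (ring_inverse g) (lact g b) = b" "lact g (lact (ring_inverse g) b) = b"
  using grouplike_inverse[OF grouplike] by (simp_all add: lact_mult[symmetric] lact_one)

lemma psi_ract:
  assumes "y \<in> I"
  shows "\<psi> (ract y a) = tau a g * \<psi> y"
proof -
  obtain c where c: "y = ract p c" using assms unfolding I_range by blast
  then show ?thesis using grouplike by (simp add: ract_ract psi_invariant grouplike_def mult.commute)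
qed

lemmas clinear_double_intros = clinear_dual_intros clinear_compose[OF psi_linear]
  clinear_compose[OF jB_linear] clinear_compose[OF jI_linear] clinear_compose[OF lact_linear]
  clinear_compose[OF sigma_linear]

lemma cross_relations:
  assumes "y \<in> I" "b \<in> B" "sweedler B b ps"
  shows "jI y * jB b = (\<Sum>(s, q)\<leftarrow>ps. jB s * jI (ract y q))"
    and "jB b * jI y = (\<Sum>(s, q)\<leftarrow>ps. jI (ract y (antipode_inv q)) * jB s)"
proof -
  have "\<forall>y\<in>I. \<forall>b\<in>B. \<forall>ps. sweedler B b ps \<longrightarrow>
      jI y * jB b = (\<Sum>(s, q)\<leftarrow>ps. jB s * jI (ract y q)) \<and>
      jB b * jI y = (\<Sum>(s, q)\<leftarrow>ps. jI (ract y (inv_into UNIV antipode q)) * jB s)"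
    using double unfolding is_double_def by (elim conjE)
  note rel = this[unfolded inv_antipode, rule_format, OF assms]
  show "jI y * jB b = (\<Sum>(s, q)\<leftarrow>ps. jB s * jI (ract y q))" by (rule conjunct1[OF rel])
  show "jB b * jI y = (\<Sum>(s, q)\<leftarrow>ps. jI (ract y (antipode_inv q)) * jB s)" by (rule conjunct2[OF rel])
qed

lemma jB_jI:
  assumes "y \<in> I" "b \<in> B"
  shows "jB b * jI y = coprod_sum b (\<lambda>s q. jI (ract y (antipode_inv q)) * jB s)"
proof -
  obtain ps where ps: "sweedler B b ps" using assms(2) by (rule sweedler_exists)
  have "cbilinear (\<lambda>s q. jI (ract y (antipode_inv q)) * jB s)" by (intro clinear_double_intros)
  then show ?thesis by (simp only: cross_relations(2)[OF assms ps] coprod_sum_sweedler[OF ps])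
qed

lemma D_subspace: "csubspace D"
  by (simp add: double_def complex_vector.subspace_span)

lemma D_generator: "y \<in> I \<Longrightarrow> b \<in> B \<Longrightarrow> jI y * jB b \<in> D"
  unfolding double_def by (rule complex_vector.span_base) blast

lemma D_induct [consumes 1, case_names zero add generator]:
  assumes "X \<in> D" "P 0"
    and "\<And>c X Y. X \<in> D \<Longrightarrow> P X \<Longrightarrow> Y \<in> D \<Longrightarrow> P Y \<Longrightarrow> P (c *\<^sub>C X + Y)"
    and "\<And>y b. y \<in> I \<Longrightarrow> b \<in> B \<Longrightarrow> P (jI y * jB b)"
  shows "P X"
proof -
  have "X \<in> D \<and> P X"
    using assms(1)[unfolded double_def]
  proof (induction rule: complex_vector.span_induct_alt)
    case base
    then show ?case using assms(2) D_subspace by (simp add: complex_vector.subspace_0)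
  next
    case (step c X Y)
    then obtain y b where "X = jI y * jB b" "y \<in> I" "b \<in> B" by blast
    then have "X \<in> D" "P X" using D_generator assms(4) by auto
    then show ?case using step assms(3) D_subspace
      by (simp add: complex_vector.subspace_add complex_vector.subspace_scale)
  qed
  then show ?thesis ..
qed

lemma D_eqI:
  assumes "X \<in> D" "clinear_on D F" "clinear_on D G"
    and "\<And>y b. y \<in> I \<Longrightarrow> b \<in> B \<Longrightarrow> F (jI y * jB b) = G (jI y * jB b)"
  shows "F X = G X"
  using assms(1)
proof (induction rule: D_induct)
  case zero
  have "0 \<in> D" using D_subspace by (simp add: complex_vector.subspace_0)
  then have "F (0 *\<^sub>C 0) = 0 *\<^sub>C F 0" "G (0 *\<^sub>C 0) = 0 *\<^sub>C G 0"
    using assms(2,3) unfolding clinear_on_def by blast+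
  then show ?case by simp
next
  case (add c X Y)
  then have "c *\<^sub>C X \<in> D" using D_subspace by (simp add: complex_vector.subspace_scale)
  then show ?case using add assms(2,3) by (simp add: clinear_on_def)
next
  case (generator y b)
  then show ?case by (rule assms(4))
qed

lemma D_mapsI:
  assumes "X \<in> D" "csubspace V" "clinear_on D F" "\<And>y b. y \<in> I \<Longrightarrow> b \<in> B \<Longrightarrow> F (jI y * jB b) \<in> V"
  shows "F X \<in> V"
  using assms(1)
proof (induction rule: D_induct)
  case zero
  have "0 \<in> D" using D_subspace by (simp add: complex_vector.subspace_0)
  then have "F (0 *\<^sub>C 0) = 0 *\<^sub>C F 0" using assms(3) unfolding clinear_on_def by blast
  then show ?case using assms(2) by (simp add: complex_vector.subspace_0)
next
  case (add c X Y)
  then have "c *\<^sub>C X \<in> D" using D_subspace by (simp add: complex_vector.subspace_scale)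
  then show ?case using add assms(2,3)
    by (simp add: clinear_on_def complex_vector.subspace_scale complex_vector.subspace_add)
next
  case (generator y b)
  then show ?case by (rule assms(4))
qed

lemma clinear_on_mult_left: "clinear_on D (\<lambda>X. Z * X)" and clinear_on_mult_right: "clinear_on D (\<lambda>X. X * Z)"
  by (simp_all add: clinear_on_def distrib_left distrib_right mult_scaleC_left mult_scaleC_right)

text \<open>A sum over the coproduct of \<open>b\<close> in \<open>A \<otimes> A\<close> takes no notice of \<open>B\<close>; a decomposition with first legs
  in \<open>B\<close> shows that it lies in the double.\<close>

lemma coprod_sum_D:
  assumes "b \<in> B" "clinear f" "\<And>q. f q \<in> I"
  shows "coprod_sum b (\<lambda>s q. jI (f q) * jB s) \<in> D"
proof -
  obtain ps where ps: "sweedler B b ps" using assms(1) by (rule sweedler_exists)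
  have "coprod_sum b (\<lambda>s q. jI (f q) * jB s) = (\<Sum>(s, q)\<leftarrow>ps. jI (f q) * jB s)"
    by (rule coprod_sum_sweedler[OF ps]) (intro clinear_double_intros assms(2))
  moreover have "(\<Sum>(s, q)\<leftarrow>qs. jI (f q) * jB s) \<in> D" if "\<forall>(s, q)\<in>set qs. s \<in> B" for qs
    using that D_subspace assms(3)
    by (induction qs) (auto simp: complex_vector.subspace_0 complex_vector.subspace_add D_generator)
  ultimately show ?thesis using ps by (simp add: sweedler_def)
qed

lemma D_mult_jB: "X \<in> D \<Longrightarrow> b \<in> B \<Longrightarrow> X * jB b \<in> D"
  by (erule D_mapsI[OF _ D_subspace clinear_on_mult_right])
    (simp add: mult.assoc jB_mult[symmetric] D_generator B_mult)

lemma jI_mult_D: "X \<in> D \<Longrightarrow> y \<in> I \<Longrightarrow> jI y * X \<in> D"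
  by (erule D_mapsI[OF _ D_subspace clinear_on_mult_left])
    (simp add: mult.assoc[symmetric] jI_mult[symmetric] D_generator I_mult)

lemma jB_jI_D: "y \<in> I \<Longrightarrow> b \<in> B \<Longrightarrow> jB b * jI y \<in> D"
  unfolding jB_jI by (rule coprod_sum_D) (auto intro!: clinear_double_intros I_ract)

lemma jB_mult_D: "X \<in> D \<Longrightarrow> b \<in> B \<Longrightarrow> jB b * X \<in> D"
  by (erule D_mapsI[OF _ D_subspace clinear_on_mult_left])
    (simp add: mult.assoc[symmetric] D_mult_jB jB_jI_D)

lemma D_mult_jI: "X \<in> D \<Longrightarrow> y \<in> I \<Longrightarrow> X * jI y \<in> D"
  by (erule D_mapsI[OF _ D_subspace clinear_on_mult_right])
    (simp add: mult.assoc jI_mult_D jB_jI_D)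

lemma D_mult: "X \<in> D \<Longrightarrow> Y \<in> D \<Longrightarrow> X * Y \<in> D"
  by (erule D_mapsI[OF _ D_subspace clinear_on_mult_right])
    (simp add: mult.assoc jI_mult_D jB_mult_D)

lemma D_sum_list:
  assumes "X \<in> D"
  obtains ps where "set ps \<subseteq> I \<times> B" "X = (\<Sum>(y, b)\<leftarrow>ps. jI y * jB b)"
  using assms[unfolded double_def]
proof (rule span_products_sum_list)
  show "\<exists>y'\<in>I. c *\<^sub>C (jI y * jB b) = jI y' * jB b" if "y \<in> I" for c y b
    using that I_subspace jI_linear
    by (intro bexI[of _ "c *\<^sub>C y"]) (simp_all add: clinear_iff mult_scaleC_left complex_vector.subspace_scale)
qed (use that in blast)

text \<open>The reversed order of the factors is what makes \<open>X\<^sup>* X\<close> a sum of terms \<open>y\<^sub>i\<^sup>* (b\<^sub>i\<^sup>* b\<^sub>j) y\<^sub>j\<close>.\<close>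

lemma D_sum_list':
  assumes "X \<in> D"
  obtains ps where "set ps \<subseteq> I \<times> B" "X = (\<Sum>(y, b)\<leftarrow>ps. jB b * jI y)"
proof -
  let ?V = "cspan {jB b * jI y |y b. y \<in> I \<and> b \<in> B}"
  have V: "csubspace ?V" by (rule complex_vector.subspace_span)
  have "X \<in> ?V" using assms
  proof (induction rule: D_induct)
    case (generator y b)
    obtain ps where ps: "sweedler B b ps" using generator(2) by (rule sweedler_exists)
    have "jI y * jB b = (\<Sum>(s, q)\<leftarrow>ps. jB s * jI (ract y q))"
      by (rule cross_relations(1)[OF generator ps])
    moreover have "(\<Sum>(s, q)\<leftarrow>qs. jB s * jI (ract y q)) \<in> ?V" if "\<forall>(s, q)\<in>set qs. s \<in> B" for qs
      using that
    proof (induction qs)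
      case (Cons sq qs)
      obtain s q where sq: "sq = (s, q)" "s \<in> B" using Cons.prems by (cases sq) auto
      have "jB s * jI (ract y q) \<in> {jB b * jI y |y b. y \<in> I \<and> b \<in> B}"
        using sq(2) I_ract[OF generator(1)] by blast
      then have "jB s * jI (ract y q) \<in> ?V" by (rule complex_vector.span_base)
      then show ?case using Cons sq by (auto intro!: complex_vector.subspace_add[OF V])
    qed (simp add: complex_vector.span_zero)
    ultimately show ?case using ps by (simp add: sweedler_def)
  qed (auto intro: complex_vector.span_add complex_vector.span_scale complex_vector.span_zero)
  then show ?thesis
  proof (rule span_products_sum_list)
    show "\<exists>y'\<in>I. c *\<^sub>C (jB b * jI y) = jB b * jI y'" if "y \<in> I" for c y b
      using that I_subspace jI_linear
      by (intro bexI[of _ "c *\<^sub>C y"]) (simp_all add: clinear_iff mult_scaleC_right complex_vector.subspace_scale)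
  qed (use that in blast)
qed

lemma tensor_iso:
  "\<exists>T. clinear_on (tensor_subspace I B) T \<and> bij_betw T (tensor_subspace I B) D \<and>
    (\<forall>y\<in>I. \<forall>b\<in>B. T (y \<boxtimes> b) = jI y * jB b)"
  using double unfolding is_double_def by (elim conjE)

lemma extend_to_D:
  assumes f: "cbilinear f"
  shows "\<exists>F. clinear_on D F \<and> (\<forall>y\<in>I. \<forall>b\<in>B. F (jI y * jB b) = f y b)"
proof -
  let ?S = "tensor_subspace I B"
  obtain T where "clinear_on ?S T \<and> bij_betw T ?S D \<and> (\<forall>y\<in>I. \<forall>b\<in>B. T (y \<boxtimes> b) = jI y * jB b)"
    using tensor_iso ..
  then have T: "clinear_on ?S T" "bij_betw T ?S D"
    and T_tens: "\<And>y b. y \<in> I \<Longrightarrow> b \<in> B \<Longrightarrow> T (y \<boxtimes> b) = jI y * jB b"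
    by simp_all
  have S: "csubspace ?S" by (simp add: tensor_subspace_def complex_vector.subspace_span)
  note inv = clinear_on_inv_into[OF S T(2,1)]
  show ?thesis
  proof (intro exI[of _ "\<lambda>X. tensor_lift f (inv_into ?S T X)"] conjI ballI)
    show "clinear_on D (\<lambda>X. tensor_lift f (inv_into ?S T X))"
      using inv clinear_tensor_lift[OF f] by (simp add: clinear_on_def clinear_iff)
    fix y b assume yb: "y \<in> I" "b \<in> B"
    then have "y \<boxtimes> b \<in> ?S"
      unfolding tensor_subspace_def by (intro complex_vector.span_base) blast
    then have "inv_into ?S T (jI y * jB b) = y \<boxtimes> b"
      using T(2) T_tens[OF yb] by (metis bij_betw_inv_into_left)
    then show "tensor_lift f (inv_into ?S T (jI y * jB b)) = f y b"
      by (simp add: tensor_lift_tens[OF f])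
  qed
qed

end


section \<open>The invariant functional on the double\<close>

locale double_functional = double_data B J d \<rho> I p g \<mu> \<nu> \<psi> \<sigma> jB jI
  for B :: "'a::cqg_hopf_star_algebra set"
    and J :: "'i set" and d :: "'i \<Rightarrow> nat" and \<rho> :: "'i \<Rightarrow> 'a dual \<Rightarrow> complex mat"
    and I :: "'a dual set" and p g \<mu> \<nu> :: "'a dual" and \<psi> :: "'a dual \<Rightarrow> complex"
    and \<sigma> :: "'a \<Rightarrow> 'a"
    and jB :: "'a \<Rightarrow> 'm::complex_star_algebra_1" and jI :: "'a dual \<Rightarrow> 'm" +
  fixes \<phi> :: "'m \<Rightarrow> complex" and \<sigma>D :: "'m \<Rightarrow> 'm"
  assumes phi_linear: "clinear_on D \<phi>"
    and phi_generator: "y \<in> I \<Longrightarrow> b \<in> B \<Longrightarrow> \<phi> (jI y * jB b) = \<psi> y * haar b"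
    and sigmaD_linear: "clinear_on D \<sigma>D"
    and sigmaD_generator: "y \<in> I \<Longrightarrow> b \<in> B \<Longrightarrow> \<sigma>D (jI y * jB b) = jI (\<kappa> y) * jB (\<theta> b)"
begin

lemma phi_sum_list: "set Xs \<subseteq> D \<Longrightarrow> \<phi> (sum_list Xs) = (\<Sum>X\<leftarrow>Xs. \<phi> X)"
  by (rule clinear_on_sum_list[OF D_subspace phi_linear])

lemma clinear_on_phi:
  assumes "clinear_on D F" "\<And>X. X \<in> D \<Longrightarrow> F X \<in> D"
  shows "clinear_on D (\<lambda>X. \<phi> (F X))"
  using assms phi_linear by (simp add: clinear_on_def)

lemma phi_coprod_sum:
  assumes b: "b \<in> B" and c: "c \<in> B" and f: "clinear f" "\<And>q. f q \<in> I"
  shows "\<phi> (coprod_sum b (\<lambda>s q. jI (f q) * jB s) * jB c) = coprod_sum b (\<lambda>s q. \<psi> (f q) * haar (s * c))"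
proof -
  obtain ps where ps: "sweedler B b ps" using b by (rule sweedler_exists)
  have "coprod_sum b (\<lambda>s q. jI (f q) * jB s) * jB c = coprod_sum b (\<lambda>s q. jI (f q) * jB s * jB c)"
    by (rule coprod_sum_mult_left)
  also have "\<dots> = (\<Sum>(s, q)\<leftarrow>ps. jI (f q) * jB s * jB c)"
    by (rule coprod_sum_sweedler[OF ps]) (intro clinear_double_intros f)
  also have "\<dots> = (\<Sum>(s, q)\<leftarrow>ps. jI (f q) * jB (s * c))"
    using ps c unfolding sweedler_def
    by (intro arg_cong[of _ _ sum_list] map_cong) (auto simp: jB_mult mult.assoc)
  also have "\<phi> \<dots> = (\<Sum>(s, q)\<leftarrow>ps. \<phi> (jI (f q) * jB (s * c)))"
    by (subst phi_sum_list)
      (use ps c f(2) in \<open>auto simp: sweedler_def o_def case_prod_unfold intro!: D_generator B_mult\<close>)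
  also have "\<dots> = (\<Sum>(s, q)\<leftarrow>ps. \<psi> (f q) * haar (s * c))"
    using ps c f(2) unfolding sweedler_def
    by (intro arg_cong[of _ _ sum_list] map_cong) (auto simp: phi_generator B_mult)
  also have "\<dots> = coprod_sum b (\<lambda>s q. \<psi> (f q) * haar (s * c))"
    by (rule coprod_sum_sweedler[OF ps, symmetric]) (intro clinear_double_intros f)
  finally show ?thesis .
qed

text \<open>Moving \<open>b\<close> past \<open>y\<close> leaves \<open>\<Phi>(b\<^sub>1) \<psi>(z (y \<lhd> S\<^sup>-\<^sup>1(b\<^sub>2)))\<close>, and \<open>\<Phi>(b\<^sub>1) b\<^sub>2 = \<Phi>(b) 1\<close> by invariance of the
  Haar state.\<close>

lemma phi_jI_jB_jI:
  assumes z: "z \<in> I" and b: "b \<in> B" and y: "y \<in> I"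
  shows "\<phi> (jI z * jB b * jI y) = \<psi> (z * y) * haar b"
proof -
  have "jI z * jB b * jI y = coprod_sum b (\<lambda>s q. jI z * (jI (ract y (antipode_inv q)) * jB s))"
    by (simp add: mult.assoc jB_jI[OF y b] coprod_sum_mult_right)
  also have "\<dots> = coprod_sum b (\<lambda>s q. jI (z * ract y (antipode_inv q)) * jB s) * jB 1"
    using z y by (simp add: jI_mult I_ract mult.assoc jB_one)
  also have "\<phi> \<dots> = coprod_sum b (\<lambda>s q. \<psi> (z * ract y (antipode_inv q)) * haar (s * 1))"
    by (rule phi_coprod_sum[OF b B_one]) (auto intro!: clinear_double_intros I_mult I_ract z y)
  also have "\<dots> = \<psi> (z * ract y (antipode_inv (coprod_sum b (\<lambda>s q. haar s *\<^sub>C q))))"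
    by (subst clinear_apply_tensor_lift[where F = "\<lambda>q. \<psi> (z * ract y (antipode_inv q))"])
      (auto intro!: clinear_double_intros simp: antipode_inv_linear[unfolded clinear_iff]
        ract_linear[unfolded clinear_iff] mult_scaleC_right psi_linear[unfolded clinear_iff] mult.commute)
  also have "\<dots> = \<psi> (z * y) * haar b"
    by (simp add: haar_right_invariant antipode_inv_linear[unfolded clinear_iff] antipode_inv_one
        ract_linear[unfolded clinear_iff] ract_one mult_scaleC_right psi_linear[unfolded clinear_iff])
  finally show ?thesis .
qed

text \<open>Here the leg \<open>b\<^sub>2\<close> comes out of \<open>\<psi>(y \<lhd> S\<^sup>-\<^sup>1(b\<^sub>2))\<close> as the number \<open>\<tau>(S\<^sup>-\<^sup>1(b\<^sub>2), g) = \<tau>(b\<^sub>2, g\<^sup>-\<^sup>1)\<close>.\<close>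

lemma phi_jB_jI_jB:
  assumes b: "b \<in> B" and y: "y \<in> I" and c: "c \<in> B"
  shows "\<phi> (jB b * (jI y * jB c)) = \<psi> y * haar (lact (ring_inverse g) b * c)"
proof -
  have "\<phi> (jB b * (jI y * jB c)) = coprod_sum b (\<lambda>s q. \<psi> (ract y (antipode_inv q)) * haar (s * c))"
    unfolding mult.assoc[symmetric] jB_jI[OF y b]
    by (rule phi_coprod_sum[OF b c]) (auto intro!: clinear_double_intros I_ract y)
  also have "\<dots> = coprod_sum b (\<lambda>s q. \<psi> y * haar ((tau q (ring_inverse g) *\<^sub>C s) * c))"
    by (simp add: psi_ract[OF y] grouplike_inverse(4)[OF grouplike] mult_scaleC_left
        haar_linear[unfolded clinear_iff] ac_simps)
  also have "\<dots> = \<psi> y * haar (lact (ring_inverse g) b * c)"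
    unfolding lact_def
    by (rule clinear_apply_tensor_lift[where F = "\<lambda>x. \<psi> y * haar (x * c)", symmetric]) (intro clinear_double_intros)
  finally show ?thesis .
qed

lemma phi_modular_jI:
  assumes x: "x \<in> I" and Y: "Y \<in> D"
  shows "\<phi> (jI x * Y) = \<phi> (Y * jI (\<kappa> x))"
  using Y
proof (rule D_eqI)
  show "clinear_on D (\<lambda>Y. \<phi> (jI x * Y))"
    by (rule clinear_on_phi[OF clinear_on_mult_left jI_mult_D[OF _ x]])
  show "clinear_on D (\<lambda>Y. \<phi> (Y * jI (\<kappa> x)))"
    by (rule clinear_on_phi[OF clinear_on_mult_right D_mult_jI[OF _ kappa_I[OF x]]])
  fix y c assume y: "y \<in> I" and c: "c \<in> B"
  have "\<phi> (jI x * (jI y * jB c)) = \<psi> (x * y) * haar c"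
    using x y c by (simp add: mult.assoc[symmetric] jI_mult[symmetric] phi_generator I_mult)
  also have "\<dots> = \<phi> (jI y * jB c * jI (\<kappa> x))"
    using trace_density_modular[OF density x[unfolded I_fin] y[unfolded I_fin] nu(1,3)]
    by (simp add: phi_jI_jB_jI[OF y c kappa_I[OF x]])
  finally show "\<phi> (jI x * (jI y * jB c)) = \<phi> (jI y * jB c * jI (\<kappa> x))" .
qed

lemma phi_modular_jB:
  assumes b: "b \<in> B" and Y: "Y \<in> D"
  shows "\<phi> (jB b * Y) = \<phi> (Y * jB (\<theta> b))"
  using Y
proof (rule D_eqI)
  show "clinear_on D (\<lambda>Y. \<phi> (jB b * Y))"
    by (rule clinear_on_phi[OF clinear_on_mult_left jB_mult_D[OF _ b]])
  show "clinear_on D (\<lambda>Y. \<phi> (Y * jB (\<theta> b)))"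
    by (rule clinear_on_phi[OF clinear_on_mult_right D_mult_jB[OF _ theta_B[OF b]]])
  fix y c assume y: "y \<in> I" and c: "c \<in> B"
  have "\<phi> (jB b * (jI y * jB c)) = \<psi> y * haar (c * \<theta> b)"
    by (simp add: phi_jB_jI_jB[OF b y c] sigma_modular[OF lact_in_B[OF b] c])
  also have "\<dots> = \<phi> (jI y * jB c * jB (\<theta> b))"
    using y c theta_B[OF b] by (simp add: mult.assoc jB_mult[symmetric] phi_generator B_mult)
  finally show "\<phi> (jB b * (jI y * jB c)) = \<phi> (jI y * jB c * jB (\<theta> b))" .
qed

lemma sigmaD_D: "X \<in> D \<Longrightarrow> \<sigma>D X \<in> D"
  by (erule D_mapsI[OF _ D_subspace sigmaD_linear]) (simp add: sigmaD_generator D_generator kappa_I theta_B)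

text \<open>The double is spanned by products \<open>xb\<close>, and the two factors may be moved around one after the other,
  since the intermediate products stay in the double.\<close>

lemma phi_modular:
  assumes X: "X \<in> D" and Y: "Y \<in> D"
  shows "\<phi> (X * Y) = \<phi> (Y * \<sigma>D X)"
  using X
proof (rule D_eqI)
  show "clinear_on D (\<lambda>X. \<phi> (X * Y))"
    by (rule clinear_on_phi[OF clinear_on_mult_right D_mult[OF _ Y]])
  show "clinear_on D (\<lambda>X. \<phi> (Y * \<sigma>D X))"
    by (rule clinear_on_phi) (use sigmaD_linear D_mult[OF Y sigmaD_D] in
        \<open>auto simp: clinear_on_def distrib_left mult_scaleC_right\<close>)
  fix x b assume x: "x \<in> I" and b: "b \<in> B"
  have "\<phi> (jI x * jB b * Y) = \<phi> (jI x * (jB b * Y))" by (simp add: mult.assoc)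
  also have "\<dots> = \<phi> (jB b * (Y * jI (\<kappa> x)))"
    by (simp add: phi_modular_jI[OF x jB_mult_D[OF Y b]] mult.assoc)
  also have "\<dots> = \<phi> (Y * \<sigma>D (jI x * jB b))"
    unfolding phi_modular_jB[OF b D_mult_jI[OF Y kappa_I[OF x]]] sigmaD_generator[OF x b]
    by (simp only: mult.assoc)
  finally show "\<phi> (jI x * jB b * Y) = \<phi> (Y * \<sigma>D (jI x * jB b))" .
qed

text \<open>It suffices to test against \<open>Z = (g \<rhd> c) z\<close>: for \<open>W = \<Sum> y\<^sub>i b\<^sub>i\<close> one gets
  \<open>\<phi>(ZW) = \<Sum> \<psi>(z y\<^sub>i) \<Phi>(c b\<^sub>i)\<close>, and the forms of \<open>\<Phi>\<close> on \<open>B\<close> and of \<open>\<psi>\<close> on \<open>I\<close> are both nondegenerate.\<close>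

lemma phi_nondegenerate:
  assumes W: "W \<in> D" and zero: "\<And>Z. Z \<in> D \<Longrightarrow> \<phi> (Z * W) = 0"
  shows "W = 0"
proof -
  obtain ps where ps: "set ps \<subseteq> I \<times> B" and W_eq: "W = (\<Sum>(y, b)\<leftarrow>ps. jI y * jB b)"
    using W by (rule D_sum_list)
  have "(\<Sum>(y, b)\<leftarrow>ps. jI y * jB b) = 0"
  proof (rule sum_list_zero_by_functionals[OF B_subspace])
    show "b \<in> B" if "(y, b) \<in> set ps" for y b using that ps by auto
    show "clinear_on B (\<lambda>b. jI y * jB b)" for y
      using jB_linear by (simp add: clinear_on_def clinear_iff distrib_left mult_scaleC_right)
    fix r :: "'a \<Rightarrow> complex" and v
    assume r: "clinear r" and v: "v \<in> B"
    define y where "y = (\<Sum>(y, b)\<leftarrow>ps. r b *\<^sub>C y)"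
    have in_I: "(\<Sum>(y, b)\<leftarrow>qs. r b *\<^sub>C y) \<in> I" if "set qs \<subseteq> I \<times> B" for qs
      using that I_subspace
      by (induction qs) (auto simp: complex_vector.subspace_0 complex_vector.subspace_add complex_vector.subspace_scale)
    have "\<psi> (z * y) = 0" if z: "z \<in> I" for z
    proof -
      define u where "u = (\<Sum>(y, b)\<leftarrow>ps. \<psi> (z * y) *\<^sub>C b)"
      have "(\<Sum>(y, b)\<leftarrow>qs. \<psi> (z * y) *\<^sub>C b) \<in> B" if "set qs \<subseteq> I \<times> B" for qs
        using that B_subspace
        by (induction qs) (auto simp: complex_vector.subspace_0 complex_vector.subspace_add complex_vector.subspace_scale)
      then have u: "u \<in> B" using ps by (simp add: u_def)
      \<comment> \<open>\<open>\<phi>\<close> applies \<open>g\<^sup>-\<^sup>1\<close> to the left factor, so this tests \<open>u\<close> against itself\<close>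
      let ?c = "lact g (star u)"
      have c: "?c \<in> B" by (intro lact_in_B B_star u)
      have "jB ?c * jI z * W = (\<Sum>(y, b)\<leftarrow>ps. jB ?c * (jI z * (jI y * jB b)))"
        unfolding W_eq by (simp add: sum_list_const_mult[symmetric] o_def case_prod_unfold mult.assoc)
      also have "\<dots> = (\<Sum>(y, b)\<leftarrow>ps. jB ?c * (jI (z * y) * jB b))"
        using ps z by (intro arg_cong[of _ _ sum_list] map_cong) (auto simp: jI_mult mult.assoc)
      also have "\<phi> \<dots> = (\<Sum>(y, b)\<leftarrow>ps. \<phi> (jB ?c * (jI (z * y) * jB b)))"
        by (subst phi_sum_list)
          (use ps z c in \<open>auto simp: o_def case_prod_unfold intro!: jB_mult_D D_generator I_mult\<close>)
      also have "\<dots> = (\<Sum>(y, b)\<leftarrow>ps. \<psi> (z * y) * haar (star u * b))"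
        using ps z c
        by (intro arg_cong[of _ _ sum_list] map_cong) (auto simp: phi_jB_jI_jB I_mult lact_inverse)
      also have "\<dots> = haar (star u * u)"
      proof -
        have "clinear (\<lambda>b. haar (star u * b))" by (intro clinear_double_intros)
        from clinear_sum_list[OF this, of "map (\<lambda>(y, b). \<psi> (z * y) *\<^sub>C b) ps", folded u_def]
        show ?thesis
          by (simp add: o_def case_prod_unfold mult_scaleC_right haar_linear[unfolded clinear_iff])
      qed
      finally have "haar (star u * u) = 0"
        using zero[OF jB_jI_D[OF z c]] by simp
      then have "u = 0" by (rule haar_faithful)
      then have "0 = r u" using clinear_sum_list[OF r, of "[]"] by simp
      also have "\<dots> = (\<Sum>(y, b)\<leftarrow>ps. r b * \<psi> (z * y))"
        unfolding u_def clinear_sum_list[OF r] using r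
        by (simp add: o_def case_prod_unfold clinear_iff mult.commute)
      also have "\<dots> = \<psi> (z * y)"
      proof -
        have "clinear (\<lambda>y. \<psi> (z * y))" by (intro clinear_double_intros)
        from clinear_sum_list[OF this, of "map (\<lambda>(y, b). r b *\<^sub>C y) ps", folded y_def]
        show ?thesis
          by (simp add: o_def case_prod_unfold mult_scaleC_right psi_linear[unfolded clinear_iff])
      qed
      finally show ?thesis by simp
    qed
    then have "y = 0"
      using I_range in_I[OF ps]
      by (intro invariant_functional_nondegenerate[OF support grouplike psi_linear psi_invariant])
        (auto simp: y_def intro: I_full)
    then have "jI y * jB v = 0" using clinear_sum_list[OF jI_linear, of "[]"] by simp
    moreover have "jI y * jB v = (\<Sum>(y, b)\<leftarrow>ps. r b *\<^sub>C (jI y * jB v))"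
    proof -
      have "clinear (\<lambda>y. jI y * jB v)" by (intro clinear_double_intros)
      from clinear_sum_list[OF this, of "map (\<lambda>(y, b). r b *\<^sub>C y) ps", folded y_def]
      show ?thesis
        by (simp add: o_def case_prod_unfold mult_scaleC_left jI_linear[unfolded clinear_iff])
    qed
    ultimately show "(\<Sum>(y, b)\<leftarrow>ps. r b *\<^sub>C (jI y * jB v)) = 0" by simp
  qed
  then show ?thesis by (simp add: W_eq)
qed

text \<open>Modularity determines \<open>\<sigma>(XY)\<close>: both sides represent the functional \<open>Z \<mapsto> \<phi>(XYZ)\<close>, and \<open>\<phi>\<close> is nondegenerate.
  A direct check against the commutation relations would need to know how \<open>\<kappa>\<close> and \<open>\<sigma>\<^sub>B\<close> interact with
  the coproduct.\<close>

lemma sigmaD_mult: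
  assumes X: "X \<in> D" and Y: "Y \<in> D"
  shows "\<sigma>D (X * Y) = \<sigma>D X * \<sigma>D Y"
proof -
  let ?W = "\<sigma>D (X * Y) - \<sigma>D X * \<sigma>D Y"
  have m: "\<sigma>D (X * Y) \<in> D" "\<sigma>D X * \<sigma>D Y \<in> D" "\<sigma>D X \<in> D" "X * Y \<in> D"
    using X Y by (auto intro: sigmaD_D D_mult)
  have "?W = 0"
  proof (rule phi_nondegenerate)
    show "?W \<in> D" using m D_subspace by (simp add: complex_vector.subspace_diff)
    fix Z assume Z: "Z \<in> D"
    have "\<phi> (Z * \<sigma>D (X * Y)) = \<phi> (X * (Y * Z))"
      by (simp add: phi_modular[OF m(4) Z, symmetric] mult.assoc)
    also have "\<dots> = \<phi> (Y * (Z * \<sigma>D X))"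
      by (simp add: phi_modular[OF X D_mult[OF Y Z]] mult.assoc)
    also have "\<dots> = \<phi> (Z * (\<sigma>D X * \<sigma>D Y))"
      by (simp add: phi_modular[OF Y D_mult[OF Z m(3)]] mult.assoc)
    finally have eq: "\<phi> (Z * \<sigma>D (X * Y)) = \<phi> (Z * (\<sigma>D X * \<sigma>D Y))" .
    have "Z * \<sigma>D (X * Y) = Z * ?W + Z * (\<sigma>D X * \<sigma>D Y)" by (simp add: right_diff_distrib)
    then have "\<phi> (Z * \<sigma>D (X * Y)) = \<phi> (Z * ?W) + \<phi> (Z * (\<sigma>D X * \<sigma>D Y))"
      using phi_linear D_mult[OF Z \<open>?W \<in> D\<close>] D_mult[OF Z m(2)] by (simp add: clinear_on_def)
    then show "\<phi> (Z * ?W) = 0" using eq by simp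
  qed
  then show ?thesis by simp
qed

text \<open>The inverse is built in the same way, from \<open>\<kappa>\<^sup>-\<^sup>1\<close> and \<open>b \<mapsto> g \<rhd> \<sigma>\<^sub>B\<^sup>-\<^sup>1(b)\<close>.\<close>

lemma sigmaD_bij: "bij_betw \<sigma>D D D"
proof -
  have "clinear_on B \<sigma>" using sigma_linear by (simp add: clinear_on_def clinear_iff)
  note inv_linear = clinear_on_inv_into[OF B_subspace sigma_bij this]
  obtain \<tau> where \<tau>: "clinear \<tau>" "\<And>b. b \<in> B \<Longrightarrow> \<tau> b = inv_into B \<sigma> b"
    using clinear_on_extend[OF B_subspace inv_linear] by metis
  have \<tau>\<sigma>: "\<tau> (\<sigma> b) = b" "\<sigma> (\<tau> b) = b" "\<tau> b \<in> B" if "b \<in> B" for b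
    using that sigma_B[OF that] sigma_bij \<tau>(2)
    by (auto simp: bij_betw_inv_into_left bij_betw_inv_into_right bij_betw_def inv_into_into)
  have "cbilinear (\<lambda>y b. jI (\<nu> * y * \<mu>) * jB (lact g (\<tau> b)))"
    by (intro clinear_double_intros clinear_compose[OF \<tau>(1)])
  from extend_to_D[OF this] obtain F where F: "clinear_on D F"
      "\<forall>y\<in>I. \<forall>b\<in>B. F (jI y * jB b) = jI (\<nu> * y * \<mu>) * jB (lact g (\<tau> b))"
    by (elim exE conjE)
  note F_generator = F(2)[rule_format] and F = F(1)
  have I': "\<nu> * y * \<mu> \<in> I" if "y \<in> I" for y using that by (intro I_conj nu mu_full)
  have B': "lact g (\<tau> b) \<in> B" if "b \<in> B" for b using that by (intro lact_in_B \<tau>\<sigma>)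
  have F_D: "F X \<in> D" if "X \<in> D" for X
    using that by (rule D_mapsI[OF _ D_subspace F]) (simp add: F_generator D_generator I' B')
  have inv: "\<nu> * (\<mu> * y * \<nu>) * \<mu> = y" "\<mu> * (\<nu> * y * \<mu>) * \<nu> = y" for y
  proof -
    have "\<nu> * (\<mu> * y * \<nu>) * \<mu> = (\<nu> * \<mu>) * y * (\<nu> * \<mu>)" by (simp only: mult.assoc)
    then show "\<nu> * (\<mu> * y * \<nu>) * \<mu> = y" by (simp add: nu)
    have "\<mu> * (\<nu> * y * \<mu>) * \<nu> = (\<mu> * \<nu>) * y * (\<mu> * \<nu>)" by (simp only: mult.assoc)
    then show "\<mu> * (\<nu> * y * \<mu>) * \<nu> = y" by (simp add: nu)
  qed
  have id: "clinear_on D (\<lambda>X. X)" by (simp add: clinear_on_def)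
  have "F (\<sigma>D X) = X" if "X \<in> D" for X
    using that
  proof (rule D_eqI[OF _ _ id])
    show "clinear_on D (\<lambda>X. F (\<sigma>D X))" using F sigmaD_linear sigmaD_D by (simp add: clinear_on_def)
    show "F (\<sigma>D (jI y * jB b)) = jI y * jB b" if "y \<in> I" "b \<in> B" for y b
      using that by (simp add: sigmaD_generator F_generator kappa_I theta_B \<tau>\<sigma> lact_in_B lact_inverse inv)
  qed
  moreover have "\<sigma>D (F X) = X" if "X \<in> D" for X
    using that
  proof (rule D_eqI[OF _ _ id])
    show "clinear_on D (\<lambda>X. \<sigma>D (F X))" using F sigmaD_linear F_D by (simp add: clinear_on_def)
    show "\<sigma>D (F (jI y * jB b)) = jI y * jB b" if "y \<in> I" "b \<in> B" for y b
      using that by (simp add: sigmaD_generator F_generator I' B' \<tau>\<sigma> lact_inverse inv)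
  qed
  ultimately show ?thesis using sigmaD_D F_D by (intro bij_betwI[of _ _ _ F]) auto
qed

text \<open>For \<open>X = \<Sum> b\<^sub>i y\<^sub>i\<close> the value \<open>\<phi>(X\<^sup>* X)\<close> is the sum of the entries of the Schur product of the Gram matrices
  \<open>\<psi>(y\<^sub>i\<^sup>* y\<^sub>j)\<close> and \<open>\<Phi>(b\<^sub>i\<^sup>* b\<^sub>j)\<close>.\<close>

lemma phi_positive:
  assumes "X \<in> D"
  shows "0 \<le> \<phi> (star X * X)"
proof -
  obtain ps where ps: "set ps \<subseteq> I \<times> B" and X: "X = (\<Sum>(y, b)\<leftarrow>ps. jB b * jI y)"
    using assms by (rule D_sum_list')
  let ?N = "{..<length ps}"
  define y where "y i = fst (ps ! i)" for i
  define b where "b i = snd (ps ! i)" for i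
  have yb: "y i \<in> I" "b i \<in> B" if "i \<in> ?N" for i
  proof -
    have "ps ! i \<in> set ps" using that by simp
    then have "ps ! i \<in> I \<times> B" using ps by blast
    then show "y i \<in> I" "b i \<in> B" by (auto simp: y_def b_def)
  qed
  have X_sum: "X = (\<Sum>i\<in>?N. jB (b i) * jI (y i))"
    by (simp add: X sum_list_sum_nth y_def b_def case_prod_unfold atLeast0LessThan)
  have star_sum: "star (\<Sum>i\<in>F. f i) = (\<Sum>i\<in>F. star (f i))" for F :: "nat set" and f :: "nat \<Rightarrow> 'm"
    by (induction F rule: infinite_finite_induct) (simp_all add: star_add)
  have summand: "star (jB (b i) * jI (y i)) * (jB (b j) * jI (y j)) = jI (star (y i)) * jB (star (b i) * b j) * jI (y j)"
    if "i \<in> ?N" "j \<in> ?N" for i j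
    using yb[OF that(1)] yb[OF that(2)] by (simp add: star_mult jI_star jB_star jB_mult B_star mult.assoc)
  have mem: "jI (star (y i)) * jB (star (b i) * b j) * jI (y j) \<in> D" if "i \<in> ?N" "j \<in> ?N" for i j
    using yb[OF that(1)] yb[OF that(2)] by (intro D_mult_jI D_generator I_star B_mult B_star)
  have phi_sum: "\<phi> (\<Sum>i\<in>F. f i) = (\<Sum>i\<in>F. \<phi> (f i)) \<and> (\<Sum>i\<in>F. f i) \<in> D" if "finite F" "\<And>i. i \<in> F \<Longrightarrow> f i \<in> D"
    for F :: "nat set" and f
    using that
  proof induction
    case empty
    have "0 \<in> D" using D_subspace by (simp add: complex_vector.subspace_0)
    then show ?case using phi_sum_list[of "[]"] by simp
  next
    case (insert i F)
    then show ?case using phi_linear D_subspace by (simp add: clinear_on_def complex_vector.subspace_add)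
  qed
  have "star X * X = (\<Sum>i\<in>?N. \<Sum>j\<in>?N. jI (star (y i)) * jB (star (b i) * b j) * jI (y j))"
    unfolding X_sum star_sum sum_product by (intro sum.cong refl summand)
  moreover have "\<phi> (\<Sum>j\<in>?N. jI (star (y i)) * jB (star (b i) * b j) * jI (y j))
        = (\<Sum>j\<in>?N. \<phi> (jI (star (y i)) * jB (star (b i) * b j) * jI (y j)))"
      "(\<Sum>j\<in>?N. jI (star (y i)) * jB (star (b i) * b j) * jI (y j)) \<in> D" if "i \<in> ?N" for i
    using phi_sum[of ?N "\<lambda>j. jI (star (y i)) * jB (star (b i) * b j) * jI (y j)"] mem[OF that] by auto
  ultimately have "\<phi> (star X * X) = (\<Sum>i\<in>?N. \<Sum>j\<in>?N. \<phi> (jI (star (y i)) * jB (star (b i) * b j) * jI (y j)))"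
    using phi_sum[of ?N "\<lambda>i. \<Sum>j\<in>?N. jI (star (y i)) * jB (star (b i) * b j) * jI (y j)"] by simp
  also have "\<dots> = (\<Sum>i\<in>?N. \<Sum>j\<in>?N. \<psi> (star (y i) * y j) * haar (star (b i) * b j))"
    using yb by (intro sum.cong refl phi_jI_jB_jI I_star B_mult B_star)
  also have "0 \<le> \<dots>"
  proof (rule schur_product_nonneg[OF finite_lessThan _ psd_kernel_haar])
    show "psd_kernel ?N (\<lambda>i j. \<psi> (star (y i) * y j))"
      using I_subspace yb(1)
    proof (rule psd_kernel_gram)
      show "clinear (\<lambda>z. \<psi> (star y * z))" for y by (intro clinear_double_intros)
      show "0 \<le> \<psi> (star z * z)" if "z \<in> I" for z
        using trace_density_positive[OF density] that by (simp add: I_fin)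
    qed (simp_all add: dual_star_add dual_star_scale distrib_right mult_scaleC_left
        psi_linear[unfolded clinear_iff])
  qed
  finally show ?thesis .
qed

end


theorem proposition2p2:
  fixes B :: "'a::cqg_hopf_star_algebra set"
    and \<sigma>B :: "'a \<Rightarrow> 'a"
    and J :: "'i set" and d :: "'i \<Rightarrow> nat" and \<rho> :: "'i \<Rightarrow> 'a dual \<Rightarrow> complex mat"
    and \<Phi>C g \<mu> :: "'a dual"
    and \<psi> :: "'a dual \<Rightarrow> complex"
    and jB :: "'a \<Rightarrow> 'm::complex_star_algebra_1" and jI :: "'a dual \<Rightarrow> 'm"
    and L :: "'a dual \<Rightarrow> 'm \<Rightarrow> 'm" and R :: "'m \<Rightarrow> 'a \<Rightarrow> 'm"
    and I :: "'a dual set" and D :: "'m set" and \<kappa> :: "'a dual \<Rightarrow> 'a dual"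
  assumes "right_coideal_star_subalgebra B"
    and "modular_automorphism B \<sigma>B"
    and "complete_irreps B J d \<rho>"
    and I_def: "I = fin_I B J d \<rho>"
    and "support_projection B J d \<rho> \<Phi>C"
    and "I = {ract \<Phi>C a |a. True}"
    and "grouplike g" and "dual_positive g"
    and "balanced g \<Phi>C"
    and "invariant_functional I \<Phi>C g \<psi>"
    and "trace_density B J d \<rho> \<psi> \<mu>"
    and \<kappa>_def: "\<And>x. \<kappa> x = \<mu> * x * ring_inverse \<mu>"
    and "is_double B I jB jI"
    and D_def: "D = double B I jB jI"
    and "double_bimodule B I jB jI L R"
  shows "\<exists>\<phi>D \<sigma>D.
    clinear_on D \<phi>D \<and>
    (\<forall>x\<in>I. \<forall>b\<in>B. \<phi>D (jI x * jB b) = \<psi> x * haar b) \<and>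
    (\<forall>X\<in>D. 0 \<le> \<phi>D (star X * X)) \<and>
    algebra_automorphism_on D \<sigma>D \<and>
    (\<forall>y\<in>I. \<forall>b\<in>B. \<sigma>D (jI y * jB b) = jI (\<kappa> y) * jB (\<sigma>B (lact (ring_inverse g) b))) \<and>
    (\<forall>X\<in>D. \<forall>Y\<in>D. \<phi>D (X * Y) = \<phi>D (Y * \<sigma>D X)) \<and>
    (\<forall>x a. \<forall>y\<in>I. \<forall>b\<in>B.
      \<phi>D (R (L x (jI y * jB b)) a) = tau 1 x * \<phi>D (jI y * jB b) * tau a g)"
proof -
  interpret B: coideal_irreps B J d \<rho>
    by unfold_locales (use assms in simp_all)
  have B_subspace: "csubspace B" by (rule B.B_subspace)
  have I_full: "x \<in> full_I B" if "x \<in> I" for x using that I_def by (simp add: fin_I_def)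
  have I_subspace: "csubspace I"
    unfolding assms(6) by (rule ract_range_subspace)
  have \<sigma>B: "bij_betw \<sigma>B B B" "clinear_on B \<sigma>B"
    and \<sigma>B_mod: "\<And>b c. b \<in> B \<Longrightarrow> c \<in> B \<Longrightarrow> haar (b * c) = haar (c * \<sigma>B b)"
    using assms(2) by (auto simp: modular_automorphism_def algebra_automorphism_on_def)
  have lin: "clinear_on B jB" "clinear_on I jI" "clinear_on I \<psi>"
    using assms(13,10) by (simp_all add: is_double_def invariant_functional_def)
  obtain \<psi>' where \<psi>': "clinear \<psi>'" "\<And>x. x \<in> I \<Longrightarrow> \<psi>' x = \<psi> x"
    using clinear_on_extend[OF I_subspace lin(3)] by metis
  obtain jI' where jI': "clinear jI'" "\<And>x. x \<in> I \<Longrightarrow> jI' x = jI x"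
    using clinear_on_extend[OF I_subspace lin(2)] by metis
  obtain jB' where jB': "clinear jB'" "\<And>x. x \<in> B \<Longrightarrow> jB' x = jB x"
    using clinear_on_extend[OF B_subspace lin(1)] by metis
  obtain \<sigma>' where \<sigma>': "clinear \<sigma>'" "\<And>x. x \<in> B \<Longrightarrow> \<sigma>' x = \<sigma>B x"
    using clinear_on_extend[OF B_subspace \<sigma>B(2)] by metis
  obtain \<nu> where \<nu>: "\<nu> \<in> full_I B" "\<mu> * \<nu> = 1" "\<nu> * \<mu> = 1"
    using assms(11) by (auto simp: trace_density_def)
  have \<kappa>: "\<kappa> x = \<mu> * x * \<nu>" for x
    by (simp add: \<kappa>_def ring_inverse_eqI[OF \<nu>(2,3)])
  have D': "double B I jB' jI' = D"
    unfolding D_def by (rule double_cong[OF jB'(2) jI'(2)])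
  interpret E: double_data B J d \<rho> I \<Phi>C g \<mu> \<nu> \<psi>' \<sigma>' jB' jI'
  proof unfold_locales
    show "I = fin_I B J d \<rho>" by fact
    show "support_projection B J d \<rho> \<Phi>C" by fact
    show range: "I = {ract \<Phi>C a |a. True}" by fact
    show "grouplike g" by fact
    show "\<psi>' (ract \<Phi>C a) = tau a g" for a
    proof -
      have "ract \<Phi>C a \<in> I" using range by blast
      then show ?thesis using \<psi>'(2) assms(10) by (simp add: invariant_functional_def)
    qed
    show "trace_density B J d \<rho> \<psi>' \<mu>"
      using assms(11) \<psi>'(2) by (simp add: trace_density_def I_def)
    show "bij_betw \<sigma>' B B" using \<sigma>B(1) \<sigma>'(2) by (metis bij_betw_cong)
    show "haar (b * c) = haar (c * \<sigma>' b)" if "b \<in> B" "c \<in> B" for b c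
      using \<sigma>B_mod[OF that] \<sigma>'(2) that by simp
    show "is_double B I jB' jI'"
    proof (rule is_double_cong[OF assms(13,1) _ _ _ I_subspace jB'(2) jI'(2)])
      show "x * y \<in> I" if "x \<in> I" "y \<in> I" for x y
        using that B.fin_I_mult(1)[of x y] I_full[OF that(2)] by (simp add: I_def)
      show "star x \<in> I" if "x \<in> I" for x using that by (simp add: I_def B.fin_I_star)
      show "ract x a \<in> I" if "x \<in> I" for x a using that unfolding range by (auto simp: ract_ract)
    qed
  qed (fact \<nu> \<psi>'(1) jI'(1) jB'(1) \<sigma>'(1))+
  note lins = E.clinear_double_intros
  have "cbilinear (\<lambda>y b. \<psi>' y * haar b)" by (intro lins)
  from E.extend_to_D[OF this, unfolded D'] obtain \<phi> where \<phi>: "clinear_on D \<phi>"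
      "\<forall>y\<in>I. \<forall>b\<in>B. \<phi> (jI' y * jB' b) = \<psi>' y * haar b"
    by (elim exE conjE)
  have "cbilinear (\<lambda>y b. jI' (\<mu> * y * \<nu>) * jB' (\<sigma>' (lact (ring_inverse g) b)))" by (intro lins)
  from E.extend_to_D[OF this, unfolded D'] obtain \<sigma>D where \<sigma>D: "clinear_on D \<sigma>D"
      "\<forall>y\<in>I. \<forall>b\<in>B. \<sigma>D (jI' y * jB' b) = jI' (\<mu> * y * \<nu>) * jB' (\<sigma>' (lact (ring_inverse g) b))"
    by (elim exE conjE)
  interpret F: double_functional B J d \<rho> I \<Phi>C g \<mu> \<nu> \<psi>' \<sigma>' jB' jI' \<phi> \<sigma>D
    by unfold_locales (use \<phi> \<sigma>D in \<open>simp_all add: D'\<close>)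
  have gen: "jI y * jB b = jI' y * jB' b" if "y \<in> I" "b \<in> B" for y b
    using that by (simp add: jI' jB')
  show ?thesis
  proof (intro exI conjI ballI allI)
    show "clinear_on D \<phi>" by (rule \<phi>(1))
    show "\<phi> (jI x * jB b) = \<psi> x * haar b" if "x \<in> I" "b \<in> B" for x b
      using that by (simp add: gen \<phi>(2) \<psi>'(2))
    show "0 \<le> \<phi> (star X * X)" if "X \<in> D" for X
      using F.phi_positive that unfolding D' .
    show "algebra_automorphism_on D \<sigma>D"
      using F.sigmaD_bij F.sigmaD_mult \<sigma>D(1) by (simp add: algebra_automorphism_on_def D')
    show "\<sigma>D (jI y * jB b) = jI (\<kappa> y) * jB (\<sigma>B (lact (ring_inverse g) b))" if "y \<in> I" "b \<in> B" for y b
      using E.kappa_I[OF that(1)] E.theta_B[OF that(2)] B.lact_in_B[OF that(2)]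
      unfolding gen[OF that] \<sigma>D(2)[rule_format, OF that]
      by (simp add: \<kappa> jI'(2) jB'(2) \<sigma>'(2))
    show "\<phi> (X * Y) = \<phi> (Y * \<sigma>D X)" if "X \<in> D" "Y \<in> D" for X Y
      using F.phi_modular that unfolding D' by blast
    show "\<phi> (R (L x (jI y * jB b)) a) = tau 1 x * \<phi> (jI y * jB b) * tau a g" if "y \<in> I" "b \<in> B" for x a y b
    proof -
      have "R (L x (jI y * jB b)) a = jI (ract y a) * jB (lact x b)"
        using assms(15) that B.lact_in_B[OF that(2)] by (simp add: double_bimodule_def)
      then show ?thesis
        using that by (simp add: gen \<phi>(2) E.I_ract B.lact_in_B E.psi_ract haar_lact mult_ac)
    qed
  qed
qed

end
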